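(* Let $\mathsf R$ be a Reedy category and $\mathsf M$ a model category. The category $\mathsf M^{\mathsf R}$ of Reedy diagrams is the category of bialgebras with respect to the monad on $\mathsf M^{\mathrm{Ob}\,\mathsf R}$ induced by the direct subcategory $\mathsf R^+\subset\mathsf R$ and the comonad on $\mathsf M^{\mathrm{Ob}\,\mathsf R}$ induced by the inverse subcategory $\mathsf R^-\subset\mathsf R$. The Reedy model structure on $\mathsf M^{\mathsf R}$ is left-induced from the projective model structure on $\mathsf M^{\mathsf R^+}$ (along restriction $\mathsf M^{\mathsf R}\to\mathsf M^{\mathsf R^+}$) and right-induced from the injective model structure on $\mathsf M^{\mathsf R^-}$ (along restriction $\mathsf M^{\mathsf R}\to\mathsf M^{\mathsf R^-}$).
   Context: A Reedy category is a small category $\mathsf R$ with a degree function $d\colon\mathrm{Ob}\,\mathsf R\to\mathbb N$ and wide subcategories $\mathsf R^+,\mathsf R^-$ such that non-identity morphisms of $\mathsf R^+$ strictly raise degree, non-identity morphisms of $\mathsf R^-$ strictly lower degree, and every morphism factors uniquely as a morphism of $\mathsf R^-$ followed by a morphism of $\mathsf R^+$. For $\Phi\in\mathsf M^{\mathsf R}$ and $r\in\mathsf R$, the latching object $L_r\Phi$ is the colimit of $\Phi$ over the category of objects over $r$ in $\mathsf R^+$ whose source has degree less than that of $r$ (with morphisms in $\mathsf R^+$), and the matching object $M_r\Phi$ is the limit of $\Phi$ over the category of objects under $r$ in $\mathsf R^-$ whose target has degree less than that of $r$. In the Reedy model structure, $\tau\colon\Phi\to\Psi$ is a weak equivalence if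 each $\tau_r$ is one; a cofibration if each relative latching map $\Phi(r)\sqcup_{L_r\Phi}L_r\Psi\to\Psi(r)$ is a cofibration in $\mathsf M$; a fibration if each relative matching map $\Phi(r)\to M_r\Phi\times_{M_r\Psi}\Psi(r)$ is a fibration in $\mathsf M$. The projective model structure on $\mathsf M^{\mathsf R^+}$ has weak equivalences and fibrations defined objectwise; the injective model structure on $\mathsf M^{\mathsf R^-}$ has weak equivalences and cofibrations defined objectwise (both exist for any model category $\mathsf M$). Left-induced (resp. right-induced) along a functor means that cofibrations (resp. fibrations) and weak equivalences are exactly the maps sent by the functor to such. The monad $T$ on $\mathsf M^{\mathrm{Ob}\,\mathsf R}$ is the one of the adjunction (left Kan extension $\dashv$ restriction) between $\mathsf M^{\mathrm{Ob}\,\mathsf R}$ and $\mathsf M^{\mathsf R^+}$, so $T\Phi(r)=\coprod_{x}\coprod_{\mathsf R^+(x,r)}\Phi(x)$; the comonad $K$ is the one of the adjunction (restriction $\dashv$ right Kan extension) between $\mathsf M^{\mathsf R^-}$ and $\mathsf M^{\mathrm{Ob}\,\mathsf R}$, so $K\Phi(r)=\prod_y\prod_{\mathsf R^-(r,y)}\Phi(y)$. The distributive law $\chi\colon TK\Rightarrow KT$ has, at $\Phi$ and $r$, the component indexed by $f\in\mathsf R^+(x,r)$ and $g\in\mathsf R^-(r,y)$ given as follows: factor $gf=iq$ with $q\in\mathsf R^-(x,z)$, $i\in\mathsf R^+(z,y)$, project $K\Phi(x)=\prod\Phi$ to the factor $\Phi(z)$ indexed by $q$, and include $\Phi(z)$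 into $T\Phi(y)$ via the summand indexed by $i$. A bialgebra is an object $X$ with a $T$-algebra structure $a\colon TX\to X$ and a $K$-coalgebra structure $k\colon X\to KX$ such that $k\circ a=Ka\circ\chi_X\circ Tk$. *)

theory Defs
  imports "HOL-Library.FuncSet" "HOL-Library.Infinite_Typeclass"
begin

section \<open>Categories, functors, natural transformations\<close>

record ('o, 'm) cat =
  Obj :: "'o set"
  Arr :: "'m set"
  Dom :: "'m \<Rightarrow> 'o"
  Cod :: "'m \<Rightarrow> 'o"
  Id :: "'o \<Rightarrow> 'm"
  Comp :: "'m \<Rightarrow> 'm \<Rightarrow> 'm" (infixl "\<cdot>\<index>" 70)

definition hom :: "('o, 'm) cat \<Rightarrow> 'o \<Rightarrow> 'o \<Rightarrow> 'm set" where
  "hom C x y = {f \<in> Arr C. Dom C f = x \<and> Cod C f = y}"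

locale category =
  fixes C :: "('o, 'm) cat" (structure)
  assumes Dom_Obj: "f \<in> Arr C \<Longrightarrow> Dom C f \<in> Obj C"
    and Cod_Obj: "f \<in> Arr C \<Longrightarrow> Cod C f \<in> Obj C"
    and Id_hom: "x \<in> Obj C \<Longrightarrow> Id C x \<in> hom C x x"
    and Comp_hom: "\<lbrakk>f \<in> hom C x y; g \<in> hom C y z\<rbrakk> \<Longrightarrow> g \<cdot> f \<in> hom C x z"
    and Comp_assoc: "\<lbrakk>f \<in> hom C w x; g \<in> hom C x y; h \<in> hom C y z\<rbrakk> \<Longrightarrow> (h \<cdot> g) \<cdot> f = h \<cdot> (g \<cdot> f)"
    and Comp_Id: "f \<in> hom C x y \<Longrightarrow> f \<cdot> Id C x = f"
    and Id_Comp: "f \<in> hom C x y \<Longrightarrow> Id C y \<cdot> f = f"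

text \<open>Functors, and the components of natural transformations, are extensional functions, so that
  equality of functors is HOL equality.\<close>

record ('o, 'm, 'p, 'n) ftor =
  omap :: "'o \<Rightarrow> 'p"
  amap :: "'m \<Rightarrow> 'n"

definition is_functor :: "('o, 'm) cat \<Rightarrow> ('p, 'n) cat \<Rightarrow> ('o, 'm, 'p, 'n) ftor \<Rightarrow> bool" where
  "is_functor C D F \<longleftrightarrow>
     omap F \<in> Obj C \<rightarrow>\<^sub>E Obj D \<and> amap F \<in> Arr C \<rightarrow>\<^sub>E Arr D \<and>
     (\<forall>f\<in>Arr C. amap F f \<in> hom D (omap F (Dom C f)) (omap F (Cod C f))) \<and>
     (\<forall>x\<in>Obj C. amap F (Id C x) = Id D (omap F x)) \<and>
     (\<forall>f\<in>Arr C. \<forall>g\<in>Arr C. Cod C f = Dom C g \<longrightarrow>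
        amap F (g \<cdot>\<^bsub>C\<^esub> f) = amap F g \<cdot>\<^bsub>D\<^esub> amap F f)"

definition mk_functor :: "('o, 'm) cat \<Rightarrow> ('o \<Rightarrow> 'p) \<Rightarrow> ('m \<Rightarrow> 'n) \<Rightarrow> ('o, 'm, 'p, 'n) ftor" where
  "mk_functor C fo fa = \<lparr>omap = restrict fo (Obj C), amap = restrict fa (Arr C)\<rparr>"

definition id_functor :: "('o, 'm) cat \<Rightarrow> ('o, 'm, 'o, 'm) ftor" where
  "id_functor C = mk_functor C (\<lambda>x. x) (\<lambda>f. f)"

definition comp_functor ::
  "('o, 'm) cat \<Rightarrow> ('p, 'n, 'q, 'l) ftor \<Rightarrow> ('o, 'm, 'p, 'n) ftor \<Rightarrow> ('o, 'm, 'q, 'l) ftor" where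
  "comp_functor C G F = mk_functor C (\<lambda>x. omap G (omap F x)) (\<lambda>f. amap G (amap F f))"

definition is_iso_functor :: "('o, 'm) cat \<Rightarrow> ('p, 'n) cat \<Rightarrow> ('o, 'm, 'p, 'n) ftor \<Rightarrow> bool" where
  "is_iso_functor C D F \<longleftrightarrow> is_functor C D F \<and>
     (\<exists>G. is_functor D C G \<and> comp_functor C G F = id_functor C \<and> comp_functor D F G = id_functor D)"

record ('o, 'm, 'p, 'n) ntr =
  nsrc :: "('o, 'm, 'p, 'n) ftor"
  ntgt :: "('o, 'm, 'p, 'n) ftor"
  ncmp :: "'o \<Rightarrow> 'n"

definition is_ntr :: "('o, 'm) cat \<Rightarrow> ('p, 'n) cat \<Rightarrow> ('o, 'm, 'p, 'n) ntr \<Rightarrow> bool" where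
  "is_ntr J C t \<longleftrightarrow>
     is_functor J C (nsrc t) \<and> is_functor J C (ntgt t) \<and> ncmp t \<in> extensional (Obj J) \<and>
     (\<forall>x\<in>Obj J. ncmp t x \<in> hom C (omap (nsrc t) x) (omap (ntgt t) x)) \<and>
     (\<forall>f\<in>Arr J. amap (ntgt t) f \<cdot>\<^bsub>C\<^esub> ncmp t (Dom J f) = ncmp t (Cod J f) \<cdot>\<^bsub>C\<^esub> amap (nsrc t) f)"

definition mk_ntr ::
  "('o, 'm) cat \<Rightarrow> ('o, 'm, 'p, 'n) ftor \<Rightarrow> ('o, 'm, 'p, 'n) ftor \<Rightarrow> ('o \<Rightarrow> 'n) \<Rightarrow> ('o, 'm, 'p, 'n) ntr" where
  "mk_ntr J F G c = \<lparr>nsrc = F, ntgt = G, ncmp = restrict c (Obj J)\<rparr>"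

definition fun_cat ::
  "('o, 'm) cat \<Rightarrow> ('p, 'n) cat \<Rightarrow> (('o, 'm, 'p, 'n) ftor, ('o, 'm, 'p, 'n) ntr) cat" where
  "fun_cat J C =
     \<lparr>Obj = {F. is_functor J C F}, Arr = {t. is_ntr J C t}, Dom = nsrc, Cod = ntgt,
      Id = (\<lambda>F. mk_ntr J F F (\<lambda>x. Id C (omap F x))),
      Comp = (\<lambda>t s. mk_ntr J (nsrc s) (ntgt t) (\<lambda>x. ncmp t x \<cdot>\<^bsub>C\<^esub> ncmp s x))\<rparr>"

definition wide_subcategory :: "('o, 'm) cat \<Rightarrow> 'm set \<Rightarrow> bool" where
  "wide_subcategory C A \<longleftrightarrow> A \<subseteq> Arr C \<and> Id C ` Obj C \<subseteq> A \<and>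
     (\<forall>f\<in>A. \<forall>g\<in>A. Cod C f = Dom C g \<longrightarrow> g \<cdot>\<^bsub>C\<^esub> f \<in> A)"

definition wide :: "('o, 'm) cat \<Rightarrow> 'm set \<Rightarrow> ('o, 'm) cat" where
  "wide C A = C\<lparr>Arr := A\<rparr>"

text \<open>The discrete category on the objects of \<open>C\<close>, as a wide subcategory of \<open>C\<close>.\<close>

definition ids :: "('o, 'm) cat \<Rightarrow> ('o, 'm) cat" where
  "ids C = wide C (Id C ` Obj C)"

text \<open>Restriction of diagrams to a wide subcategory: \<open>I\<close> is a wide subcategory of \<open>J\<close>.\<close>

definition restr_diag :: "('o, 'm) cat \<Rightarrow> ('o, 'm, 'p, 'n) ftor \<Rightarrow> ('o, 'm, 'p, 'n) ftor" where
  "restr_diag I F = mk_functor I (omap F) (amap F)"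

definition restriction ::
  "('o, 'm) cat \<Rightarrow> ('o, 'm) cat \<Rightarrow> ('p, 'n) cat \<Rightarrow>
     (('o, 'm, 'p, 'n) ftor, ('o, 'm, 'p, 'n) ntr, ('o, 'm, 'p, 'n) ftor, ('o, 'm, 'p, 'n) ntr) ftor" where
  "restriction I J C = mk_functor (fun_cat J C) (restr_diag I)
     (\<lambda>t. mk_ntr I (restr_diag I (nsrc t)) (restr_diag I (ntgt t)) (ncmp t))"


section \<open>Limits and colimits\<close>

definition is_cocone ::
  "('j, 'k) cat \<Rightarrow> ('o, 'm) cat \<Rightarrow> ('j, 'k, 'o, 'm) ftor \<Rightarrow> 'o \<Rightarrow> ('j \<Rightarrow> 'm) \<Rightarrow> bool" where
  "is_cocone J C D c l \<longleftrightarrow> c \<in> Obj C \<and> (\<forall>j\<in>Obj J. l j \<in> hom C (omap D j) c) \<and>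
     (\<forall>u\<in>Arr J. l (Cod J u) \<cdot>\<^bsub>C\<^esub> amap D u = l (Dom J u))"

definition is_colimit ::
  "('j, 'k) cat \<Rightarrow> ('o, 'm) cat \<Rightarrow> ('j, 'k, 'o, 'm) ftor \<Rightarrow> 'o \<Rightarrow> ('j \<Rightarrow> 'm) \<Rightarrow> bool" where
  "is_colimit J C D c l \<longleftrightarrow> is_cocone J C D c l \<and>
     (\<forall>c' l'. is_cocone J C D c' l' \<longrightarrow> (\<exists>!h. h \<in> hom C c c' \<and> (\<forall>j\<in>Obj J. h \<cdot>\<^bsub>C\<^esub> l j = l' j)))"

definition is_cone ::
  "('j, 'k) cat \<Rightarrow> ('o, 'm) cat \<Rightarrow> ('j, 'k, 'o, 'm) ftor \<Rightarrow> 'o \<Rightarrow> ('j \<Rightarrow> 'm) \<Rightarrow> bool" where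
  "is_cone J C D c l \<longleftrightarrow> c \<in> Obj C \<and> (\<forall>j\<in>Obj J. l j \<in> hom C c (omap D j)) \<and>
     (\<forall>u\<in>Arr J. amap D u \<cdot>\<^bsub>C\<^esub> l (Dom J u) = l (Cod J u))"

definition is_limit ::
  "('j, 'k) cat \<Rightarrow> ('o, 'm) cat \<Rightarrow> ('j, 'k, 'o, 'm) ftor \<Rightarrow> 'o \<Rightarrow> ('j \<Rightarrow> 'm) \<Rightarrow> bool" where
  "is_limit J C D c l \<longleftrightarrow> is_cone J C D c l \<and>
     (\<forall>c' l'. is_cone J C D c' l' \<longrightarrow> (\<exists>!h. h \<in> hom C c' c \<and> (\<forall>j\<in>Obj J. l j \<cdot>\<^bsub>C\<^esub> h = l' j)))"

text \<open>The type \<open>'u\<close> is the universe of small sets: a category is small if its objects and its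
  arrows are elements of \<open>'u\<close>. It will be assumed infinite; up to relabelling, every category
  whose object and arrow sets have at most the cardinality of \<open>'u\<close> is then small.\<close>

definition complete :: "'u itself \<Rightarrow> ('o, 'm) cat \<Rightarrow> bool" where
  "complete _ C \<longleftrightarrow> (\<forall>(J :: ('u, 'u) cat) D. category J \<and> is_functor J C D \<longrightarrow> (\<exists>c l. is_limit J C D c l))"

definition cocomplete :: "'u itself \<Rightarrow> ('o, 'm) cat \<Rightarrow> bool" where
  "cocomplete _ C \<longleftrightarrow> (\<forall>(J :: ('u, 'u) cat) D. category J \<and> is_functor J C D \<longrightarrow> (\<exists>c l. is_colimit J C D c l))"

text \<open>Chosen limits and colimits, and the morphisms given by their universal properties.\<close>

definition colim :: "('j, 'k) cat \<Rightarrow> ('o, 'm) cat \<Rightarrow> ('j, 'k, 'o, 'm) ftor \<Rightarrow> 'o \<times> ('j \<Rightarrow> 'm)" where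
  "colim J C D = (SOME (c, l). is_colimit J C D c l)"

definition colim_ob :: "('j, 'k) cat \<Rightarrow> ('o, 'm) cat \<Rightarrow> ('j, 'k, 'o, 'm) ftor \<Rightarrow> 'o" where
  "colim_ob J C D = fst (colim J C D)"

definition colim_in :: "('j, 'k) cat \<Rightarrow> ('o, 'm) cat \<Rightarrow> ('j, 'k, 'o, 'm) ftor \<Rightarrow> 'j \<Rightarrow> 'm" where
  "colim_in J C D = snd (colim J C D)"

definition colim_desc ::
  "('j, 'k) cat \<Rightarrow> ('o, 'm) cat \<Rightarrow> ('j, 'k, 'o, 'm) ftor \<Rightarrow> 'o \<Rightarrow> ('j \<Rightarrow> 'm) \<Rightarrow> 'm" where
  "colim_desc J C D c l = (THE h. h \<in> hom C (colim_ob J C D) c \<and> (\<forall>j\<in>Obj J. h \<cdot>\<^bsub>C\<^esub> colim_in J C D j = l j))"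

definition lim :: "('j, 'k) cat \<Rightarrow> ('o, 'm) cat \<Rightarrow> ('j, 'k, 'o, 'm) ftor \<Rightarrow> 'o \<times> ('j \<Rightarrow> 'm)" where
  "lim J C D = (SOME (c, l). is_limit J C D c l)"

definition lim_ob :: "('j, 'k) cat \<Rightarrow> ('o, 'm) cat \<Rightarrow> ('j, 'k, 'o, 'm) ftor \<Rightarrow> 'o" where
  "lim_ob J C D = fst (lim J C D)"

definition lim_pr :: "('j, 'k) cat \<Rightarrow> ('o, 'm) cat \<Rightarrow> ('j, 'k, 'o, 'm) ftor \<Rightarrow> 'j \<Rightarrow> 'm" where
  "lim_pr J C D = snd (lim J C D)"

definition lim_lift ::
  "('j, 'k) cat \<Rightarrow> ('o, 'm) cat \<Rightarrow> ('j, 'k, 'o, 'm) ftor \<Rightarrow> 'o \<Rightarrow> ('j \<Rightarrow> 'm) \<Rightarrow> 'm" where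
  "lim_lift J C D c l = (THE h. h \<in> hom C c (lim_ob J C D) \<and> (\<forall>j\<in>Obj J. lim_pr J C D j \<cdot>\<^bsub>C\<^esub> h = l j))"

text \<open>Coproducts and products of families \<open>(X i)\<^sub>i\<^sub>\<in>\<^sub>I\<close>.\<close>

definition disc :: "'i set \<Rightarrow> ('i, 'i) cat" where
  "disc I = \<lparr>Obj = I, Arr = I, Dom = (\<lambda>i. i), Cod = (\<lambda>i. i), Id = (\<lambda>i. i), Comp = (\<lambda>g f. f)\<rparr>"

definition family :: "('o, 'm) cat \<Rightarrow> 'i set \<Rightarrow> ('i \<Rightarrow> 'o) \<Rightarrow> ('i, 'i, 'o, 'm) ftor" where
  "family C I X = mk_functor (disc I) X (\<lambda>i. Id C (X i))"

abbreviation coprod :: "('o, 'm) cat \<Rightarrow> 'i set \<Rightarrow> ('i \<Rightarrow> 'o) \<Rightarrow> 'o" where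
  "coprod C I X \<equiv> colim_ob (disc I) C (family C I X)"

abbreviation coprod_in :: "('o, 'm) cat \<Rightarrow> 'i set \<Rightarrow> ('i \<Rightarrow> 'o) \<Rightarrow> 'i \<Rightarrow> 'm" where
  "coprod_in C I X \<equiv> colim_in (disc I) C (family C I X)"

abbreviation cotuple :: "('o, 'm) cat \<Rightarrow> 'i set \<Rightarrow> ('i \<Rightarrow> 'o) \<Rightarrow> 'o \<Rightarrow> ('i \<Rightarrow> 'm) \<Rightarrow> 'm" where
  "cotuple C I X \<equiv> colim_desc (disc I) C (family C I X)"

abbreviation product :: "('o, 'm) cat \<Rightarrow> 'i set \<Rightarrow> ('i \<Rightarrow> 'o) \<Rightarrow> 'o" where
  "product C I X \<equiv> lim_ob (disc I) C (family C I X)"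

abbreviation product_pr :: "('o, 'm) cat \<Rightarrow> 'i set \<Rightarrow> ('i \<Rightarrow> 'o) \<Rightarrow> 'i \<Rightarrow> 'm" where
  "product_pr C I X \<equiv> lim_pr (disc I) C (family C I X)"

abbreviation tuple :: "('o, 'm) cat \<Rightarrow> 'i set \<Rightarrow> ('i \<Rightarrow> 'o) \<Rightarrow> 'o \<Rightarrow> ('i \<Rightarrow> 'm) \<Rightarrow> 'm" where
  "tuple C I X \<equiv> lim_lift (disc I) C (family C I X)"

text \<open>Chosen pushouts \<open>(p, i, j)\<close> of \<open>f\<close> and \<open>g\<close> (with \<open>i \<cdot> f = j \<cdot> g\<close>), chosen pullbacks
  \<open>(p, i, j)\<close> of \<open>f\<close> and \<open>g\<close> (with \<open>f \<cdot> i = g \<cdot> j\<close>).\<close>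

definition is_pushout :: "('o, 'm) cat \<Rightarrow> 'm \<Rightarrow> 'm \<Rightarrow> 'o \<Rightarrow> 'm \<Rightarrow> 'm \<Rightarrow> bool" where
  "is_pushout C f g p i j \<longleftrightarrow>
     i \<in> hom C (Cod C f) p \<and> j \<in> hom C (Cod C g) p \<and> i \<cdot>\<^bsub>C\<^esub> f = j \<cdot>\<^bsub>C\<^esub> g \<and>
     (\<forall>c u v. u \<in> hom C (Cod C f) c \<and> v \<in> hom C (Cod C g) c \<and> u \<cdot>\<^bsub>C\<^esub> f = v \<cdot>\<^bsub>C\<^esub> g \<longrightarrow>
        (\<exists>!h. h \<in> hom C p c \<and> h \<cdot>\<^bsub>C\<^esub> i = u \<and> h \<cdot>\<^bsub>C\<^esub> j = v))"

definition pushout_desc :: "('o, 'm) cat \<Rightarrow> 'm \<Rightarrow> 'm \<Rightarrow> 'm \<Rightarrow> 'm \<Rightarrow> 'm" where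
  "pushout_desc C f g u v =
     (let (p, i, j) = (SOME (p, i, j). is_pushout C f g p i j)
      in THE h. h \<in> hom C p (Cod C u) \<and> h \<cdot>\<^bsub>C\<^esub> i = u \<and> h \<cdot>\<^bsub>C\<^esub> j = v)"

definition is_pullback :: "('o, 'm) cat \<Rightarrow> 'm \<Rightarrow> 'm \<Rightarrow> 'o \<Rightarrow> 'm \<Rightarrow> 'm \<Rightarrow> bool" where
  "is_pullback C f g p i j \<longleftrightarrow>
     i \<in> hom C p (Dom C f) \<and> j \<in> hom C p (Dom C g) \<and> f \<cdot>\<^bsub>C\<^esub> i = g \<cdot>\<^bsub>C\<^esub> j \<and>
     (\<forall>c u v. u \<in> hom C c (Dom C f) \<and> v \<in> hom C c (Dom C g) \<and> f \<cdot>\<^bsub>C\<^esub> u = g \<cdot>\<^bsub>C\<^esub> v \<longrightarrow>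
        (\<exists>!h. h \<in> hom C c p \<and> i \<cdot>\<^bsub>C\<^esub> h = u \<and> j \<cdot>\<^bsub>C\<^esub> h = v))"

definition pullback_lift :: "('o, 'm) cat \<Rightarrow> 'm \<Rightarrow> 'm \<Rightarrow> 'm \<Rightarrow> 'm \<Rightarrow> 'm" where
  "pullback_lift C f g u v =
     (let (p, i, j) = (SOME (p, i, j). is_pullback C f g p i j)
      in THE h. h \<in> hom C (Dom C u) p \<and> i \<cdot>\<^bsub>C\<^esub> h = u \<and> j \<cdot>\<^bsub>C\<^esub> h = v)"


section \<open>Model categories\<close>

definition lifts_against :: "('o, 'm) cat \<Rightarrow> 'm \<Rightarrow> 'm \<Rightarrow> bool" where
  "lifts_against C i p \<longleftrightarrow>
     (\<forall>u v. u \<in> hom C (Dom C i) (Dom C p) \<and> v \<in> hom C (Cod C i) (Cod C p) \<and> p \<cdot>\<^bsub>C\<^esub> u = v \<cdot>\<^bsub>C\<^esub> i \<longrightarrow>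
        (\<exists>h. h \<in> hom C (Cod C i) (Dom C p) \<and> h \<cdot>\<^bsub>C\<^esub> i = u \<and> p \<cdot>\<^bsub>C\<^esub> h = v))"

definition LLP :: "('o, 'm) cat \<Rightarrow> 'm set \<Rightarrow> 'm set" where
  "LLP C A = {i \<in> Arr C. \<forall>p\<in>A. lifts_against C i p}"

definition RLP :: "('o, 'm) cat \<Rightarrow> 'm set \<Rightarrow> 'm set" where
  "RLP C A = {p \<in> Arr C. \<forall>i\<in>A. lifts_against C i p}"

definition weak_factorization_system :: "('o, 'm) cat \<Rightarrow> 'm set \<Rightarrow> 'm set \<Rightarrow> bool" where
  "weak_factorization_system C A B \<longleftrightarrow> A = LLP C B \<and> B = RLP C A \<and>
     (\<forall>f\<in>Arr C. \<exists>a\<in>A. \<exists>b\<in>B. Cod C a = Dom C b \<and> f = b \<cdot>\<^bsub>C\<^esub> a)"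

record 'm mstruct =
  WE :: "'m set"
  Cof :: "'m set"
  Fib :: "'m set"

definition model_structure :: "('o, 'm) cat \<Rightarrow> 'm mstruct \<Rightarrow> bool" where
  "model_structure C S \<longleftrightarrow>
     WE S \<subseteq> Arr C \<and> Cof S \<subseteq> Arr C \<and> Fib S \<subseteq> Arr C \<and>
     (\<forall>f\<in>Arr C. \<forall>g\<in>Arr C. Cod C f = Dom C g \<longrightarrow>
        (f \<in> WE S \<and> g \<in> WE S \<longrightarrow> g \<cdot>\<^bsub>C\<^esub> f \<in> WE S) \<and>
        (f \<in> WE S \<and> g \<cdot>\<^bsub>C\<^esub> f \<in> WE S \<longrightarrow> g \<in> WE S) \<and>
        (g \<in> WE S \<and> g \<cdot>\<^bsub>C\<^esub> f \<in> WE S \<longrightarrow> f \<in> WE S)) \<and>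
     weak_factorization_system C (Cof S \<inter> WE S) (Fib S) \<and>
     weak_factorization_system C (Cof S) (Fib S \<inter> WE S)"

definition model_category :: "'u itself \<Rightarrow> ('o, 'm) cat \<Rightarrow> 'm mstruct \<Rightarrow> bool" where
  "model_category U C S \<longleftrightarrow> category C \<and> complete U C \<and> cocomplete U C \<and> model_structure C S"

definition left_induced ::
  "('o, 'm) cat \<Rightarrow> 'm mstruct \<Rightarrow> 'n mstruct \<Rightarrow> ('o, 'm, 'p, 'n) ftor \<Rightarrow> bool" where
  "left_induced C S T F \<longleftrightarrow>
     Cof S = {f \<in> Arr C. amap F f \<in> Cof T} \<and> WE S = {f \<in> Arr C. amap F f \<in> WE T}"

definition right_induced ::
  "('o, 'm) cat \<Rightarrow> 'm mstruct \<Rightarrow> 'n mstruct \<Rightarrow> ('o, 'm, 'p, 'n) ftor \<Rightarrow> bool" where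
  "right_induced C S T F \<longleftrightarrow>
     Fib S = {f \<in> Arr C. amap F f \<in> Fib T} \<and> WE S = {f \<in> Arr C. amap F f \<in> WE T}"

definition objectwise ::
  "('j, 'k) cat \<Rightarrow> ('o, 'm) cat \<Rightarrow> 'm set \<Rightarrow> ('j, 'k, 'o, 'm) ntr set" where
  "objectwise J C A = {t \<in> Arr (fun_cat J C). \<forall>x\<in>Obj J. ncmp t x \<in> A}"

text \<open>Two of the three classes of a model structure determine the third; see
  \<open>projective_structure_unique\<close> and \<open>injective_structure_unique\<close> below.\<close>

definition projective_structure ::
  "('j, 'k) cat \<Rightarrow> ('o, 'm) cat \<Rightarrow> 'm mstruct \<Rightarrow> ('j, 'k, 'o, 'm) ntr mstruct" where
  "projective_structure J C S =
     \<lparr>WE = objectwise J C (WE S),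
      Cof = LLP (fun_cat J C) (objectwise J C (Fib S) \<inter> objectwise J C (WE S)),
      Fib = objectwise J C (Fib S)\<rparr>"

definition injective_structure ::
  "('j, 'k) cat \<Rightarrow> ('o, 'm) cat \<Rightarrow> 'm mstruct \<Rightarrow> ('j, 'k, 'o, 'm) ntr mstruct" where
  "injective_structure J C S =
     \<lparr>WE = objectwise J C (WE S),
      Cof = objectwise J C (Cof S),
      Fib = RLP (fun_cat J C) (objectwise J C (Cof S) \<inter> objectwise J C (WE S))\<rparr>"

lemma projective_structure_unique:
  assumes "model_structure (fun_cat J C) T"
    and "WE T = objectwise J C (WE S)" and "Fib T = objectwise J C (Fib S)"
  shows "T = projective_structure J C S"
proof -
  have "Cof T = LLP (fun_cat J C) (Fib T \<inter> WE T)"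
    using assms(1) unfolding model_structure_def weak_factorization_system_def by blast
  then show ?thesis
    unfolding projective_structure_def assms(2,3) by (intro mstruct.equality) (simp_all add: assms(2,3))
qed

lemma injective_structure_unique:
  assumes "model_structure (fun_cat J C) T"
    and "WE T = objectwise J C (WE S)" and "Cof T = objectwise J C (Cof S)"
  shows "T = injective_structure J C S"
proof -
  have "Fib T = RLP (fun_cat J C) (Cof T \<inter> WE T)"
    using assms(1) unfolding model_structure_def weak_factorization_system_def by blast
  then show ?thesis
    unfolding injective_structure_def assms(2,3) by (intro mstruct.equality) (simp_all add: assms(2,3))
qed


section \<open>Reedy categories and the Reedy model structure\<close>

text \<open>\<open>P\<close> and \<open>N\<close> are the arrows of the direct and of the inverse subcategory.\<close>

definition reedy_category :: "('r, 'a) cat \<Rightarrow> ('r \<Rightarrow> nat) \<Rightarrow> 'a set \<Rightarrow> 'a set \<Rightarrow> bool" where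
  "reedy_category R d P N \<longleftrightarrow> category R \<and> wide_subcategory R P \<and> wide_subcategory R N \<and>
     (\<forall>f\<in>P. f \<notin> Id R ` Obj R \<longrightarrow> d (Dom R f) < d (Cod R f)) \<and>
     (\<forall>f\<in>N. f \<notin> Id R ` Obj R \<longrightarrow> d (Cod R f) < d (Dom R f)) \<and>
     (\<forall>f\<in>Arr R. \<exists>!(i, q). i \<in> P \<and> q \<in> N \<and> Cod R q = Dom R i \<and> f = i \<cdot>\<^bsub>R\<^esub> q)"

definition reedy_factor :: "('r, 'a) cat \<Rightarrow> 'a set \<Rightarrow> 'a set \<Rightarrow> 'a \<Rightarrow> 'a \<times> 'a" where
  "reedy_factor R P N f = (THE (i, q). i \<in> P \<and> q \<in> N \<and> Cod R q = Dom R i \<and> f = i \<cdot>\<^bsub>R\<^esub> q)"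

text \<open>A morphism \<open>f \<rightarrow> g\<close> of the latching category over \<open>r\<close> is \<open>(f, h, g)\<close> with \<open>g \<cdot> h = f\<close>;
  a morphism \<open>f \<rightarrow> g\<close> of the matching category under \<open>r\<close> is \<open>(f, h, g)\<close> with \<open>h \<cdot> f = g\<close>.\<close>

definition latching_objs :: "('r, 'a) cat \<Rightarrow> ('r \<Rightarrow> nat) \<Rightarrow> 'a set \<Rightarrow> 'r \<Rightarrow> 'a set" where
  "latching_objs R d P r = {f \<in> P. Cod R f = r \<and> d (Dom R f) < d r}"

definition latching_cat :: "('r, 'a) cat \<Rightarrow> ('r \<Rightarrow> nat) \<Rightarrow> 'a set \<Rightarrow> 'r \<Rightarrow> ('a, 'a \<times> 'a \<times> 'a) cat" where
  "latching_cat R d P r =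
     \<lparr>Obj = latching_objs R d P r,
      Arr = {(f, h, g). f \<in> latching_objs R d P r \<and> g \<in> latching_objs R d P r \<and> h \<in> P \<and>
                        Dom R h = Dom R f \<and> Cod R h = Dom R g \<and> g \<cdot>\<^bsub>R\<^esub> h = f},
      Dom = (\<lambda>(f, h, g). f), Cod = (\<lambda>(f, h, g). g),
      Id = (\<lambda>f. (f, Id R (Dom R f), f)),
      Comp = (\<lambda>(f', h', g') (f, h, g). (f, h' \<cdot>\<^bsub>R\<^esub> h, g'))\<rparr>"

definition latching_diag ::
  "('r, 'a) cat \<Rightarrow> ('r \<Rightarrow> nat) \<Rightarrow> 'a set \<Rightarrow> ('r, 'a, 'o, 'm) ftor \<Rightarrow> 'r \<Rightarrow> ('a, 'a \<times> 'a \<times> 'a, 'o, 'm) ftor" where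
  "latching_diag R d P \<Phi> r =
     mk_functor (latching_cat R d P r) (\<lambda>f. omap \<Phi> (Dom R f)) (\<lambda>(f, h, g). amap \<Phi> h)"

definition latching_ob ::
  "('r, 'a) cat \<Rightarrow> ('r \<Rightarrow> nat) \<Rightarrow> 'a set \<Rightarrow> ('o, 'm) cat \<Rightarrow> ('r, 'a, 'o, 'm) ftor \<Rightarrow> 'r \<Rightarrow> 'o" where
  "latching_ob R d P M \<Phi> r = colim_ob (latching_cat R d P r) M (latching_diag R d P \<Phi> r)"

text \<open>The latching map \<open>L\<^sub>r\<Phi> \<rightarrow> \<Phi>(r)\<close>.\<close>

definition latching_map ::
  "('r, 'a) cat \<Rightarrow> ('r \<Rightarrow> nat) \<Rightarrow> 'a set \<Rightarrow> ('o, 'm) cat \<Rightarrow> ('r, 'a, 'o, 'm) ftor \<Rightarrow> 'r \<Rightarrow> 'm" where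
  "latching_map R d P M \<Phi> r =
     colim_desc (latching_cat R d P r) M (latching_diag R d P \<Phi> r) (omap \<Phi> r) (\<lambda>f. amap \<Phi> f)"

text \<open>The map \<open>L\<^sub>r\<tau> : L\<^sub>r\<Phi> \<rightarrow> L\<^sub>r\<Psi>\<close> for \<open>\<tau> : \<Phi> \<rightarrow> \<Psi>\<close>.\<close>

definition latching_arr ::
  "('r, 'a) cat \<Rightarrow> ('r \<Rightarrow> nat) \<Rightarrow> 'a set \<Rightarrow> ('o, 'm) cat \<Rightarrow> ('r, 'a, 'o, 'm) ntr \<Rightarrow> 'r \<Rightarrow> 'm" where
  "latching_arr R d P M \<tau> r =
     colim_desc (latching_cat R d P r) M (latching_diag R d P (nsrc \<tau>) r)
       (latching_ob R d P M (ntgt \<tau>) r)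
       (\<lambda>f. colim_in (latching_cat R d P r) M (latching_diag R d P (ntgt \<tau>) r) f \<cdot>\<^bsub>M\<^esub> ncmp \<tau> (Dom R f))"

definition relative_latching_map ::
  "('r, 'a) cat \<Rightarrow> ('r \<Rightarrow> nat) \<Rightarrow> 'a set \<Rightarrow> ('o, 'm) cat \<Rightarrow> ('r, 'a, 'o, 'm) ntr \<Rightarrow> 'r \<Rightarrow> 'm" where
  "relative_latching_map R d P M \<tau> r =
     pushout_desc M (latching_map R d P M (nsrc \<tau>) r) (latching_arr R d P M \<tau> r)
       (ncmp \<tau> r) (latching_map R d P M (ntgt \<tau>) r)"

definition matching_objs :: "('r, 'a) cat \<Rightarrow> ('r \<Rightarrow> nat) \<Rightarrow> 'a set \<Rightarrow> 'r \<Rightarrow> 'a set" where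
  "matching_objs R d N r = {f \<in> N. Dom R f = r \<and> d (Cod R f) < d r}"

definition matching_cat :: "('r, 'a) cat \<Rightarrow> ('r \<Rightarrow> nat) \<Rightarrow> 'a set \<Rightarrow> 'r \<Rightarrow> ('a, 'a \<times> 'a \<times> 'a) cat" where
  "matching_cat R d N r =
     \<lparr>Obj = matching_objs R d N r,
      Arr = {(f, h, g). f \<in> matching_objs R d N r \<and> g \<in> matching_objs R d N r \<and> h \<in> N \<and>
                        Dom R h = Cod R f \<and> Cod R h = Cod R g \<and> h \<cdot>\<^bsub>R\<^esub> f = g},
      Dom = (\<lambda>(f, h, g). f), Cod = (\<lambda>(f, h, g). g),
      Id = (\<lambda>f. (f, Id R (Cod R f), f)),
      Comp = (\<lambda>(f', h', g') (f, h, g). (f, h' \<cdot>\<^bsub>R\<^esub> h, g'))\<rparr>"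

definition matching_diag ::
  "('r, 'a) cat \<Rightarrow> ('r \<Rightarrow> nat) \<Rightarrow> 'a set \<Rightarrow> ('r, 'a, 'o, 'm) ftor \<Rightarrow> 'r \<Rightarrow> ('a, 'a \<times> 'a \<times> 'a, 'o, 'm) ftor" where
  "matching_diag R d N \<Phi> r =
     mk_functor (matching_cat R d N r) (\<lambda>f. omap \<Phi> (Cod R f)) (\<lambda>(f, h, g). amap \<Phi> h)"

definition matching_ob ::
  "('r, 'a) cat \<Rightarrow> ('r \<Rightarrow> nat) \<Rightarrow> 'a set \<Rightarrow> ('o, 'm) cat \<Rightarrow> ('r, 'a, 'o, 'm) ftor \<Rightarrow> 'r \<Rightarrow> 'o" where
  "matching_ob R d N M \<Phi> r = lim_ob (matching_cat R d N r) M (matching_diag R d N \<Phi> r)"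

definition matching_map ::
  "('r, 'a) cat \<Rightarrow> ('r \<Rightarrow> nat) \<Rightarrow> 'a set \<Rightarrow> ('o, 'm) cat \<Rightarrow> ('r, 'a, 'o, 'm) ftor \<Rightarrow> 'r \<Rightarrow> 'm" where
  "matching_map R d N M \<Phi> r =
     lim_lift (matching_cat R d N r) M (matching_diag R d N \<Phi> r) (omap \<Phi> r) (\<lambda>f. amap \<Phi> f)"

definition matching_arr ::
  "('r, 'a) cat \<Rightarrow> ('r \<Rightarrow> nat) \<Rightarrow> 'a set \<Rightarrow> ('o, 'm) cat \<Rightarrow> ('r, 'a, 'o, 'm) ntr \<Rightarrow> 'r \<Rightarrow> 'm" where
  "matching_arr R d N M \<tau> r =
     lim_lift (matching_cat R d N r) M (matching_diag R d N (ntgt \<tau>) r)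
       (matching_ob R d N M (nsrc \<tau>) r)
       (\<lambda>f. ncmp \<tau> (Cod R f) \<cdot>\<^bsub>M\<^esub> lim_pr (matching_cat R d N r) M (matching_diag R d N (nsrc \<tau>) r) f)"

definition relative_matching_map ::
  "('r, 'a) cat \<Rightarrow> ('r \<Rightarrow> nat) \<Rightarrow> 'a set \<Rightarrow> ('o, 'm) cat \<Rightarrow> ('r, 'a, 'o, 'm) ntr \<Rightarrow> 'r \<Rightarrow> 'm" where
  "relative_matching_map R d N M \<tau> r =
     pullback_lift M (matching_arr R d N M \<tau> r) (matching_map R d N M (ntgt \<tau>) r)
       (matching_map R d N M (nsrc \<tau>) r) (ncmp \<tau> r)"

definition reedy_structure ::
  "('r, 'a) cat \<Rightarrow> ('r \<Rightarrow> nat) \<Rightarrow> 'a set \<Rightarrow> 'a set \<Rightarrow> ('o, 'm) cat \<Rightarrow> 'm mstruct \<Rightarrow>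
     ('r, 'a, 'o, 'm) ntr mstruct" where
  "reedy_structure R d P N M S =
     \<lparr>WE = objectwise R M (WE S),
      Cof = {\<tau> \<in> Arr (fun_cat R M). \<forall>r\<in>Obj R. relative_latching_map R d P M \<tau> r \<in> Cof S},
      Fib = {\<tau> \<in> Arr (fun_cat R M). \<forall>r\<in>Obj R. relative_matching_map R d N M \<tau> r \<in> Fib S}\<rparr>"


section \<open>Monads, comonads and bialgebras\<close>

record ('o, 'm) monad =
  mfun :: "('o, 'm, 'o, 'm) ftor"
  munit :: "'o \<Rightarrow> 'm"
  mmult :: "'o \<Rightarrow> 'm"

record ('o, 'm) comonad =
  cfun :: "('o, 'm, 'o, 'm) ftor"
  ccounit :: "'o \<Rightarrow> 'm"
  ccomult :: "'o \<Rightarrow> 'm"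

text \<open>The monad on \<open>C\<close> of an adjunction \<open>F \<stileturn> G\<close>, \<open>F : C \<rightarrow> D\<close>, and the comonad on \<open>C\<close> of an
  adjunction \<open>G \<stileturn> F\<close>, \<open>F : C \<rightarrow> D\<close>; \<open>\<eta>\<close> and \<open>\<epsilon>\<close> are the unit and the counit.\<close>

definition adj_monad ::
  "('o, 'm) cat \<Rightarrow> ('o, 'm, 'p, 'n) ftor \<Rightarrow> ('p, 'n, 'o, 'm) ftor \<Rightarrow> ('o \<Rightarrow> 'm) \<Rightarrow> ('p \<Rightarrow> 'n) \<Rightarrow> ('o, 'm) monad" where
  "adj_monad C F G \<eta> \<epsilon> =
     \<lparr>mfun = comp_functor C G F, munit = \<eta>, mmult = (\<lambda>X. amap G (\<epsilon> (omap F X)))\<rparr>"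

definition adj_comonad ::
  "('o, 'm) cat \<Rightarrow> ('o, 'm, 'p, 'n) ftor \<Rightarrow> ('p, 'n, 'o, 'm) ftor \<Rightarrow> ('p \<Rightarrow> 'n) \<Rightarrow> ('o \<Rightarrow> 'm) \<Rightarrow> ('o, 'm) comonad" where
  "adj_comonad C F G \<eta> \<epsilon> =
     \<lparr>cfun = comp_functor C G F, ccounit = \<epsilon>, ccomult = (\<lambda>X. amap G (\<eta> (omap F X)))\<rparr>"

definition is_algebra :: "('o, 'm) cat \<Rightarrow> ('o, 'm) monad \<Rightarrow> 'o \<Rightarrow> 'm \<Rightarrow> bool" where
  "is_algebra C T X a \<longleftrightarrow> X \<in> Obj C \<and> a \<in> hom C (omap (mfun T) X) X \<and>
     a \<cdot>\<^bsub>C\<^esub> munit T X = Id C X \<and> a \<cdot>\<^bsub>C\<^esub> mmult T X = a \<cdot>\<^bsub>C\<^esub> amap (mfun T) a"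

definition is_coalgebra :: "('o, 'm) cat \<Rightarrow> ('o, 'm) comonad \<Rightarrow> 'o \<Rightarrow> 'm \<Rightarrow> bool" where
  "is_coalgebra C K X k \<longleftrightarrow> X \<in> Obj C \<and> k \<in> hom C X (omap (cfun K) X) \<and>
     ccounit K X \<cdot>\<^bsub>C\<^esub> k = Id C X \<and> ccomult K X \<cdot>\<^bsub>C\<^esub> k = amap (cfun K) k \<cdot>\<^bsub>C\<^esub> k"

text \<open>Bialgebras \<open>(X, a, k)\<close> with respect to \<open>\<chi> : TK \<Rightarrow> KT\<close>, and their morphisms
  \<open>((X, a, k), f, (Y, b, l))\<close>.\<close>

definition bialgebras ::
  "('o, 'm) cat \<Rightarrow> ('o, 'm) monad \<Rightarrow> ('o, 'm) comonad \<Rightarrow> ('o \<Rightarrow> 'm) \<Rightarrow> ('o \<times> 'm \<times> 'm) set" where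
  "bialgebras C T K \<chi> = {(X, a, k). is_algebra C T X a \<and> is_coalgebra C K X k \<and>
     k \<cdot>\<^bsub>C\<^esub> a = amap (cfun K) a \<cdot>\<^bsub>C\<^esub> (\<chi> X \<cdot>\<^bsub>C\<^esub> amap (mfun T) k)}"

definition bialgebra_cat ::
  "('o, 'm) cat \<Rightarrow> ('o, 'm) monad \<Rightarrow> ('o, 'm) comonad \<Rightarrow> ('o \<Rightarrow> 'm) \<Rightarrow>
     ('o \<times> 'm \<times> 'm, ('o \<times> 'm \<times> 'm) \<times> 'm \<times> ('o \<times> 'm \<times> 'm)) cat" where
  "bialgebra_cat C T K \<chi> =
     \<lparr>Obj = bialgebras C T K \<chi>,
      Arr = {((X, a, k), f, (Y, b, l)). (X, a, k) \<in> bialgebras C T K \<chi> \<and> (Y, b, l) \<in> bialgebras C T K \<chi> \<and>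
               f \<in> hom C X Y \<and> f \<cdot>\<^bsub>C\<^esub> a = b \<cdot>\<^bsub>C\<^esub> amap (mfun T) f \<and> l \<cdot>\<^bsub>C\<^esub> f = amap (cfun K) f \<cdot>\<^bsub>C\<^esub> k},
      Dom = (\<lambda>(A, f, B). A), Cod = (\<lambda>(A, f, B). B),
      Id = (\<lambda>A. (A, Id C (fst A), A)),
      Comp = (\<lambda>(A', g, B') (A, f, B). (A, g \<cdot>\<^bsub>C\<^esub> f, B'))\<rparr>"


section \<open>Kan extensions from the discrete category of objects\<close>

definition in_arrs :: "('r, 'a) cat \<Rightarrow> 'r \<Rightarrow> 'a set" where
  "in_arrs J r = {f \<in> Arr J. Cod J f = r}"

definition out_arrs :: "('r, 'a) cat \<Rightarrow> 'r \<Rightarrow> 'a set" where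
  "out_arrs J r = {f \<in> Arr J. Dom J f = r}"

text \<open>Left Kan extension along \<open>ids J \<rightarrow> J\<close>: at \<open>r\<close> it is the coproduct of the \<open>\<Phi>(x)\<close> over all
  \<open>x\<close> and all \<open>f : x \<rightarrow> r\<close>; an arrow \<open>h : r \<rightarrow> s\<close> takes the summand of \<open>f\<close> to the one of \<open>h \<cdot> f\<close>.\<close>

abbreviation lan_at :: "('r, 'a) cat \<Rightarrow> ('o, 'm) cat \<Rightarrow> ('r, 'a, 'o, 'm) ftor \<Rightarrow> 'r \<Rightarrow> 'o" where
  "lan_at J M \<Phi> r \<equiv> coprod M (in_arrs J r) (\<lambda>f. omap \<Phi> (Dom J f))"

abbreviation lan_in :: "('r, 'a) cat \<Rightarrow> ('o, 'm) cat \<Rightarrow> ('r, 'a, 'o, 'm) ftor \<Rightarrow> 'r \<Rightarrow> 'a \<Rightarrow> 'm" where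
  "lan_in J M \<Phi> r \<equiv> coprod_in M (in_arrs J r) (\<lambda>f. omap \<Phi> (Dom J f))"

abbreviation lan_cotuple ::
  "('r, 'a) cat \<Rightarrow> ('o, 'm) cat \<Rightarrow> ('r, 'a, 'o, 'm) ftor \<Rightarrow> 'r \<Rightarrow> 'o \<Rightarrow> ('a \<Rightarrow> 'm) \<Rightarrow> 'm" where
  "lan_cotuple J M \<Phi> r \<equiv> cotuple M (in_arrs J r) (\<lambda>f. omap \<Phi> (Dom J f))"

definition lan_ob :: "('r, 'a) cat \<Rightarrow> ('o, 'm) cat \<Rightarrow> ('r, 'a, 'o, 'm) ftor \<Rightarrow> ('r, 'a, 'o, 'm) ftor" where
  "lan_ob J M \<Phi> = mk_functor J (lan_at J M \<Phi>)
     (\<lambda>h. lan_cotuple J M \<Phi> (Dom J h) (lan_at J M \<Phi> (Cod J h))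
            (\<lambda>f. lan_in J M \<Phi> (Cod J h) (h \<cdot>\<^bsub>J\<^esub> f)))"

definition lan ::
  "('r, 'a) cat \<Rightarrow> ('o, 'm) cat \<Rightarrow>
     (('r, 'a, 'o, 'm) ftor, ('r, 'a, 'o, 'm) ntr, ('r, 'a, 'o, 'm) ftor, ('r, 'a, 'o, 'm) ntr) ftor" where
  "lan J M = mk_functor (fun_cat (ids J) M) (lan_ob J M)
     (\<lambda>\<tau>. mk_ntr J (lan_ob J M (nsrc \<tau>)) (lan_ob J M (ntgt \<tau>))
        (\<lambda>r. lan_cotuple J M (nsrc \<tau>) r (lan_at J M (ntgt \<tau>) r)
               (\<lambda>f. lan_in J M (ntgt \<tau>) r f \<cdot>\<^bsub>M\<^esub> ncmp \<tau> (Dom J f))))"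

definition lan_unit ::
  "('r, 'a) cat \<Rightarrow> ('o, 'm) cat \<Rightarrow> ('r, 'a, 'o, 'm) ftor \<Rightarrow> ('r, 'a, 'o, 'm) ntr" where
  "lan_unit J M \<Phi> = mk_ntr (ids J) \<Phi> (restr_diag (ids J) (lan_ob J M \<Phi>))
     (\<lambda>r. lan_in J M \<Phi> r (Id J r))"

definition lan_counit ::
  "('r, 'a) cat \<Rightarrow> ('o, 'm) cat \<Rightarrow> ('r, 'a, 'o, 'm) ftor \<Rightarrow> ('r, 'a, 'o, 'm) ntr" where
  "lan_counit J M \<Psi> = mk_ntr J (lan_ob J M (restr_diag (ids J) \<Psi>)) \<Psi>
     (\<lambda>r. lan_cotuple J M (restr_diag (ids J) \<Psi>) r (omap \<Psi> r) (\<lambda>f. amap \<Psi> f))"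

text \<open>Right Kan extension along \<open>ids J \<rightarrow> J\<close>: at \<open>r\<close> it is the product of the \<open>\<Phi>(y)\<close> over all
  \<open>y\<close> and all \<open>g : r \<rightarrow> y\<close>.\<close>

abbreviation ran_at :: "('r, 'a) cat \<Rightarrow> ('o, 'm) cat \<Rightarrow> ('r, 'a, 'o, 'm) ftor \<Rightarrow> 'r \<Rightarrow> 'o" where
  "ran_at J M \<Phi> r \<equiv> product M (out_arrs J r) (\<lambda>g. omap \<Phi> (Cod J g))"

abbreviation ran_pr :: "('r, 'a) cat \<Rightarrow> ('o, 'm) cat \<Rightarrow> ('r, 'a, 'o, 'm) ftor \<Rightarrow> 'r \<Rightarrow> 'a \<Rightarrow> 'm" where
  "ran_pr J M \<Phi> r \<equiv> product_pr M (out_arrs J r) (\<lambda>g. omap \<Phi> (Cod J g))"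

abbreviation ran_tuple ::
  "('r, 'a) cat \<Rightarrow> ('o, 'm) cat \<Rightarrow> ('r, 'a, 'o, 'm) ftor \<Rightarrow> 'r \<Rightarrow> 'o \<Rightarrow> ('a \<Rightarrow> 'm) \<Rightarrow> 'm" where
  "ran_tuple J M \<Phi> r \<equiv> tuple M (out_arrs J r) (\<lambda>g. omap \<Phi> (Cod J g))"

definition ran_ob :: "('r, 'a) cat \<Rightarrow> ('o, 'm) cat \<Rightarrow> ('r, 'a, 'o, 'm) ftor \<Rightarrow> ('r, 'a, 'o, 'm) ftor" where
  "ran_ob J M \<Phi> = mk_functor J (ran_at J M \<Phi>)
     (\<lambda>h. ran_tuple J M \<Phi> (Cod J h) (ran_at J M \<Phi> (Dom J h))
            (\<lambda>g. ran_pr J M \<Phi> (Dom J h) (g \<cdot>\<^bsub>J\<^esub> h)))"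

definition ran ::
  "('r, 'a) cat \<Rightarrow> ('o, 'm) cat \<Rightarrow>
     (('r, 'a, 'o, 'm) ftor, ('r, 'a, 'o, 'm) ntr, ('r, 'a, 'o, 'm) ftor, ('r, 'a, 'o, 'm) ntr) ftor" where
  "ran J M = mk_functor (fun_cat (ids J) M) (ran_ob J M)
     (\<lambda>\<tau>. mk_ntr J (ran_ob J M (nsrc \<tau>)) (ran_ob J M (ntgt \<tau>))
        (\<lambda>r. ran_tuple J M (ntgt \<tau>) r (ran_at J M (nsrc \<tau>) r)
               (\<lambda>g. ncmp \<tau> (Cod J g) \<cdot>\<^bsub>M\<^esub> ran_pr J M (nsrc \<tau>) r g)))"

definition ran_unit ::
  "('r, 'a) cat \<Rightarrow> ('o, 'm) cat \<Rightarrow> ('r, 'a, 'o, 'm) ftor \<Rightarrow> ('r, 'a, 'o, 'm) ntr" where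
  "ran_unit J M \<Psi> = mk_ntr J \<Psi> (ran_ob J M (restr_diag (ids J) \<Psi>))
     (\<lambda>r. ran_tuple J M (restr_diag (ids J) \<Psi>) r (omap \<Psi> r) (\<lambda>g. amap \<Psi> g))"

definition ran_counit ::
  "('r, 'a) cat \<Rightarrow> ('o, 'm) cat \<Rightarrow> ('r, 'a, 'o, 'm) ftor \<Rightarrow> ('r, 'a, 'o, 'm) ntr" where
  "ran_counit J M \<Phi> = mk_ntr (ids J) (restr_diag (ids J) (ran_ob J M \<Phi>)) \<Phi>
     (\<lambda>r. ran_pr J M \<Phi> r (Id J r))"


section \<open>Reedy diagrams as bialgebras\<close>

text \<open>Here \<open>J\<close> is the direct, respectively the inverse, subcategory of the Reedy category.\<close>

definition direct_monad ::
  "('r, 'a) cat \<Rightarrow> ('o, 'm) cat \<Rightarrow> (('r, 'a, 'o, 'm) ftor, ('r, 'a, 'o, 'm) ntr) monad" where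
  "direct_monad J M = adj_monad (fun_cat (ids J) M) (lan J M) (restriction (ids J) J M)
     (lan_unit J M) (lan_counit J M)"

definition inverse_comonad ::
  "('r, 'a) cat \<Rightarrow> ('o, 'm) cat \<Rightarrow> (('r, 'a, 'o, 'm) ftor, ('r, 'a, 'o, 'm) ntr) comonad" where
  "inverse_comonad J M = adj_comonad (fun_cat (ids J) M) (ran J M) (restriction (ids J) J M)
     (ran_unit J M) (ran_counit J M)"

definition reedy_dist_law ::
  "('r, 'a) cat \<Rightarrow> 'a set \<Rightarrow> 'a set \<Rightarrow> ('o, 'm) cat \<Rightarrow> ('r, 'a, 'o, 'm) ftor \<Rightarrow> ('r, 'a, 'o, 'm) ntr" where
  "reedy_dist_law R P N M \<Phi> =
     (let Rp = wide R P; Rn = wide R N;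
          T\<Phi> = omap (mfun (direct_monad Rp M)) \<Phi>;
          K\<Phi> = omap (cfun (inverse_comonad Rn M)) \<Phi>
      in mk_ntr (ids R) (omap (mfun (direct_monad Rp M)) K\<Phi>) (omap (cfun (inverse_comonad Rn M)) T\<Phi>)
        (\<lambda>r. lan_cotuple Rp M K\<Phi> r (ran_at Rn M T\<Phi> r)
           (\<lambda>f. ran_tuple Rn M T\<Phi> r (omap K\<Phi> (Dom R f))
              (\<lambda>g. let (i, q) = reedy_factor R P N (g \<cdot>\<^bsub>R\<^esub> f)
                    in lan_in Rp M \<Phi> (Cod R g) i \<cdot>\<^bsub>M\<^esub> ran_pr Rn M \<Phi> (Dom R f) q))))"

definition reedy_bialgebras ::
  "('r, 'a) cat \<Rightarrow> 'a set \<Rightarrow> 'a set \<Rightarrow> ('o, 'm) cat \<Rightarrow> _" where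
  "reedy_bialgebras R P N M = bialgebra_cat (fun_cat (ids R) M)
     (direct_monad (wide R P) M) (inverse_comonad (wide R N) M) (reedy_dist_law R P N M)"

text \<open>The canonical comparison functor from diagrams to bialgebras. It sends a diagram \<open>\<Phi>\<close> to the
  family of its values, with the algebra structure \<open>a\<close> whose component at \<open>f\<close> in the direct
  subcategory is \<open>\<Phi>(f)\<close>, and the coalgebra structure \<open>k\<close> whose component at \<open>g\<close> in the inverse
  subcategory is \<open>\<Phi>(g)\<close>.\<close>

definition bialgebra_of_diag ::
  "('r, 'a) cat \<Rightarrow> 'a set \<Rightarrow> 'a set \<Rightarrow> ('o, 'm) cat \<Rightarrow> ('r, 'a, 'o, 'm) ftor \<Rightarrow>
     ('r, 'a, 'o, 'm) ftor \<times> ('r, 'a, 'o, 'm) ntr \<times> ('r, 'a, 'o, 'm) ntr" where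
  "bialgebra_of_diag R P N M \<Phi> =
     (restr_diag (ids R) \<Phi>,
      amap (restriction (ids R) (wide R P) M) (lan_counit (wide R P) M (restr_diag (wide R P) \<Phi>)),
      amap (restriction (ids R) (wide R N) M) (ran_unit (wide R N) M (restr_diag (wide R N) \<Phi>)))"

definition comparison_functor ::
  "('r, 'a) cat \<Rightarrow> 'a set \<Rightarrow> 'a set \<Rightarrow> ('o, 'm) cat \<Rightarrow> _" where
  "comparison_functor R P N M = mk_functor (fun_cat R M) (bialgebra_of_diag R P N M)
     (\<lambda>\<tau>. (bialgebra_of_diag R P N M (nsrc \<tau>), amap (restriction (ids R) R M) \<tau>,
           bialgebra_of_diag R P N M (ntgt \<tau>)))"

end

(* The comparison functor is bijective on objects and arrows: an algebra of the monad is the same as a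
   functorial family of maps a_f for f in the direct subcategory, a coalgebra is a functorial family k_g
   for g in the inverse one, and the bialgebra law says k_g a_f = a_i k_q whenever g f = i q is the Reedy
   factorisation, which is exactly what makes i q |-> a_i k_q a functor on the whole category.

   For cofibrations, only the direct subcategory J matters. If the relative latching maps lift against
   the trivial fibrations, a lift of diagrams is built by recursion on the degree. Conversely, for an
   object r and p : A -> B, let X(s) be the product of copies of A over all g : s -> r and let Y(s) be the
   same product with the factor at g = id replaced by B. Then X -> Y is objectwise a product of copies of
   p and of identities, and lifting it against a map of diagrams amounts to lifting p against the relative
   latching map at r. Fibrations and coalgebras are treated by passing to opposite categories. *)

theory Submission
  imports Defs
begin

section \<open>Elementary facts about categories, functors, natural transformations and functor
  categories\<close>

section \<open>Categories and functors\<close>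

text \<open>Projective cofibrations and injective fibrations enter only through lifting properties,
  so no map of diagrams is ever factored. The test diagrams of the converse are forced by a
  universal property. X is the right Kan extension of A from the object r, so a map from \<Psi> to X
  is a map \<Psi>(r) -> A. A map from \<Psi> to Y is a map \<Psi>(r) -> B together with a map from
  the latching object of \<Psi> at r to A that agree on the latching object as maps to B. A square
  from a map of diagrams to X -> Y is therefore a square from its relative latching map at r to p,
  and diagonals correspond. That Y is a functor rests on directness: a composite g h into r can be
  an identity only if g is one, so transition maps lead from A to B along p and never from B to A.
  For X -> Y to be an objectwise trivial fibration, the class must contain identities and be closed
  under products; classes of the form \<open>RLP M B\<close> have both properties. Duality is cheap
  because a diagram from \<open>J\<close> to \<open>M\<close> is the same record as one from
  \<open>opp J\<close> to \<open>opp M\<close>.\<close>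

lemma in_hom: "f \<in> hom C x y \<longleftrightarrow> f \<in> Arr C \<and> Dom C f = x \<and> Cod C f = y"
  by (auto simp: hom_def)

context category
begin

declare Dom_Obj [simp] Cod_Obj [simp]

lemma comp_Arr [simp]: "\<lbrakk>f \<in> Arr C; g \<in> Arr C; Cod C f = Dom C g\<rbrakk> \<Longrightarrow> g \<cdot> f \<in> Arr C"
  and Dom_comp [simp]: "\<lbrakk>f \<in> Arr C; g \<in> Arr C; Cod C f = Dom C g\<rbrakk> \<Longrightarrow> Dom C (g \<cdot> f) = Dom C f"
  and Cod_comp [simp]: "\<lbrakk>f \<in> Arr C; g \<in> Arr C; Cod C f = Dom C g\<rbrakk> \<Longrightarrow> Cod C (g \<cdot> f) = Cod C g"
  using Comp_hom[of f "Dom C f" "Cod C f" g "Cod C g"] by (auto simp: in_hom)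

lemma comp_assoc [simp]:
  "\<lbrakk>f \<in> Arr C; g \<in> Arr C; h \<in> Arr C; Cod C f = Dom C g; Cod C g = Dom C h\<rbrakk> \<Longrightarrow> h \<cdot> g \<cdot> f = h \<cdot> (g \<cdot> f)"
  using Comp_assoc[of f "Dom C f" "Cod C f" g "Cod C g" h "Cod C h"] by (auto simp: in_hom)

lemma comp_Id [simp]: "\<lbrakk>f \<in> Arr C; Dom C f = x\<rbrakk> \<Longrightarrow> f \<cdot> Id C x = f"
  using Comp_Id[of f x "Cod C f"] by (auto simp: in_hom)

lemma Id_comp [simp]: "\<lbrakk>f \<in> Arr C; Cod C f = x\<rbrakk> \<Longrightarrow> Id C x \<cdot> f = f"
  using Id_Comp[of f "Dom C f" x] by (auto simp: in_hom)

lemma Id_Arr [simp]: "x \<in> Obj C \<Longrightarrow> Id C x \<in> Arr C"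
  and Dom_Id [simp]: "x \<in> Obj C \<Longrightarrow> Dom C (Id C x) = x"
  and Cod_Id [simp]: "x \<in> Obj C \<Longrightarrow> Cod C (Id C x) = x"
  using Id_hom[of x] by (auto simp: in_hom)

text \<open>\<open>comp_assoc\<close> nests composites to the right, which hides a known value of
  \<open>h \<cdot> g\<close> inside a longer composite. This rule applies such an equation at the
  head of the chain.\<close>

lemma comp_comp_eq:
  assumes "h \<cdot> g = k" "f \<in> Arr C" "g \<in> Arr C" "h \<in> Arr C" "Cod C f = Dom C g" "Cod C g = Dom C h"
  shows "h \<cdot> (g \<cdot> f) = k \<cdot> f"
  using assms by (simp flip: assms(1))

end

lemma categoryI:
  assumes "\<And>f. f \<in> Arr C \<Longrightarrow> Dom C f \<in> Obj C \<and> Cod C f \<in> Obj C"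
    and "\<And>x. x \<in> Obj C \<Longrightarrow> Id C x \<in> Arr C \<and> Dom C (Id C x) = x \<and> Cod C (Id C x) = x"
    and "\<And>f g. \<lbrakk>f \<in> Arr C; g \<in> Arr C; Cod C f = Dom C g\<rbrakk> \<Longrightarrow>
      g \<cdot>\<^bsub>C\<^esub> f \<in> Arr C \<and> Dom C (g \<cdot>\<^bsub>C\<^esub> f) = Dom C f \<and> Cod C (g \<cdot>\<^bsub>C\<^esub> f) = Cod C g"
    and "\<And>f g h. \<lbrakk>f \<in> Arr C; g \<in> Arr C; h \<in> Arr C; Cod C f = Dom C g; Cod C g = Dom C h\<rbrakk> \<Longrightarrow>
      (h \<cdot>\<^bsub>C\<^esub> g) \<cdot>\<^bsub>C\<^esub> f = h \<cdot>\<^bsub>C\<^esub> (g \<cdot>\<^bsub>C\<^esub> f)"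
    and "\<And>f. f \<in> Arr C \<Longrightarrow> f \<cdot>\<^bsub>C\<^esub> Id C (Dom C f) = f \<and> Id C (Cod C f) \<cdot>\<^bsub>C\<^esub> f = f"
  shows "category C"
  by unfold_locales (use assms in \<open>auto simp: in_hom\<close>)

lemma mk_functor_simps [simp]:
  "omap (mk_functor C fo fa) = restrict fo (Obj C)" "amap (mk_functor C fo fa) = restrict fa (Arr C)"
  by (simp_all add: mk_functor_def)

lemma mk_ntr_simps [simp]:
  "nsrc (mk_ntr J F G c) = F" "ntgt (mk_ntr J F G c) = G" "ncmp (mk_ntr J F G c) = restrict c (Obj J)"
  by (simp_all add: mk_ntr_def)

lemma mk_functor_cong:
  assumes "\<And>x. x \<in> Obj C \<Longrightarrow> fo x = fo' x" "\<And>f. f \<in> Arr C \<Longrightarrow> fa f = fa' f"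
  shows "mk_functor C fo fa = mk_functor C fo' fa'"
  unfolding mk_functor_def by (auto simp: restrict_def fun_eq_iff assms)

lemma is_functorI:
  assumes "omap F \<in> extensional (Obj C)" "amap F \<in> extensional (Arr C)"
    and "\<And>x. x \<in> Obj C \<Longrightarrow> omap F x \<in> Obj D"
    and "\<And>f. f \<in> Arr C \<Longrightarrow> amap F f \<in> Arr D \<and> Dom D (amap F f) = omap F (Dom C f) \<and> Cod D (amap F f) = omap F (Cod C f)"
    and "\<And>x. x \<in> Obj C \<Longrightarrow> amap F (Id C x) = Id D (omap F x)"
    and "\<And>f g. \<lbrakk>f \<in> Arr C; g \<in> Arr C; Cod C f = Dom C g\<rbrakk> \<Longrightarrow> amap F (g \<cdot>\<^bsub>C\<^esub> f) = amap F g \<cdot>\<^bsub>D\<^esub> amap F f"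
  shows "is_functor C D F"
  using assms unfolding is_functor_def by (auto simp: in_hom PiE_iff)

lemma mk_functor_is_functorI:
  assumes "category C"
    and "\<And>x. x \<in> Obj C \<Longrightarrow> fo x \<in> Obj D"
    and "\<And>f. f \<in> Arr C \<Longrightarrow> fa f \<in> Arr D \<and> Dom D (fa f) = fo (Dom C f) \<and> Cod D (fa f) = fo (Cod C f)"
    and "\<And>x. x \<in> Obj C \<Longrightarrow> fa (Id C x) = Id D (fo x)"
    and "\<And>f g. \<lbrakk>f \<in> Arr C; g \<in> Arr C; Cod C f = Dom C g\<rbrakk> \<Longrightarrow> fa (g \<cdot>\<^bsub>C\<^esub> f) = fa g \<cdot>\<^bsub>D\<^esub> fa f"
  shows "is_functor C D (mk_functor C fo fa)"
proof -
  interpret category C by fact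
  show ?thesis
    by (rule is_functorI) (use assms(2-) in auto)
qed

lemma functor_Obj [simp]: "\<lbrakk>is_functor C D F; x \<in> Obj C\<rbrakk> \<Longrightarrow> omap F x \<in> Obj D"
  and functor_Arr [simp]: "\<lbrakk>is_functor C D F; f \<in> Arr C\<rbrakk> \<Longrightarrow> amap F f \<in> Arr D"
  and functor_Dom [simp]: "\<lbrakk>is_functor C D F; f \<in> Arr C\<rbrakk> \<Longrightarrow> Dom D (amap F f) = omap F (Dom C f)"
  and functor_Cod [simp]: "\<lbrakk>is_functor C D F; f \<in> Arr C\<rbrakk> \<Longrightarrow> Cod D (amap F f) = omap F (Cod C f)"
  and functor_Id: "\<lbrakk>is_functor C D F; x \<in> Obj C\<rbrakk> \<Longrightarrow> amap F (Id C x) = Id D (omap F x)"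
  and functor_comp: "\<lbrakk>is_functor C D F; f \<in> Arr C; g \<in> Arr C; Cod C f = Dom C g\<rbrakk> \<Longrightarrow>
    amap F (g \<cdot>\<^bsub>C\<^esub> f) = amap F g \<cdot>\<^bsub>D\<^esub> amap F f"
  and functor_ext: "is_functor C D F \<Longrightarrow> omap F \<in> extensional (Obj C) \<and> amap F \<in> extensional (Arr C)"
  unfolding is_functor_def by (auto simp: in_hom PiE_iff)

lemma functor_eqI:
  assumes "is_functor C D F" "is_functor C D G"
    and "\<And>x. x \<in> Obj C \<Longrightarrow> omap F x = omap G x" "\<And>f. f \<in> Arr C \<Longrightarrow> amap F f = amap G f"
  shows "F = G"
proof (rule ftor.equality)
  show "omap F = omap G"
    using functor_ext[OF assms(1)] functor_ext[OF assms(2)] assms(3) by (auto intro: extensionalityI)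
  show "amap F = amap G"
    using functor_ext[OF assms(1)] functor_ext[OF assms(2)] assms(4) by (auto intro: extensionalityI)
qed simp

lemma mk_ntr_cong: "(\<And>x. x \<in> Obj J \<Longrightarrow> c x = c' x) \<Longrightarrow> mk_ntr J F G c = mk_ntr J F G c'"
  unfolding mk_ntr_def by (auto simp: restrict_def fun_eq_iff)

lemma mk_ntr_ncmp: "ncmp t \<in> extensional (Obj J) \<Longrightarrow> mk_ntr J (nsrc t) (ntgt t) (ncmp t) = t"
  by (simp add: mk_ntr_def extensional_restrict)

lemma is_ntrI:
  assumes "is_functor J C (nsrc t)" "is_functor J C (ntgt t)" "ncmp t \<in> extensional (Obj J)"
    and "\<And>x. x \<in> Obj J \<Longrightarrow> ncmp t x \<in> Arr C \<and> Dom C (ncmp t x) = omap (nsrc t) x \<and> Cod C (ncmp t x) = omap (ntgt t) x"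
    and "\<And>f. f \<in> Arr J \<Longrightarrow> amap (ntgt t) f \<cdot>\<^bsub>C\<^esub> ncmp t (Dom J f) = ncmp t (Cod J f) \<cdot>\<^bsub>C\<^esub> amap (nsrc t) f"
  shows "is_ntr J C t"
  using assms unfolding is_ntr_def by (auto simp: in_hom)

lemma mk_ntr_is_ntrI:
  assumes "category J" "is_functor J C F" "is_functor J C G"
    and "\<And>x. x \<in> Obj J \<Longrightarrow> c x \<in> Arr C \<and> Dom C (c x) = omap F x \<and> Cod C (c x) = omap G x"
    and "\<And>f. f \<in> Arr J \<Longrightarrow> amap G f \<cdot>\<^bsub>C\<^esub> c (Dom J f) = c (Cod J f) \<cdot>\<^bsub>C\<^esub> amap F f"
  shows "is_ntr J C (mk_ntr J F G c)"
proof -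
  interpret category J by fact
  show ?thesis by (rule is_ntrI) (use assms(2-) in auto)
qed

lemma ntr_src [simp]: "is_ntr J C t \<Longrightarrow> is_functor J C (nsrc t)"
  and ntr_tgt [simp]: "is_ntr J C t \<Longrightarrow> is_functor J C (ntgt t)"
  and ntr_Arr [simp]: "\<lbrakk>is_ntr J C t; x \<in> Obj J\<rbrakk> \<Longrightarrow> ncmp t x \<in> Arr C"
  and ntr_Dom [simp]: "\<lbrakk>is_ntr J C t; x \<in> Obj J\<rbrakk> \<Longrightarrow> Dom C (ncmp t x) = omap (nsrc t) x"
  and ntr_Cod [simp]: "\<lbrakk>is_ntr J C t; x \<in> Obj J\<rbrakk> \<Longrightarrow> Cod C (ncmp t x) = omap (ntgt t) x"
  and ntr_nat: "\<lbrakk>is_ntr J C t; f \<in> Arr J\<rbrakk> \<Longrightarrow>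
    amap (ntgt t) f \<cdot>\<^bsub>C\<^esub> ncmp t (Dom J f) = ncmp t (Cod J f) \<cdot>\<^bsub>C\<^esub> amap (nsrc t) f"
  and ntr_ext: "is_ntr J C t \<Longrightarrow> ncmp t \<in> extensional (Obj J)"
  unfolding is_ntr_def by (auto simp: in_hom)

lemma ntr_functors_Arr [simp]:
  assumes "is_ntr J C t"
  shows "x \<in> Obj J \<Longrightarrow> omap (nsrc t) x \<in> Obj C" "x \<in> Obj J \<Longrightarrow> omap (ntgt t) x \<in> Obj C"
    "f \<in> Arr J \<Longrightarrow> amap (nsrc t) f \<in> Arr C" "f \<in> Arr J \<Longrightarrow> amap (ntgt t) f \<in> Arr C"
    "f \<in> Arr J \<Longrightarrow> Dom C (amap (nsrc t) f) = omap (nsrc t) (Dom J f)"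
    "f \<in> Arr J \<Longrightarrow> Cod C (amap (nsrc t) f) = omap (nsrc t) (Cod J f)"
    "f \<in> Arr J \<Longrightarrow> Dom C (amap (ntgt t) f) = omap (ntgt t) (Dom J f)"
    "f \<in> Arr J \<Longrightarrow> Cod C (amap (ntgt t) f) = omap (ntgt t) (Cod J f)"
  using ntr_src[OF assms] ntr_tgt[OF assms] by auto

lemma ntr_eqI:
  assumes "is_ntr J C t" "is_ntr J C t'" "nsrc t = nsrc t'" "ntgt t = ntgt t'"
    and "\<And>x. x \<in> Obj J \<Longrightarrow> ncmp t x = ncmp t' x"
  shows "t = t'"
proof (rule ntr.equality)
  show "ncmp t = ncmp t'"
    using ntr_ext[OF assms(1)] ntr_ext[OF assms(2)] assms(5) by (auto intro: extensionalityI)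
qed (use assms in auto)

lemma fun_cat_simps [simp]:
  "Obj (fun_cat J C) = {F. is_functor J C F}" "Arr (fun_cat J C) = {t. is_ntr J C t}"
  "Dom (fun_cat J C) = nsrc" "Cod (fun_cat J C) = ntgt"
  "Id (fun_cat J C) F = mk_ntr J F F (\<lambda>x. Id C (omap F x))"
  "t \<cdot>\<^bsub>fun_cat J C\<^esub> s = mk_ntr J (nsrc s) (ntgt t) (\<lambda>x. ncmp t x \<cdot>\<^bsub>C\<^esub> ncmp s x)"
  by (simp_all add: fun_cat_def)

lemma comp_ntr:
  assumes "category J" "category C" "is_ntr J C s" "is_ntr J C t" "ntgt s = nsrc t"
  shows "is_ntr J C (mk_ntr J (nsrc s) (ntgt t) (\<lambda>x. ncmp t x \<cdot>\<^bsub>C\<^esub> ncmp s x))"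
proof -
  interpret J: category J by fact
  interpret C: category C by fact
  show ?thesis
  proof (rule mk_ntr_is_ntrI)
    fix f assume f: "f \<in> Arr J"
    have "amap (ntgt t) f \<cdot>\<^bsub>C\<^esub> (ncmp t (Dom J f) \<cdot>\<^bsub>C\<^esub> ncmp s (Dom J f)) =
        (amap (ntgt t) f \<cdot>\<^bsub>C\<^esub> ncmp t (Dom J f)) \<cdot>\<^bsub>C\<^esub> ncmp s (Dom J f)"
      using assms f by simp
    also have "\<dots> = ncmp t (Cod J f) \<cdot>\<^bsub>C\<^esub> (amap (nsrc t) f \<cdot>\<^bsub>C\<^esub> ncmp s (Dom J f))"
      using assms f by (simp add: ntr_nat)
    also have "\<dots> = ncmp t (Cod J f) \<cdot>\<^bsub>C\<^esub> (ncmp s (Cod J f) \<cdot>\<^bsub>C\<^esub> amap (nsrc s) f)"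
      using assms f ntr_nat[of J C s f] by simp
    finally show "amap (ntgt t) f \<cdot>\<^bsub>C\<^esub> (ncmp t (Dom J f) \<cdot>\<^bsub>C\<^esub> ncmp s (Dom J f)) =
        ncmp t (Cod J f) \<cdot>\<^bsub>C\<^esub> ncmp s (Cod J f) \<cdot>\<^bsub>C\<^esub> amap (nsrc s) f"
      using assms f by simp
  qed (use assms in auto)
qed

lemma id_ntr:
  assumes "category J" "category C" "is_functor J C F"
  shows "is_ntr J C (mk_ntr J F F (\<lambda>x. Id C (omap F x)))"
proof -
  interpret J: category J by fact
  interpret C: category C by fact
  show ?thesis by (rule mk_ntr_is_ntrI) (use assms in auto)
qed

lemma category_fun_cat:
  assumes "category J" "category C"
  shows "category (fun_cat J C)"
proof -
  interpret J: category J by fact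
  interpret C: category C by fact
  note c = comp_ntr[OF assms] and i = id_ntr[OF assms]
  show ?thesis
  proof (rule categoryI)
    fix f g h assume *: "f \<in> Arr (fun_cat J C)" "g \<in> Arr (fun_cat J C)" "h \<in> Arr (fun_cat J C)"
      "Cod (fun_cat J C) f = Dom (fun_cat J C) g" "Cod (fun_cat J C) g = Dom (fun_cat J C) h"
    show "h \<cdot>\<^bsub>fun_cat J C\<^esub> g \<cdot>\<^bsub>fun_cat J C\<^esub> f = h \<cdot>\<^bsub>fun_cat J C\<^esub> (g \<cdot>\<^bsub>fun_cat J C\<^esub> f)"
      using * by (auto intro!: mk_ntr_cong)
  next
    fix f assume *: "f \<in> Arr (fun_cat J C)"
    then have "mk_ntr J (nsrc f) (ntgt f) c = f" if "\<And>x. x \<in> Obj J \<Longrightarrow> c x = ncmp f x" for c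
      by (subst mk_ntr_cong[of J c "ncmp f", OF that]) (simp_all add: mk_ntr_ncmp ntr_ext)
    then show "f \<cdot>\<^bsub>fun_cat J C\<^esub> Id (fun_cat J C) (Dom (fun_cat J C) f) = f \<and>
      Id (fun_cat J C) (Cod (fun_cat J C) f) \<cdot>\<^bsub>fun_cat J C\<^esub> f = f"
      using * by simp
  qed (auto intro!: c i)
qed

text \<open>The inverse consists of preimages of objects and arrows. Source, target, identities and
  composites in \<open>D\<close> are read off from these preimages, so the rule reaches the
  bialgebras without a separate check of their category axioms.\<close>

lemma bij_functor_is_iso:
  assumes "category C" and F: "is_functor C D F"
    and bo: "bij_betw (omap F) (Obj C) (Obj D)" and ba: "bij_betw (amap F) (Arr C) (Arr D)"
  shows "is_iso_functor C D F"
proof -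
  interpret category C by fact
  define go where "go = inv_into (Obj C) (omap F)"
  define ga where "ga = inv_into (Arr C) (amap F)"
  have go: "go y \<in> Obj C" "omap F (go y) = y" if "y \<in> Obj D" for y
    using bo that unfolding go_def by (auto simp: bij_betw_def inv_into_into f_inv_into_f)
  have ga: "ga g \<in> Arr C" "amap F (ga g) = g" if "g \<in> Arr D" for g
    using ba that unfolding ga_def by (auto simp: bij_betw_def inv_into_into f_inv_into_f)
  have go': "go y = x" if "x \<in> Obj C" "omap F x = y" for x y
    using bo that unfolding go_def by (auto simp: bij_betw_def)
  have ga': "ga g = f" if "f \<in> Arr C" "amap F f = g" for f g
    using ba that unfolding ga_def by (auto simp: bij_betw_def)
  have dom: "Dom D g = omap F (Dom C (ga g))" "Cod D g = omap F (Cod C (ga g))" if "g \<in> Arr D" for g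
    using functor_Dom[OF F ga(1)[OF that]] functor_Cod[OF F ga(1)[OF that]] ga(2)[OF that] by simp_all
  have dom': "Dom C (ga g) = go (Dom D g)" "Cod C (ga g) = go (Cod D g)" if "g \<in> Arr D" for g
    using that go'[OF _ refl] ga[OF that] dom[OF that] by simp_all
  have Dobj: "Dom D g \<in> Obj D" "Cod D g \<in> Obj D" if "g \<in> Arr D" for g
    using dom[OF that] ga(1)[OF that] F by simp_all
  have cmp: "ga g' \<cdot>\<^bsub>C\<^esub> ga g \<in> Arr C \<and> amap F (ga g' \<cdot>\<^bsub>C\<^esub> ga g) = g' \<cdot>\<^bsub>D\<^esub> g"
    if "g \<in> Arr D" "g' \<in> Arr D" "Cod D g = Dom D g'" for g g'
    using that ga dom' by (simp add: functor_comp[OF F])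
  have idd: "amap F (Id C (go y)) = Id D y" if "y \<in> Obj D" for y
    using that go by (simp add: functor_Id[OF F])
  define G where "G = mk_functor D go ga"
  have G: "is_functor D C G"
  proof (rule is_functorI)
    fix y assume y: "y \<in> Obj D"
    then have "Id D y \<in> Arr D" using idd[OF y] go(1)[OF y] functor_Arr[OF F, of "Id C (go y)"] by simp
    then show "amap G (Id D y) = Id C (omap G y)"
      using y idd[OF y] go(1)[OF y] by (simp add: G_def ga')
  next
    fix f g assume *: "f \<in> Arr D" "g \<in> Arr D" "Cod D f = Dom D g"
    then have "g \<cdot>\<^bsub>D\<^esub> f \<in> Arr D" using cmp functor_Arr[OF F] by metis
    then show "amap G (g \<cdot>\<^bsub>D\<^esub> f) = amap G g \<cdot>\<^bsub>C\<^esub> amap G f"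
      using * cmp[OF *] by (simp add: G_def ga')
  qed (auto simp: G_def go ga dom' Dobj)
  have "comp_functor C G F = id_functor C"
    unfolding comp_functor_def id_functor_def
    by (rule mk_functor_cong) (use F in \<open>auto simp: G_def go' ga'\<close>)
  moreover have "comp_functor D F G = id_functor D"
    unfolding comp_functor_def id_functor_def
    by (rule mk_functor_cong) (auto simp: G_def go ga)
  ultimately show ?thesis
    using F G unfolding is_iso_functor_def by blast
qed

section \<open>Duality for functors, limits, pushouts and lifting problems\<close>

section \<open>Opposite categories\<close>

definition opp :: "('o, 'm) cat \<Rightarrow> ('o, 'm) cat" where
  "opp C = \<lparr>Obj = Obj C, Arr = Arr C, Dom = Cod C, Cod = Dom C, Id = Id C, Comp = (\<lambda>g f. f \<cdot>\<^bsub>C\<^esub> g)\<rparr>"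

text \<open>Functors carry no source and target category, so reversing arrows leaves them unchanged
  as records (\<open>is_functor_opp\<close>). Natural transformations record their source and target
  functors, and these two fields have to be exchanged.\<close>

definition opp_ntr :: "('o, 'm, 'p, 'n) ntr \<Rightarrow> ('o, 'm, 'p, 'n) ntr" where
  "opp_ntr t = \<lparr>nsrc = ntgt t, ntgt = nsrc t, ncmp = ncmp t\<rparr>"

lemma opp_simps [simp]:
  "Obj (opp C) = Obj C" "Arr (opp C) = Arr C" "Dom (opp C) = Cod C" "Cod (opp C) = Dom C"
  "Id (opp C) = Id C" "g \<cdot>\<^bsub>opp C\<^esub> f = f \<cdot>\<^bsub>C\<^esub> g" "opp (opp C) = C"
  by (simp_all add: opp_def)

lemma hom_opp: "hom (opp C) x y = hom C y x"
  by (auto simp: in_hom)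

lemma opp_ntr_simps [simp]:
  "nsrc (opp_ntr t) = ntgt t" "ntgt (opp_ntr t) = nsrc t" "ncmp (opp_ntr t) = ncmp t" "opp_ntr (opp_ntr t) = t"
  by (simp_all add: opp_ntr_def)

lemma opp_ntr_eq_iff [simp]: "opp_ntr s = opp_ntr t \<longleftrightarrow> s = t"
  by (metis opp_ntr_simps(4))

lemma category_opp: "category C \<Longrightarrow> category (opp C)"
proof -
  assume "category C"
  then interpret category C .
  show ?thesis by (rule categoryI) simp_all
qed

lemma mk_functor_opp [simp]: "mk_functor (opp C) = mk_functor C"
  by (simp add: mk_functor_def fun_eq_iff)

lemma mk_ntr_opp [simp]: "mk_ntr (opp J) F G c = opp_ntr (mk_ntr J G F c)"
  by (simp add: mk_ntr_def opp_ntr_def)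

lemma is_functor_opp [simp]: "is_functor (opp J) (opp C) = is_functor J C"
proof -
  \<comment> \<open>One implication, stated for all categories, suffices: applied to the opposites
    it yields the converse, as \<open>opp\<close> is an involution. The same device recurs in later
    duality lemmas.\<close>
  have *: "is_functor (opp J) (opp C) F" if "is_functor J C F" for J :: "('a, 'b) cat" and C :: "('c, 'd) cat" and F
    by (rule is_functorI) (use that in \<open>simp_all add: functor_ext functor_Id functor_comp\<close>)
  show ?thesis
    using *[of J C] *[of "opp J" "opp C"] by (intro ext iffI) simp_all
qed

lemma is_ntr_opp [simp]: "is_ntr (opp J) (opp C) (opp_ntr t) = is_ntr J C t"
proof -
  have *: "is_ntr (opp J) (opp C) (opp_ntr t)" if "is_ntr J C t" for J :: "('a, 'b) cat" and C :: "('c, 'd) cat" and t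
    by (rule is_ntrI) (use that in \<open>simp_all add: ntr_ext ntr_nat\<close>)
  show ?thesis
    using *[of J C t] *[of "opp J" "opp C" "opp_ntr t"] by (intro iffI) simp_all
qed

lemma is_cocone_opp: "is_cocone (opp J) (opp C) = is_cone J C"
  by (simp add: is_cone_def is_cocone_def hom_opp fun_eq_iff)

lemma is_colimit_opp: "is_colimit (opp J) (opp C) = is_limit J C"
  by (simp add: is_limit_def is_colimit_def is_cocone_opp hom_opp fun_eq_iff)

lemma is_pushout_opp: "is_pushout (opp C) = is_pullback C"
  by (simp add: is_pushout_def is_pullback_def hom_opp fun_eq_iff)

lemma pushout_desc_opp: "pushout_desc (opp C) = pullback_lift C"
  by (simp add: pushout_desc_def pullback_lift_def is_pushout_opp hom_opp fun_eq_iff)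

text \<open>A diagram of shape \<open>J\<close> in \<open>opp C\<close> is a diagram of shape
  \<open>opp J\<close> in \<open>C\<close>, and reversing a shape keeps its objects and arrows in
  \<open>'u\<close>.\<close>

lemma complete_opp:
  fixes U :: "'u itself"
  assumes "cocomplete U C" shows "complete U (opp C)"
  unfolding complete_def
proof (intro allI impI)
  fix J :: "('u, 'u) cat" and D assume *: "category J \<and> is_functor J (opp C) D"
  then have "category (opp J) \<and> is_functor (opp J) C D"
    using category_opp is_functor_opp[of J "opp C"] by auto
  then show "\<exists>c l. is_limit J (opp C) D c l"
    using assms is_colimit_opp[of J "opp C"] unfolding cocomplete_def opp_simps by metis
qed

lemma cocomplete_opp:
  fixes U :: "'u itself"
  assumes "complete U C" shows "cocomplete U (opp C)"
  unfolding cocomplete_def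
proof (intro allI impI)
  fix J :: "('u, 'u) cat" and D assume *: "category J \<and> is_functor J (opp C) D"
  then have "category (opp J) \<and> is_functor (opp J) C D"
    using category_opp is_functor_opp[of J "opp C"] by auto
  then show "\<exists>c l. is_colimit J (opp C) D c l"
    using assms is_colimit_opp[of "opp J" C] unfolding complete_def by auto
qed

text \<open>Reversing arrows exchanges the two horizontal maps of the square, while a diagonal stays
  the same arrow.\<close>

lemma lifts_against_opp: "lifts_against (opp C) i p \<longleftrightarrow> lifts_against C p i"
proof -
  have "lifts_against C p i" if l: "lifts_against (opp C) i p" for C :: "('o, 'm) cat" and i p
    unfolding lifts_against_def
  proof (intro allI impI)
    fix u v
    assume "u \<in> hom C (Dom C p) (Dom C i) \<and> v \<in> hom C (Cod C p) (Cod C i) \<and> i \<cdot>\<^bsub>C\<^esub> u = v \<cdot>\<^bsub>C\<^esub> p"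
    with l[unfolded lifts_against_def, rule_format, of v u]
    show "\<exists>h. h \<in> hom C (Cod C p) (Dom C i) \<and> h \<cdot>\<^bsub>C\<^esub> p = u \<and> i \<cdot>\<^bsub>C\<^esub> h = v"
      by (simp add: hom_opp) blast
  qed
  from this[of C i p] this[of "opp C" p i] show ?thesis by auto
qed

lemma LLP_opp: "LLP (opp C) A = RLP C A"
  and RLP_opp: "RLP (opp C) A = LLP C A"
  by (simp_all add: LLP_def RLP_def lifts_against_opp)

section \<open>Chosen colimits, and their existence for shapes of other types than
  \<open>'u\<close>\<close>

section \<open>Colimits\<close>

context category
begin

lemma is_coconeI:
  assumes "c \<in> Obj C"
    and "\<And>j. j \<in> Obj J \<Longrightarrow> l j \<in> Arr C \<and> Dom C (l j) = omap D j \<and> Cod C (l j) = c"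
    and "\<And>u. u \<in> Arr J \<Longrightarrow> l (Cod J u) \<cdot> amap D u = l (Dom J u)"
  shows "is_cocone J C D c l"
  using assms by (auto simp: is_cocone_def in_hom)

lemma is_coconeD:
  assumes "is_cocone J C D c l"
  shows "c \<in> Obj C" "j \<in> Obj J \<Longrightarrow> l j \<in> Arr C" "j \<in> Obj J \<Longrightarrow> Dom C (l j) = omap D j"
    "j \<in> Obj J \<Longrightarrow> Cod C (l j) = c" "u \<in> Arr J \<Longrightarrow> l (Cod J u) \<cdot> amap D u = l (Dom J u)"
  using assms by (auto simp: is_cocone_def in_hom)

lemma cocone_comp:
  assumes "category J" "is_functor J C D" "is_cocone J C D c l" "h \<in> Arr C" "Dom C h = c"
  shows "is_cocone J C D (Cod C h) (\<lambda>j. h \<cdot> l j)"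
proof -
  interpret J: category J by fact
  note l = is_coconeD[OF assms(3)]
  show ?thesis
  proof (rule is_coconeI)
    fix u assume u: "u \<in> Arr J"
    then have "h \<cdot> (l (Cod J u) \<cdot> amap D u) = h \<cdot> l (Dom J u)" by (simp add: l(5))
    then show "h \<cdot> l (Cod J u) \<cdot> amap D u = h \<cdot> l (Dom J u)"
      using u assms(2,4,5) by (simp add: l(1-4))
  qed (use assms l in auto)
qed

text \<open>Both maps factor the cocone of the composites \<open>h \<cdot> l j\<close>, and such a
  factorisation is unique.\<close>

lemma colimit_eqI:
  assumes "category J" "is_functor J C D" "is_colimit J C D c l"
    and "h \<in> Arr C" "Dom C h = c" "h' \<in> Arr C" "Dom C h' = c" "Cod C h = Cod C h'"
    and "\<And>j. j \<in> Obj J \<Longrightarrow> h \<cdot> l j = h' \<cdot> l j"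
  shows "h = h'"
proof -
  have "is_cocone J C D (Cod C h) (\<lambda>j. h \<cdot> l j)"
    using assms by (intro cocone_comp) (auto simp: is_colimit_def)
  then have "\<exists>!k. k \<in> hom C c (Cod C h) \<and> (\<forall>j\<in>Obj J. k \<cdot> l j = h \<cdot> l j)"
    using assms(3) unfolding is_colimit_def by blast
  moreover have "h \<in> hom C c (Cod C h)" "h' \<in> hom C c (Cod C h)"
    using assms(4-8) by (auto simp: in_hom)
  ultimately show ?thesis
    using assms(9) by metis
qed

lemma pushout_eqI:
  assumes "f \<in> Arr C" "g \<in> Arr C" "is_pushout C f g p i j" "h \<in> hom C p c" "h' \<in> hom C p c"
    and "h \<cdot> i = h' \<cdot> i" "h \<cdot> j = h' \<cdot> j"
  shows "h = h'"
proof -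
  have ij: "i \<in> hom C (Cod C f) p" "j \<in> hom C (Cod C g) p" "i \<cdot> f = j \<cdot> g"
    using assms(3) by (simp_all add: is_pushout_def)
  then have "h \<cdot> i \<cdot> f = h \<cdot> j \<cdot> g" "h \<cdot> i \<in> hom C (Cod C f) c" "h \<cdot> j \<in> hom C (Cod C g) c"
    using assms(1,2,4) by (simp_all add: in_hom)
  then have "\<exists>!k. k \<in> hom C p c \<and> k \<cdot> i = h \<cdot> i \<and> k \<cdot> j = h \<cdot> j"
    using assms(3) unfolding is_pushout_def by blast
  with assms(4-) show ?thesis by metis
qed

end

text \<open>Converts between the two orders of the legs, which come up because duality exchanges
  them.\<close>

lemma is_pushout_commute: "is_pushout C f g p i j \<longleftrightarrow> is_pushout C g f p j i"
proof -
  have "is_pushout C g f p j i" if po: "is_pushout C f g p i j" for f g i j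
    unfolding is_pushout_def
  proof (intro conjI allI impI)
    fix c u v assume "u \<in> hom C (Cod C g) c \<and> v \<in> hom C (Cod C f) c \<and> u \<cdot>\<^bsub>C\<^esub> g = v \<cdot>\<^bsub>C\<^esub> f"
    then have "\<exists>!h. h \<in> hom C p c \<and> h \<cdot>\<^bsub>C\<^esub> i = v \<and> h \<cdot>\<^bsub>C\<^esub> j = u"
      using po unfolding is_pushout_def by (metis (no_types, lifting))
    then show "\<exists>!h. h \<in> hom C p c \<and> h \<cdot>\<^bsub>C\<^esub> j = u \<and> h \<cdot>\<^bsub>C\<^esub> i = v"
      by (simp add: conj_commute)
  qed (use po in \<open>simp_all add: is_pushout_def\<close>)
  from this[of f g i j] this[of g f j i] show ?thesis by blast
qed

text \<open>Existence is assumed for one diagram only, so that shapes of different types, the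
  discrete ones and the latching categories, can be treated alike.\<close>

locale colimit = category C + J: category J
  for C :: "('o, 'm) cat" (structure) and J :: "('j, 'k) cat" +
  fixes D
  assumes diag: "is_functor J C D"
    and ex_colimit: "\<exists>c l. is_colimit J C D c l"
begin

lemma colim: "is_colimit J C D (colim_ob J C D) (colim_in J C D)"
proof -
  have "case colim J C D of (c, l) \<Rightarrow> is_colimit J C D c l"
    using someI_ex[of "\<lambda>(c, l). is_colimit J C D c l"] ex_colimit by (simp add: colim_def)
  then show ?thesis by (simp add: colim_ob_def colim_in_def case_prod_beta)
qed

lemma cocone: "is_cocone J C D (colim_ob J C D) (colim_in J C D)"
  using colim by (simp add: is_colimit_def)

lemmas colim_ob_Obj [simp] = is_coconeD(1)[OF cocone]
  and colim_in_Arr [simp] = is_coconeD(2)[OF cocone]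
  and Dom_colim_in [simp] = is_coconeD(3)[OF cocone]
  and Cod_colim_in [simp] = is_coconeD(4)[OF cocone]
  and colim_in_nat = is_coconeD(5)[OF cocone]

lemma colim_eqI:
  assumes "h \<in> Arr C" "Dom C h = colim_ob J C D" "h' \<in> Arr C" "Dom C h' = colim_ob J C D" "Cod C h = Cod C h'"
    and "\<And>j. j \<in> Obj J \<Longrightarrow> h \<cdot> colim_in J C D j = h' \<cdot> colim_in J C D j"
  shows "h = h'"
  using colimit_eqI[OF J.category_axioms diag colim] assms by blast

lemma desc:
  assumes "is_cocone J C D c l"
  shows "colim_desc J C D c l \<in> Arr C" (is ?c1) "Dom C (colim_desc J C D c l) = colim_ob J C D" (is ?c2)
    "Cod C (colim_desc J C D c l) = c" (is ?c3) "j \<in> Obj J \<Longrightarrow> colim_desc J C D c l \<cdot> colim_in J C D j = l j"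
proof -
  have "\<exists>!h. h \<in> hom C (colim_ob J C D) c \<and> (\<forall>j\<in>Obj J. h \<cdot> colim_in J C D j = l j)"
    using colim assms unfolding is_colimit_def by blast
  from theI'[OF this, folded colim_desc_def]
  show ?c1 ?c2
    ?c3 "j \<in> Obj J \<Longrightarrow> colim_desc J C D c l \<cdot> colim_in J C D j = l j"
    by (auto simp: in_hom)
qed

end

lemma disc_simps [simp]:
  "Obj (disc I) = I" "Arr (disc I) = I" "Dom (disc I) i = i" "Cod (disc I) i = i" "Id (disc I) i = i"
  "g \<cdot>\<^bsub>disc I\<^esub> f = f"
  by (simp_all add: disc_def)

lemma category_disc: "category (disc I)"
  by (rule categoryI) simp_all

text \<open>\<open>cocomplete\<close> speaks only of shapes whose objects and arrows have type
  \<open>'u\<close>. Another shape is copied onto the images of the injections; cocones over the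
  copy are cocones over the original with the legs reindexed along \<open>e\<close>.\<close>

lemma relabelled_colimit_exists:
  fixes U :: "'u itself" and J :: "('j, 'k) cat" and e :: "'j \<Rightarrow> 'u" and e' :: "'k \<Rightarrow> 'u"
  assumes "category C" "cocomplete U C" "category J" and D: "is_functor J C D" and e: "inj e" "inj e'"
  shows "\<exists>c l. is_colimit J C D c l"
proof -
  interpret C: category C by fact
  interpret J: category J by fact
  define J' where "J' = \<lparr>Obj = e ` Obj J, Arr = e' ` Arr J, Dom = (\<lambda>f. e (Dom J (inv e' f))),
    Cod = (\<lambda>f. e (Cod J (inv e' f))), Id = (\<lambda>x. e' (Id J (inv e x))),
    Comp = (\<lambda>g f. e' (inv e' g \<cdot>\<^bsub>J\<^esub> inv e' f))\<rparr>"
  have inv [simp]: "inv e (e x) = x" "inv e' (e' f) = f" for x f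
    using e by simp_all
  have [simp]: "e x = e y \<longleftrightarrow> x = y" for x y using e by (simp add: inj_eq)
  have J' [simp]: "Obj J' = e ` Obj J" "Arr J' = e' ` Arr J" "Dom J' (e' f) = e (Dom J f)" "Cod J' (e' f) = e (Cod J f)"
    "Id J' (e x) = e' (Id J x)" "e' g \<cdot>\<^bsub>J'\<^esub> e' f = e' (g \<cdot>\<^bsub>J\<^esub> f)" for f g x
    by (simp_all add: J'_def)
  have catJ': "category J'"
    by (rule categoryI) auto
  define D' where "D' = mk_functor J' (\<lambda>x. omap D (inv e x)) (\<lambda>f. amap D (inv e' f))"
  have D': "is_functor J' C D'"
    unfolding D'_def
    by (rule mk_functor_is_functorI[OF catJ']) (use D in \<open>auto simp: functor_Id functor_comp\<close>)
  have cocone: "is_cocone J' C D' c l \<longleftrightarrow> is_cocone J C D c (l \<circ> e)" for c l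
    by (auto simp: is_cocone_def D'_def)
  obtain c l where cl: "is_colimit J' C D' c l"
    using assms(2) catJ' D' unfolding cocomplete_def by blast
  have "is_colimit J C D c (l \<circ> e)"
    unfolding is_colimit_def
  proof (intro conjI allI impI)
    show "is_cocone J C D c (l \<circ> e)"
      using cl cocone by (simp add: is_colimit_def)
    fix c' l' assume "is_cocone J C D c' l'"
    then have "is_cocone J' C D' c' (l' \<circ> inv e)"
      by (simp add: cocone comp_def)
    then have "\<exists>!h. h \<in> hom C c c' \<and> (\<forall>j\<in>Obj J'. h \<cdot>\<^bsub>C\<^esub> l j = (l' \<circ> inv e) j)"
      using cl unfolding is_colimit_def by blast
    then show "\<exists>!h. h \<in> hom C c c' \<and> (\<forall>j\<in>Obj J. h \<cdot>\<^bsub>C\<^esub> (l \<circ> e) j = l' j)"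
      by simp
  qed
  then show ?thesis by blast
qed

text \<open>An infinite type is equinumerous with its square; using the bijection twice encodes
  triples.\<close>

lemma infinite_inj_triple: "\<exists>e :: 'u::infinite \<times> 'u \<times> 'u \<Rightarrow> 'u. inj e"
proof -
  have "(card_of ((UNIV :: 'u set) \<times> (UNIV :: 'u set)), card_of (UNIV :: 'u set)) \<in> ordIso"
    using infinite_UNIV by (rule card_of_Times_same_infinite)
  then obtain p where "bij_betw p ((UNIV :: 'u set) \<times> (UNIV :: 'u set)) (UNIV :: 'u set)"
    unfolding card_of_ordIso[symmetric] by blast
  then have p: "inj p" by (simp add: bij_betw_def)
  have "inj (\<lambda>(x, y, z). p (x, p (y, z)))"
    by (rule injI) (clarsimp simp: inj_eq[OF p])
  then show ?thesis by blast
qed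

text \<open>Allows the pushout shape, which is built over \<open>nat\<close>, to be relabelled in
  \<open>'u\<close>.\<close>

lemma infinite_inj_nat: "\<exists>e :: nat \<Rightarrow> 'u::infinite. inj e"
  using infinite_UNIV infinite_countable_subset by blast

locale cocomplete_category = category C
  for C :: "('o, 'm) cat" (structure) +
  fixes U :: "'u::infinite itself"
  assumes cocomplete: "cocomplete U C"
begin

text \<open>The typing is that of a latching category: objects are arrows of the indexing category
  and arrows are triples of them.\<close>

lemma colimitI:
  fixes J :: "('u, 'u \<times> 'u \<times> 'u) cat"
  assumes "category J" "is_functor J C D"
  shows "colimit C J D"
proof -
  interpret J: category J by fact
  obtain e :: "'u \<times> 'u \<times> 'u \<Rightarrow> 'u" where "inj e" using infinite_inj_triple by blast
  with relabelled_colimit_exists[OF category_axioms cocomplete assms, of "\<lambda>x. x" e]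
  show ?thesis by unfold_locales (use assms in auto)
qed

lemma family_colimit:
  fixes I :: "'u set"
  assumes "\<And>i. i \<in> I \<Longrightarrow> X i \<in> Obj C"
  shows "colimit C (disc I) (family C I X)"
proof -
  have "is_functor (disc I) C (family C I X)"
    unfolding family_def by (rule mk_functor_is_functorI[OF category_disc]) (use assms in auto)
  then show ?thesis
    using category_disc[of I] cocomplete category_axioms
    by (simp add: colimit_def colimit_axioms_def cocomplete_def)
qed

lemma coprod:
  fixes I :: "'u set"
  assumes "\<And>i. i \<in> I \<Longrightarrow> X i \<in> Obj C"
  shows coprod_Obj: "coprod C I X \<in> Obj C"
    and coprod_in_Arr: "i \<in> I \<Longrightarrow> coprod_in C I X i \<in> Arr C"
    and Dom_coprod_in: "i \<in> I \<Longrightarrow> Dom C (coprod_in C I X i) = X i"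
    and Cod_coprod_in: "i \<in> I \<Longrightarrow> Cod C (coprod_in C I X i) = coprod C I X"
proof -
  interpret colimit C "disc I" "family C I X" by (rule family_colimit) fact
  show "coprod C I X \<in> Obj C" "i \<in> I \<Longrightarrow> coprod_in C I X i \<in> Arr C"
    "i \<in> I \<Longrightarrow> Cod C (coprod_in C I X i) = coprod C I X" by simp_all
  show "i \<in> I \<Longrightarrow> Dom C (coprod_in C I X i) = X i" using Dom_colim_in[of i] by (simp add: family_def)
qed

lemma cotuple:
  fixes I :: "'u set"
  assumes X: "\<And>i. i \<in> I \<Longrightarrow> X i \<in> Obj C" and c: "c \<in> Obj C"
    and l: "\<And>i. i \<in> I \<Longrightarrow> l i \<in> Arr C \<and> Dom C (l i) = X i \<and> Cod C (l i) = c"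
  shows cotuple_Arr: "cotuple C I X c l \<in> Arr C"
    and Dom_cotuple: "Dom C (cotuple C I X c l) = coprod C I X" (is ?c1)
    and Cod_cotuple: "Cod C (cotuple C I X c l) = c"
    and cotuple_in: "i \<in> I \<Longrightarrow> cotuple C I X c l \<cdot> coprod_in C I X i = l i"
proof -
  interpret colimit C "disc I" "family C I X" by (rule family_colimit) fact
  have "is_cocone (disc I) C (family C I X) c l"
    by (rule is_coconeI) (use X c l in \<open>auto simp: family_def\<close>)
  note * = desc[OF this]
  show "cotuple C I X c l \<in> Arr C" ?c1
    "Cod C (cotuple C I X c l) = c" "i \<in> I \<Longrightarrow> cotuple C I X c l \<cdot> coprod_in C I X i = l i"
    using * by simp_all
qed

lemma coprod_eqI:
  fixes I :: "'u set"
  assumes X: "\<And>i. i \<in> I \<Longrightarrow> X i \<in> Obj C"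
    and "h \<in> Arr C" "Dom C h = coprod C I X" "h' \<in> Arr C" "Dom C h' = coprod C I X" "Cod C h = Cod C h'"
    and "\<And>i. i \<in> I \<Longrightarrow> h \<cdot> coprod_in C I X i = h' \<cdot> coprod_in C I X i"
  shows "h = h'"
proof -
  interpret colimit C "disc I" "family C I X" by (rule family_colimit) fact
  show ?thesis by (rule colim_eqI) (use assms in auto)
qed

lemma pushout_exists:
  assumes f: "f \<in> Arr C" and g: "g \<in> Arr C" and fg: "Dom C f = Dom C g"
  shows "\<exists>p i j. is_pushout C f g p i j"
proof -
  \<comment> \<open>The span shape: 0, 1, 2 are the objects and also their identities, 3 is the
    arrow from 0 to 1 and 4 the arrow from 0 to 2, whence the codomain \<open>k - 2\<close>.\<close>
  define J :: "(nat, nat) cat" where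
    "J = \<lparr>Obj = {0, 1, 2}, Arr = {0, 1, 2, 3, 4}, Dom = (\<lambda>k. if k < 3 then k else 0),
      Cod = (\<lambda>k. if k < 3 then k else k - 2), Id = (\<lambda>k. k), Comp = (\<lambda>l k. if l < 3 then k else l)\<rparr>"
  have J [simp]: "Obj J = {0, 1, 2}" "Arr J = {0, 1, 2, 3, 4}" "Dom J k = (if k < 3 then k else 0)"
      "Cod J k = (if k < 3 then k else k - 2)" "Id J k = k" "l \<cdot>\<^bsub>J\<^esub> k = (if l < 3 then k else l)" for k l
    by (simp_all add: J_def)
  have catJ: "category J"
    by (rule categoryI) auto
  define D where "D = mk_functor J (\<lambda>k. [Dom C f, Cod C f, Cod C g] ! k)
    (\<lambda>k. [Id C (Dom C f), Id C (Cod C f), Id C (Cod C g), f, g] ! k)"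
  have D: "is_functor J C D"
    unfolding D_def
    by (rule mk_functor_is_functorI[OF catJ]) (use f g fg in auto)
  have Do [simp]: "omap D 0 = Dom C f" "omap D (Suc 0) = Cod C f" "omap D 2 = Cod C g" "amap D 0 = Id C (Dom C f)"
    "amap D (Suc 0) = Id C (Cod C f)" "amap D 2 = Id C (Cod C g)" "amap D 3 = f" "amap D 4 = g"
    by (simp_all add: D_def)
  obtain e :: "nat \<Rightarrow> 'u" where e: "inj e" using infinite_inj_nat by blast
  obtain c l where cl: "is_colimit J C D c l"
    using relabelled_colimit_exists[OF category_axioms cocomplete catJ D e e] by blast
  then have "is_cocone J C D c l" by (simp add: is_colimit_def)
  note l = is_coconeD[OF this]
  have lf: "l 1 \<cdot> f = l 0" "l 2 \<cdot> g = l 0"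
    using l(5)[of 3] l(5)[of 4] by simp_all
  have "is_pushout C f g c (l 1) (l 2)"
    unfolding is_pushout_def
  proof (intro conjI allI impI)
    fix c' u v assume *: "u \<in> hom C (Cod C f) c' \<and> v \<in> hom C (Cod C g) c' \<and> u \<cdot> f = v \<cdot> g"
    define l' where "l' k = [u \<cdot> f, u, v] ! k" for k
    have l': "l' 0 = u \<cdot> f" "l' (Suc 0) = u" "l' 2 = v"
      by (simp_all add: l'_def)
    have "is_cocone J C D c' l'"
      by (rule is_coconeI) (use * f g fg in \<open>auto simp: in_hom l'\<close>)
    then have "\<exists>!h. h \<in> hom C c c' \<and> (\<forall>j\<in>Obj J. h \<cdot> l j = l' j)"
      using cl unfolding is_colimit_def by blast
    \<comment> \<open>The leg at the apex 0 is determined by the leg at 1, so the universal property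
      of the colimit needs to mention only 1 and 2.\<close>
    moreover have "h \<cdot> l 0 = l' 0" if "h \<in> hom C c c'" "h \<cdot> l 1 = u" for h
    proof -
      have "h \<cdot> l 1 \<cdot> f = h \<cdot> (l 1 \<cdot> f)"
        using that(1) l(2-4)[of 1] f by (intro comp_assoc) (auto simp: in_hom)
      then show ?thesis using that(2) lf(1) by (simp add: l')
    qed
    ultimately show "\<exists>!h. h \<in> hom C c c' \<and> h \<cdot> l 1 = u \<and> h \<cdot> l 2 = v"
      by (simp add: l') (metis One_nat_def)
  qed (use l(2-4)[of 1] l(2-4)[of 2] lf in \<open>auto simp: in_hom\<close>)
  then show ?thesis by blast
qed

text \<open>The pushout inside \<open>pushout_desc\<close> is chosen and hidden. It is returned here
  together with the factorisation property for all \<open>u\<close> and \<open>v\<close>, so that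
  several facts can refer to the same pushout.\<close>

lemma pushout_desc:
  assumes f: "f \<in> Arr C" and g: "g \<in> Arr C" and fg: "Dom C f = Dom C g"
  obtains p i j where "is_pushout C f g p i j"
    and "\<And>c u v. \<lbrakk>u \<in> hom C (Cod C f) c; v \<in> hom C (Cod C g) c; u \<cdot> f = v \<cdot> g\<rbrakk> \<Longrightarrow>
      pushout_desc C f g u v \<in> hom C p c \<and> pushout_desc C f g u v \<cdot> i = u \<and> pushout_desc C f g u v \<cdot> j = v"
proof -
  define q where "q = (SOME (p, i, j). is_pushout C f g p i j)"
  have q: "case q of (p, i, j) \<Rightarrow> is_pushout C f g p i j"
    using someI_ex[of "\<lambda>(p, i, j). is_pushout C f g p i j"] pushout_exists[OF assms] by (simp add: q_def)
  obtain p i j where pij: "q = (p, i, j)" by (cases q) auto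
  have po: "is_pushout C f g p i j" using q pij by simp
  show thesis
  proof (rule that[OF po])
    fix c u v assume *: "u \<in> hom C (Cod C f) c" "v \<in> hom C (Cod C g) c" "u \<cdot> f = v \<cdot> g"
    have "\<exists>!h. h \<in> hom C p c \<and> h \<cdot> i = u \<and> h \<cdot> j = v"
      using po * unfolding is_pushout_def by blast
    moreover have "pushout_desc C f g u v = (THE h. h \<in> hom C p c \<and> h \<cdot> i = u \<and> h \<cdot> j = v)"
      using *(1) pij by (simp add: pushout_desc_def flip: q_def) (simp add: in_hom)
    ultimately show "pushout_desc C f g u v \<in> hom C p c \<and> pushout_desc C f g u v \<cdot> i = u \<and> pushout_desc C f g u v \<cdot> j = v"
      using theI'[of "\<lambda>h. h \<in> hom C p c \<and> h \<cdot> i = u \<and> h \<cdot> j = v"] by simp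
  qed
qed

end

text \<open>As records, \<open>opp (disc I)\<close> and \<open>disc I\<close> differ in the
  composition of pairs that do not compose. Hence the general duality for colimits does not give
  this form, and the definitions are compared directly.\<close>

lemma is_colimit_disc_opp: "is_colimit (disc I) (opp C) D = is_limit (disc I) C D"
  by (simp add: is_limit_def is_colimit_def is_cocone_def is_cone_def hom_opp fun_eq_iff)

lemma family_opp [simp]: "family (opp C) I X = family C I X"
  by (simp add: family_def)

lemma lim_disc_opp: "lim (disc I) C D = colim (disc I) (opp C) D"
  by (simp add: lim_def colim_def is_colimit_disc_opp)

lemma product_opp: "product C I X = coprod (opp C) I X"
  by (simp add: lim_ob_def colim_ob_def lim_disc_opp)

lemma product_pr_opp: "product_pr C I X = coprod_in (opp C) I X"
  by (simp add: lim_pr_def colim_in_def lim_disc_opp)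

lemma tuple_opp: "tuple C I X = cotuple (opp C) I X"
  by (simp add: lim_lift_def colim_desc_def product_opp product_pr_opp hom_opp fun_eq_iff)

locale complete_category = category C
  for C :: "('o, 'm) cat" (structure) +
  fixes U :: "'u::infinite itself"
  assumes complete: "complete U C"
begin

text \<open>Products of \<open>C\<close> are coproducts of \<open>opp C\<close>; the facts about
  products below are the coproduct facts read back through this identification.\<close>

sublocale opp: cocomplete_category "opp C" U
  by (simp add: cocomplete_category_def cocomplete_category_axioms_def category_opp category_axioms
      cocomplete_opp complete)

lemmas product_Obj = opp.coprod_Obj[folded product_opp, simplified]
  and product_pr_Arr = opp.coprod_in_Arr[folded product_pr_opp, simplified]
  and Dom_product_pr = opp.Cod_coprod_in[folded product_pr_opp product_opp, simplified]
  and Cod_product_pr = opp.Dom_coprod_in[folded product_pr_opp product_opp, simplified]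
  and tuple_Arr = opp.cotuple_Arr[folded tuple_opp, simplified]
  and Dom_tuple = opp.Cod_cotuple[folded tuple_opp, simplified]
  and Cod_tuple = opp.Dom_cotuple[folded tuple_opp product_opp, simplified]
  and pr_tuple = opp.cotuple_in[folded tuple_opp product_pr_opp, simplified]
  and product_eqI = opp.coprod_eqI[folded product_pr_opp product_opp, simplified]

end

section \<open>Latching objects and relative latching maps over a direct category\<close>

section \<open>Latching objects\<close>

locale direct_category = category J for J :: "('r, 'a) cat" (structure) +
  fixes d :: "'r \<Rightarrow> nat"
  assumes raises: "\<lbrakk>f \<in> Arr J; f \<notin> Id J ` Obj J\<rbrakk> \<Longrightarrow> d (Dom J f) < d (Cod J f)"
begin

lemma raises_weak: "f \<in> Arr J \<Longrightarrow> d (Dom J f) \<le> d (Cod J f)"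
  using raises[of f] by fastforce

lemma arr_cases: "f \<in> Arr J \<Longrightarrow> f = Id J (Cod J f) \<and> Dom J f = Cod J f \<or> d (Dom J f) < d (Cod J f)"
  using raises[of f] by fastforce

end

text \<open>Colimits supply latching objects and pushouts; the products come in through the test
  diagrams of \<open>lifts_imp_latching\<close>.\<close>

locale direct_diagrams =
  J: direct_category J d + M: cocomplete_category M U + M: complete_category M U
  for J :: "('u::infinite, 'u) cat" and d :: "'u \<Rightarrow> nat" and M :: "('o, 'm) cat" (structure) and U :: "'u itself"
begin

abbreviation "LO \<equiv> latching_objs J d (Arr J)"
abbreviation "LC \<equiv> latching_cat J d (Arr J)"
abbreviation "LD \<equiv> latching_diag J d (Arr J)"
abbreviation "Lin \<Phi> r \<equiv> colim_in (LC r) M (LD \<Phi> r)"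
abbreviation "Lob \<equiv> latching_ob J d (Arr J) M"
abbreviation "Lmap \<equiv> latching_map J d (Arr J) M"
abbreviation "Larr \<equiv> latching_arr J d (Arr J) M"

lemma LO_iff: "a \<in> LO r \<longleftrightarrow> a \<in> Arr J \<and> Cod J a = r \<and> d (Dom J a) < d r"
  by (simp add: latching_objs_def)

text \<open>Precomposition cannot raise the degree of the source.\<close>

lemma LO_comp: "\<lbrakk>a \<in> LO r; h \<in> Arr J; Cod J h = Dom J a\<rbrakk> \<Longrightarrow> a \<cdot>\<^bsub>J\<^esub> h \<in> LO r"
  using J.raises_weak[of h] by (auto simp: LO_iff)

lemma LC_simps [simp]:
  "Obj (LC r) = LO r"
  "Arr (LC r) = {(a, h, b). a \<in> LO r \<and> b \<in> LO r \<and> h \<in> Arr J \<and> Dom J h = Dom J a \<and> Cod J h = Dom J b \<and> b \<cdot>\<^bsub>J\<^esub> h = a}"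
  "Dom (LC r) (a, h, b) = a" "Cod (LC r) (a, h, b) = b" "Id (LC r) a = (a, Id J (Dom J a), a)"
  "(a', h', b') \<cdot>\<^bsub>LC r\<^esub> (a, h, b) = (a, h' \<cdot>\<^bsub>J\<^esub> h, b')"
  by (simp_all add: latching_cat_def)

lemma category_LC: "category (LC r)"
proof (rule categoryI)
  fix f g assume *: "f \<in> Arr (LC r)" "g \<in> Arr (LC r)" "Cod (LC r) f = Dom (LC r) g"
  obtain a h b h' c where [simp]: "f = (a, h, b)" "g = (b, h', c)" using *(3) by (cases f; cases g) simp
  have "c \<cdot>\<^bsub>J\<^esub> (h' \<cdot>\<^bsub>J\<^esub> h) = b \<cdot>\<^bsub>J\<^esub> h"
    using *(1,2) by (intro J.comp_comp_eq) (simp_all add: LO_iff)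
  then show "g \<cdot>\<^bsub>LC r\<^esub> f \<in> Arr (LC r) \<and> Dom (LC r) (g \<cdot>\<^bsub>LC r\<^esub> f) = Dom (LC r) f \<and>
      Cod (LC r) (g \<cdot>\<^bsub>LC r\<^esub> f) = Cod (LC r) g"
    using *(1,2) by simp
next
  fix f g k assume *: "f \<in> Arr (LC r)" "g \<in> Arr (LC r)" "k \<in> Arr (LC r)"
    "Cod (LC r) f = Dom (LC r) g" "Cod (LC r) g = Dom (LC r) k"
  then show "k \<cdot>\<^bsub>LC r\<^esub> g \<cdot>\<^bsub>LC r\<^esub> f = k \<cdot>\<^bsub>LC r\<^esub> (g \<cdot>\<^bsub>LC r\<^esub> f)"
    by (cases f; cases g; cases k) simp
next
  fix f assume "f \<in> Arr (LC r)"
  then show "f \<cdot>\<^bsub>LC r\<^esub> Id (LC r) (Dom (LC r) f) = f \<and> Id (LC r) (Cod (LC r) f) \<cdot>\<^bsub>LC r\<^esub> f = f"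
    "Dom (LC r) f \<in> Obj (LC r) \<and> Cod (LC r) f \<in> Obj (LC r)"
    by (cases f; simp)+
qed (simp add: LO_iff)

lemma LD_simps [simp]:
  "a \<in> LO r \<Longrightarrow> omap (LD \<Phi> r) a = omap \<Phi> (Dom J a)"
  "(a, h, b) \<in> Arr (LC r) \<Longrightarrow> amap (LD \<Phi> r) (a, h, b) = amap \<Phi> h"
  by (simp_all add: latching_diag_def)

lemma functor_LD: "is_functor J M \<Phi> \<Longrightarrow> is_functor (LC r) M (LD \<Phi> r)"
proof -
  assume \<Phi>: "is_functor J M \<Phi>"
  show ?thesis
    unfolding latching_diag_def
  proof (rule mk_functor_is_functorI[OF category_LC])
    fix f g assume *: "f \<in> Arr (LC r)" "g \<in> Arr (LC r)" "Cod (LC r) f = Dom (LC r) g"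
    then show "(case g \<cdot>\<^bsub>LC r\<^esub> f of (f, h, g) \<Rightarrow> amap \<Phi> h) =
        (case g of (f, h, g) \<Rightarrow> amap \<Phi> h) \<cdot> (case f of (f, h, g) \<Rightarrow> amap \<Phi> h)"
      by (cases f; cases g) (simp add: functor_comp[OF \<Phi>])
  next
    fix f assume "f \<in> Arr (LC r)"
    then show "(case f of (f, h, g) \<Rightarrow> amap \<Phi> h) \<in> Arr M \<and>
      Dom M (case f of (f, h, g) \<Rightarrow> amap \<Phi> h) = omap \<Phi> (Dom J (Dom (LC r) f)) \<and>
      Cod M (case f of (f, h, g) \<Rightarrow> amap \<Phi> h) = omap \<Phi> (Dom J (Cod (LC r) f))"
      using \<Phi> by (cases f) simp
  qed (use \<Phi> in \<open>simp_all add: LO_iff functor_Id\<close>)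
qed

lemma colimit_LD: "is_functor J M \<Phi> \<Longrightarrow> colimit M (LC r) (LD \<Phi> r)"
  by (rule M.colimitI[OF category_LC functor_LD])

lemma Lob_alt: "colim_ob (LC r) M (LD \<Phi> r) = Lob \<Phi> r"
  by (simp add: latching_ob_def)

lemma Lob_Obj: "is_functor J M \<Phi> \<Longrightarrow> Lob \<Phi> r \<in> Obj M"
  using colimit.colim_ob_Obj[OF colimit_LD] by (simp add: Lob_alt)

text \<open>The last clause is the cocone law for the arrow that \<open>h\<close> induces from its
  composite with \<open>a\<close> to \<open>a\<close>. With it, the triples that encode arrows of
  the latching category no longer appear in later arguments.\<close>

lemma Lin:
  assumes "is_functor J M \<Phi>" "a \<in> LO r"
  shows "Lin \<Phi> r a \<in> Arr M" "Dom M (Lin \<Phi> r a) = omap \<Phi> (Dom J a)" (is ?c1) "Cod M (Lin \<Phi> r a) = Lob \<Phi> r" (is ?c2)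
    and "\<lbrakk>h \<in> Arr J; Cod J h = Dom J a\<rbrakk> \<Longrightarrow> Lin \<Phi> r a \<cdot> amap \<Phi> h = Lin \<Phi> r (a \<cdot>\<^bsub>J\<^esub> h)"
proof -
  interpret colimit M "LC r" "LD \<Phi> r" by (rule colimit_LD) fact
  show "Lin \<Phi> r a \<in> Arr M" ?c1 ?c2
    using assms(2) by (simp_all add: Lob_alt)
  assume h: "h \<in> Arr J" "Cod J h = Dom J a"
  then have "(a \<cdot>\<^bsub>J\<^esub> h, h, a) \<in> Arr (LC r)"
    using assms(2) LO_comp[OF assms(2) h] by (simp add: LO_iff)
  from colim_in_nat[OF this] show "Lin \<Phi> r a \<cdot> amap \<Phi> h = Lin \<Phi> r (a \<cdot>\<^bsub>J\<^esub> h)"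
    using \<open>(a \<cdot>\<^bsub>J\<^esub> h, h, a) \<in> Arr (LC r)\<close> LD_simps(2)[of "a \<cdot>\<^bsub>J\<^esub> h" h a r \<Phi>] by simp
qed

lemma L_eqI:
  assumes "is_functor J M \<Phi>" "h \<in> Arr M" "Dom M h = Lob \<Phi> r" "h' \<in> Arr M" "Dom M h' = Lob \<Phi> r" "Cod M h = Cod M h'"
    and "\<And>a. a \<in> LO r \<Longrightarrow> h \<cdot> Lin \<Phi> r a = h' \<cdot> Lin \<Phi> r a"
  shows "h = h'"
proof -
  interpret colimit M "LC r" "LD \<Phi> r" by (rule colimit_LD) fact
  show ?thesis by (rule colim_eqI) (use assms in \<open>simp_all add: Lob_alt\<close>)
qed

lemma L_desc:
  fixes l r c \<Phi>
  defines "k \<equiv> colim_desc (LC r) M (LD \<Phi> r) c l"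
  assumes "is_functor J M \<Phi>" "c \<in> Obj M"
    and "\<And>a. a \<in> LO r \<Longrightarrow> l a \<in> Arr M \<and> Dom M (l a) = omap \<Phi> (Dom J a) \<and> Cod M (l a) = c"
    and "\<And>a h. \<lbrakk>a \<in> LO r; h \<in> Arr J; Cod J h = Dom J a\<rbrakk> \<Longrightarrow> l a \<cdot> amap \<Phi> h = l (a \<cdot>\<^bsub>J\<^esub> h)"
  shows "k \<in> Arr M" "Dom M k = Lob \<Phi> r" "Cod M k = c" "a \<in> LO r \<Longrightarrow> k \<cdot> Lin \<Phi> r a = l a"
proof -
  interpret colimit M "LC r" "LD \<Phi> r" by (rule colimit_LD) fact
  have "is_cocone (LC r) M (LD \<Phi> r) c l"
  proof (rule M.is_coconeI)
    fix u assume u: "u \<in> Arr (LC r)"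
    obtain a h b where abh: "u = (a, h, b)" by (cases u)
    show "l (Cod (LC r) u) \<cdot> amap (LD \<Phi> r) u = l (Dom (LC r) u)"
      using u assms(5)[of b h] LD_simps(2)[of a h b r \<Phi>] by (simp add: abh)
  qed (use assms in auto)
  from desc[OF this]
  show "k \<in> Arr M" "Dom M k = Lob \<Phi> r" "Cod M k = c" "a \<in> LO r \<Longrightarrow> k \<cdot> Lin \<Phi> r a = l a"
    by (simp_all add: k_def Lob_alt)
qed

lemma Lmap:
  assumes "is_functor J M \<Phi>" "r \<in> Obj J"
  shows "Lmap \<Phi> r \<in> Arr M" "Dom M (Lmap \<Phi> r) = Lob \<Phi> r" "Cod M (Lmap \<Phi> r) = omap \<Phi> r"
    "a \<in> LO r \<Longrightarrow> Lmap \<Phi> r \<cdot> Lin \<Phi> r a = amap \<Phi> a"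
  unfolding latching_map_def using assms by (auto intro!: L_desc simp: LO_iff functor_comp)

lemma Larr:
  assumes "is_ntr J M \<tau>"
  shows "Larr \<tau> r \<in> Arr M" "Dom M (Larr \<tau> r) = Lob (nsrc \<tau>) r" (is ?c1) "Cod M (Larr \<tau> r) = Lob (ntgt \<tau>) r" (is ?c2)
    "a \<in> LO r \<Longrightarrow> Larr \<tau> r \<cdot> Lin (nsrc \<tau>) r a = Lin (ntgt \<tau>) r a \<cdot> ncmp \<tau> (Dom J a)"
proof -
  note src = ntr_src[OF assms] and tgt = ntr_tgt[OF assms]
  have nat: "Lin (ntgt \<tau>) r a \<cdot> ncmp \<tau> (Dom J a) \<cdot> amap (nsrc \<tau>) h =
      Lin (ntgt \<tau>) r (a \<cdot>\<^bsub>J\<^esub> h) \<cdot> ncmp \<tau> (Dom J (a \<cdot>\<^bsub>J\<^esub> h))"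
    if *: "a \<in> LO r" "h \<in> Arr J" "Cod J h = Dom J a" for a h
  proof -
    have "Lin (ntgt \<tau>) r a \<cdot> ncmp \<tau> (Dom J a) \<cdot> amap (nsrc \<tau>) h =
        Lin (ntgt \<tau>) r a \<cdot> (ncmp \<tau> (Cod J h) \<cdot> amap (nsrc \<tau>) h)"
      using assms * by (simp add: Lin LO_iff)
    also have "\<dots> = Lin (ntgt \<tau>) r a \<cdot> (amap (ntgt \<tau>) h \<cdot> ncmp \<tau> (Dom J h))"
      using assms * by (simp add: ntr_nat)
    also have "\<dots> = Lin (ntgt \<tau>) r (a \<cdot>\<^bsub>J\<^esub> h) \<cdot> ncmp \<tau> (Dom J h)"
      using assms * by (intro M.comp_comp_eq) (simp_all add: Lin LO_iff)
    finally show ?thesis using * by (simp add: LO_iff)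
  qed
  show "Larr \<tau> r \<in> Arr M" ?c1 ?c2
    "a \<in> LO r \<Longrightarrow> Larr \<tau> r \<cdot> Lin (nsrc \<tau>) r a = Lin (ntgt \<tau>) r a \<cdot> ncmp \<tau> (Dom J a)"
    unfolding latching_arr_def
    by (rule L_desc[OF src]; use assms nat Lob_Obj[OF tgt] in \<open>force simp: Lin LO_iff\<close>)+
qed

text \<open>This commuting square is what lets the pushout map to the value of the target diagram,
  so it is the reason that the relative latching map exists.\<close>

lemma Lmap_nat:
  assumes "is_ntr J M \<tau>" "r \<in> Obj J"
  shows "ncmp \<tau> r \<cdot> Lmap (nsrc \<tau>) r = Lmap (ntgt \<tau>) r \<cdot> Larr \<tau> r"
proof (rule L_eqI[OF ntr_src[OF assms(1)]])
  fix a assume a: "a \<in> LO r"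
  have "ncmp \<tau> r \<cdot> Lmap (nsrc \<tau>) r \<cdot> Lin (nsrc \<tau>) r a = ncmp \<tau> r \<cdot> amap (nsrc \<tau>) a"
    using assms a by (simp add: Lmap Lin)
  also have "\<dots> = amap (ntgt \<tau>) a \<cdot> ncmp \<tau> (Dom J a)"
    using assms a ntr_nat[of J M \<tau> a] by (simp add: LO_iff)
  also have "\<dots> = Lmap (ntgt \<tau>) r \<cdot> (Lin (ntgt \<tau>) r a \<cdot> ncmp \<tau> (Dom J a))"
    using assms a by (intro M.comp_comp_eq[symmetric]) (simp_all add: Lmap Lin LO_iff)
  also have "\<dots> = Lmap (ntgt \<tau>) r \<cdot> Larr \<tau> r \<cdot> Lin (nsrc \<tau>) r a"
    using assms a by (simp add: Lmap Larr Lin)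
  finally show "ncmp \<tau> r \<cdot> Lmap (nsrc \<tau>) r \<cdot> Lin (nsrc \<tau>) r a =
    Lmap (ntgt \<tau>) r \<cdot> Larr \<tau> r \<cdot> Lin (nsrc \<tau>) r a" .
qed (use assms in \<open>simp_all add: Lmap Larr\<close>)

text \<open>The chosen pushouts for \<open>f, g\<close> and for \<open>g, f\<close> need not agree, and duality exchanges the two
  orders; hence the results are stated for every arrow with this property.\<close>

definition is_relative_latching :: "('u, 'u, 'o, 'm) ntr \<Rightarrow> 'u \<Rightarrow> 'm \<Rightarrow> bool" where
  "is_relative_latching \<tau> r \<rho> \<longleftrightarrow> (\<exists>Q i j. is_pushout M (Lmap (nsrc \<tau>) r) (Larr \<tau> r) Q i j \<and>
     \<rho> \<in> hom M Q (omap (ntgt \<tau>) r) \<and> \<rho> \<cdot> i = ncmp \<tau> r \<and> \<rho> \<cdot> j = Lmap (ntgt \<tau>) r)"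

lemma relative_latching_map:
  assumes "is_ntr J M \<tau>" "r \<in> Obj J"
  shows "is_relative_latching \<tau> r (relative_latching_map J d (Arr J) M \<tau> r)" (is ?c1)
    and relative_latching_map_flipped:
      "is_relative_latching \<tau> r (pushout_desc M (Larr \<tau> r) (Lmap (nsrc \<tau>) r) (Lmap (ntgt \<tau>) r) (ncmp \<tau> r))"
proof -
  let ?f = "Lmap (nsrc \<tau>) r" and ?g = "Larr \<tau> r"
  have fg: "?f \<in> Arr M" "?g \<in> Arr M" "Dom M ?f = Dom M ?g" "Dom M ?g = Dom M ?f"
    using assms by (simp_all add: Lmap Larr)
  have uv: "ncmp \<tau> r \<in> hom M (Cod M ?f) (omap (ntgt \<tau>) r)" "Lmap (ntgt \<tau>) r \<in> hom M (Cod M ?g) (omap (ntgt \<tau>) r)"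
    using assms by (simp_all add: in_hom Lmap Larr)
  note nat = Lmap_nat[OF assms]
  obtain Q i j where "is_pushout M ?f ?g Q i j" and
    "\<And>c u v. \<lbrakk>u \<in> hom M (Cod M ?f) c; v \<in> hom M (Cod M ?g) c; u \<cdot> ?f = v \<cdot> ?g\<rbrakk> \<Longrightarrow>
      pushout_desc M ?f ?g u v \<in> hom M Q c \<and> pushout_desc M ?f ?g u v \<cdot> i = u \<and>
      pushout_desc M ?f ?g u v \<cdot> j = v"
    using M.pushout_desc[OF fg(1-3)] by blast
  from this(1) this(2)[OF uv nat] show ?c1
    unfolding is_relative_latching_def relative_latching_map_def by blast
  obtain Q i j where "is_pushout M ?g ?f Q i j" and
    "\<And>c u v. \<lbrakk>u \<in> hom M (Cod M ?g) c; v \<in> hom M (Cod M ?f) c; u \<cdot> ?g = v \<cdot> ?f\<rbrakk> \<Longrightarrow>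
      pushout_desc M ?g ?f u v \<in> hom M Q c \<and> pushout_desc M ?g ?f u v \<cdot> i = u \<and>
      pushout_desc M ?g ?f u v \<cdot> j = v"
    using M.pushout_desc[OF fg(2,1,4)] by blast
  from this(1)[unfolded is_pushout_commute[of M ?g]] this(2)[OF uv(2,1) nat[symmetric]]
  show "is_relative_latching \<tau> r (pushout_desc M ?g ?f (Lmap (ntgt \<tau>) r) (ncmp \<tau> r))"
    unfolding is_relative_latching_def by blast
qed

end

section \<open>From relative latching maps to lifts of diagrams\<close>

section \<open>Projective cofibrations of direct diagrams\<close>

context direct_diagrams
begin

text \<open>One stage of the recursion on the degree. The components \<open>f\<close> known in lower
  degree assemble into a map \<open>w\<close> on the latching object of \<open>ntgt \<tau>\<close>;
  with \<open>ncmp u r\<close> it gives a map \<open>k\<close> on the pushout. A lift of the square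
  formed by \<open>k\<close> and \<open>ncmp v r\<close> is the new component, and the last conjunct
  is its naturality along arrows from lower degree.\<close>

lemma lift_step:
  assumes \<tau>: "is_ntr J M \<tau>" and p: "is_ntr J M p" and u: "is_ntr J M u" and v: "is_ntr J M v"
    and ends: "nsrc u = nsrc \<tau>" "ntgt u = nsrc p" "nsrc v = ntgt \<tau>" "ntgt v = ntgt p"
    and sq: "\<And>x. x \<in> Obj J \<Longrightarrow> ncmp p x \<cdot> ncmp u x = ncmp v x \<cdot> ncmp \<tau> x"
    and r: "r \<in> Obj J" and rho: "is_relative_latching \<tau> r \<rho>"
    and lift: "lifts_against M \<rho> (ncmp p r)"
    and f: "\<And>x. \<lbrakk>x \<in> Obj J; d x < d r\<rbrakk> \<Longrightarrow> f x \<in> Arr M \<and> Dom M (f x) = omap (ntgt \<tau>) x \<and> Cod M (f x) = omap (nsrc p) x"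
    and f\<tau>: "\<And>x. \<lbrakk>x \<in> Obj J; d x < d r\<rbrakk> \<Longrightarrow> f x \<cdot> ncmp \<tau> x = ncmp u x"
    and pf: "\<And>x. \<lbrakk>x \<in> Obj J; d x < d r\<rbrakk> \<Longrightarrow> ncmp p x \<cdot> f x = ncmp v x"
    and fnat: "\<And>h. \<lbrakk>h \<in> Arr J; d (Cod J h) < d r\<rbrakk> \<Longrightarrow>
      f (Cod J h) \<cdot> amap (ntgt \<tau>) h = amap (nsrc p) h \<cdot> f (Dom J h)"
  shows "\<exists>h. h \<in> Arr M \<and> Dom M h = omap (ntgt \<tau>) r \<and> Cod M h = omap (nsrc p) r \<and>
    h \<cdot> ncmp \<tau> r = ncmp u r \<and> ncmp p r \<cdot> h = ncmp v r \<and>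
    (\<forall>a\<in>LO r. h \<cdot> amap (ntgt \<tau>) a = amap (nsrc p) a \<cdot> f (Dom J a))"
proof -
  note fn = ntr_src[OF \<tau>] ntr_tgt[OF \<tau>] ntr_src[OF p] ntr_tgt[OF p]
  have f': "f (Dom J a) \<in> Arr M \<and> Dom M (f (Dom J a)) = omap (ntgt \<tau>) (Dom J a) \<and>
      Cod M (f (Dom J a)) = omap (nsrc p) (Dom J a)" if "a \<in> LO r" for a
    using f[of "Dom J a"] that by (simp add: LO_iff)
  \<comment> \<open>The cocone law for \<open>w\<close>: the codomain of \<open>h\<close> is the
    source of \<open>a\<close>, hence has degree below that of \<open>r\<close>, where
    \<open>f\<close> is already natural.\<close>
  have nat: "amap (nsrc p) a \<cdot> f (Dom J a) \<cdot> amap (ntgt \<tau>) h =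
      amap (nsrc p) (a \<cdot>\<^bsub>J\<^esub> h) \<cdot> f (Dom J (a \<cdot>\<^bsub>J\<^esub> h))"
    if a: "a \<in> LO r" and h: "h \<in> Arr J" "Cod J h = Dom J a" for a h
  proof -
    have fh: "f (Dom J h) \<in> Arr M \<and> Dom M (f (Dom J h)) = omap (ntgt \<tau>) (Dom J h) \<and>
        Cod M (f (Dom J h)) = omap (nsrc p) (Dom J h)"
      using f'[OF LO_comp[OF a h]] a h by (simp add: LO_iff)
    have "amap (nsrc p) a \<cdot> f (Dom J a) \<cdot> amap (ntgt \<tau>) h =
        amap (nsrc p) a \<cdot> (f (Cod J h) \<cdot> amap (ntgt \<tau>) h)"
      using a h f'[OF a] fn by (simp add: LO_iff)
    also have "\<dots> = amap (nsrc p) a \<cdot> (amap (nsrc p) h \<cdot> f (Dom J h))"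
      using fnat[of h] a h by (simp add: LO_iff)
    also have "\<dots> = amap (nsrc p) (a \<cdot>\<^bsub>J\<^esub> h) \<cdot> f (Dom J h)"
      using a h fh fn by (intro M.comp_comp_eq) (simp_all add: LO_iff functor_comp)
    finally show ?thesis using a h by (simp add: LO_iff)
  qed
  define w where "w = colim_desc (LC r) M (LD (ntgt \<tau>) r) (omap (nsrc p) r) (\<lambda>a. amap (nsrc p) a \<cdot> f (Dom J a))"
  have w: "w \<in> Arr M" "Dom M w = Lob (ntgt \<tau>) r" "Cod M w = omap (nsrc p) r"
    "\<And>a. a \<in> LO r \<Longrightarrow> w \<cdot> Lin (ntgt \<tau>) r a = amap (nsrc p) a \<cdot> f (Dom J a)"
    unfolding w_def by (rule L_desc[OF fn(2)]; use nat f' fn r in \<open>force simp: LO_iff\<close>)+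
  obtain Q i j where po: "is_pushout M (Lmap (nsrc \<tau>) r) (Larr \<tau> r) Q i j"
    and rel: "\<rho> \<in> hom M Q (omap (ntgt \<tau>) r)" "\<rho> \<cdot> i = ncmp \<tau> r" "\<rho> \<cdot> j = Lmap (ntgt \<tau>) r"
    using rho unfolding is_relative_latching_def by blast
  have ij: "i \<in> hom M (omap (nsrc \<tau>) r) Q" "j \<in> hom M (Lob (ntgt \<tau>) r) Q"
    using po r \<tau> by (simp_all add: is_pushout_def Lmap Larr)
  note po_eqI = M.pushout_eqI[OF Lmap(1)[OF fn(1) r] Larr(1)[OF \<tau>] po]
  \<comment> \<open>Needed for a map out of the pushout. On the legs of the latching object it
    becomes the triangle \<open>f\<tau>\<close> in lower degree.\<close>
  have "ncmp u r \<cdot> Lmap (nsrc \<tau>) r = w \<cdot> Larr \<tau> r"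
  proof (rule L_eqI[OF fn(1)])
    fix a assume a: "a \<in> LO r"
    have "ncmp u r \<cdot> Lmap (nsrc \<tau>) r \<cdot> Lin (nsrc \<tau>) r a = ncmp u r \<cdot> amap (nsrc \<tau>) a"
      using a r u ends fn by (simp add: Lmap Lin)
    also have "\<dots> = amap (nsrc p) a \<cdot> ncmp u (Dom J a)"
      using a ntr_nat[OF u, of a] by (simp add: LO_iff ends)
    also have "\<dots> = amap (nsrc p) a \<cdot> (f (Dom J a) \<cdot> ncmp \<tau> (Dom J a))"
      using a f\<tau>[of "Dom J a"] by (simp add: LO_iff)
    also have "\<dots> = (amap (nsrc p) a \<cdot> f (Dom J a)) \<cdot> ncmp \<tau> (Dom J a)"
      using a f'[OF a] fn \<tau> by (simp add: LO_iff)
    also have "\<dots> = w \<cdot> (Lin (ntgt \<tau>) r a \<cdot> ncmp \<tau> (Dom J a))"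
      using a w fn \<tau> by (intro M.comp_comp_eq[symmetric]) (simp_all add: Lin LO_iff)
    also have "\<dots> = w \<cdot> Larr \<tau> r \<cdot> Lin (nsrc \<tau>) r a"
      using a w fn \<tau> by (simp add: Larr Lin)
    finally show "ncmp u r \<cdot> Lmap (nsrc \<tau>) r \<cdot> Lin (nsrc \<tau>) r a = w \<cdot> Larr \<tau> r \<cdot> Lin (nsrc \<tau>) r a" .
  qed (use r u \<tau> w ends fn in \<open>simp_all add: Lmap Larr\<close>)
  moreover have "ncmp u r \<in> hom M (Cod M (Lmap (nsrc \<tau>) r)) (omap (nsrc p) r)"
    "w \<in> hom M (Cod M (Larr \<tau> r)) (omap (nsrc p) r)"
    using r u \<tau> w ends by (simp_all add: in_hom Lmap Larr)
  ultimately obtain k where k: "k \<in> hom M Q (omap (nsrc p) r)" "k \<cdot> i = ncmp u r" "k \<cdot> j = w"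
    using po unfolding is_pushout_def by metis
  note ar = rel(1) ij k(1) w(1-3)
  \<comment> \<open>The square to be lifted is checked on the two legs of the pushout: along
    \<open>i\<close> it is the given square \<open>sq\<close>, along \<open>j\<close> it is checked
    again on the legs of the latching object, using \<open>pf\<close> in lower degree.\<close>
  have "ncmp p r \<cdot> k = ncmp v r \<cdot> \<rho>"
  proof (rule po_eqI)
    show "ncmp p r \<cdot> k \<in> hom M Q (omap (ntgt p) r)" "ncmp v r \<cdot> \<rho> \<in> hom M Q (omap (ntgt p) r)"
      using ar p v r ends by (simp_all add: in_hom)
    show "ncmp p r \<cdot> k \<cdot> i = ncmp v r \<cdot> \<rho> \<cdot> i"
      using ar p v r ends sq by (simp add: in_hom k rel)
    have "ncmp p r \<cdot> w = ncmp v r \<cdot> Lmap (ntgt \<tau>) r"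
    proof (rule L_eqI[OF fn(2)])
      fix a assume a: "a \<in> LO r"
      have "ncmp p r \<cdot> w \<cdot> Lin (ntgt \<tau>) r a = ncmp p r \<cdot> (amap (nsrc p) a \<cdot> f (Dom J a))"
        using a r p w fn by (simp add: Lin)
      also have "\<dots> = ncmp p r \<cdot> amap (nsrc p) a \<cdot> f (Dom J a)"
        using a r p f'[OF a] by (simp add: LO_iff)
      also have "\<dots> = amap (ntgt p) a \<cdot> ncmp p (Dom J a) \<cdot> f (Dom J a)"
        using a ntr_nat[OF p, of a] by (simp add: LO_iff)
      also have "\<dots> = amap (ntgt p) a \<cdot> ncmp v (Dom J a)"
        using a pf[of "Dom J a"] f'[OF a] p by (simp add: LO_iff)
      also have "\<dots> = ncmp v r \<cdot> amap (ntgt \<tau>) a"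
        using a ntr_nat[OF v, of a] by (simp add: LO_iff ends)
      also have "\<dots> = ncmp v r \<cdot> Lmap (ntgt \<tau>) r \<cdot> Lin (ntgt \<tau>) r a"
        using a r v fn ends by (simp add: Lmap Lin)
      finally show "ncmp p r \<cdot> w \<cdot> Lin (ntgt \<tau>) r a = ncmp v r \<cdot> Lmap (ntgt \<tau>) r \<cdot> Lin (ntgt \<tau>) r a" .
    qed (use r p v w fn ends in \<open>simp_all add: Lmap\<close>)
    then show "ncmp p r \<cdot> k \<cdot> j = ncmp v r \<cdot> \<rho> \<cdot> j"
      using ar p v r ends by (simp add: in_hom k rel)
  qed
  moreover have "k \<in> hom M (Dom M \<rho>) (Dom M (ncmp p r))"
    "ncmp v r \<in> hom M (Cod M \<rho>) (Cod M (ncmp p r))"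
    using ar p v r ends by (simp_all add: in_hom)
  ultimately obtain h where h: "h \<in> hom M (Cod M \<rho>) (Dom M (ncmp p r))"
    "h \<cdot> \<rho> = k" "ncmp p r \<cdot> h = ncmp v r"
    using lift unfolding lifts_against_def by metis
  \<comment> \<open>Restricting \<open>h \<cdot> \<rho> = k\<close> along \<open>i\<close> gives the
    triangle with \<open>\<tau>\<close>; restricting it along \<open>j\<close> gives
    naturality.\<close>
  have "h \<cdot> ncmp \<tau> r = ncmp u r"
    using h(1) ar p r by (subst rel(2)[symmetric], subst M.comp_comp_eq[OF h(2)]) (simp_all add: in_hom k)
  moreover have "h \<cdot> amap (ntgt \<tau>) a = amap (nsrc p) a \<cdot> f (Dom J a)" if a: "a \<in> LO r" for a
  proof -
    have "h \<cdot> Lmap (ntgt \<tau>) r = w"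
      using h(1) ar p r by (subst rel(3)[symmetric], subst M.comp_comp_eq[OF h(2)]) (simp_all add: in_hom k)
    moreover have "h \<cdot> amap (ntgt \<tau>) a = h \<cdot> Lmap (ntgt \<tau>) r \<cdot> Lin (ntgt \<tau>) r a"
      using a h(1) ar fn r by (simp add: in_hom Lmap Lin)
    ultimately show ?thesis using w(4)[OF a] by simp
  qed
  ultimately show ?thesis
    using h(1,3) ar p r by (intro exI[of _ h]) (auto simp: in_hom)
qed

lemma latching_imp_lifts:
  assumes \<tau>: "is_ntr J M \<tau>" and p: "is_ntr J M p"
    and rho: "\<And>r. r \<in> Obj J \<Longrightarrow> is_relative_latching \<tau> r (\<rho> r)"
    and lift: "\<And>r. r \<in> Obj J \<Longrightarrow> lifts_against M (\<rho> r) (ncmp p r)"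
  shows "lifts_against (fun_cat J M) \<tau> p"
  unfolding lifts_against_def
proof (intro allI impI)
  fix u v assume *: "u \<in> hom (fun_cat J M) (Dom (fun_cat J M) \<tau>) (Dom (fun_cat J M) p) \<and>
    v \<in> hom (fun_cat J M) (Cod (fun_cat J M) \<tau>) (Cod (fun_cat J M) p) \<and> p \<cdot>\<^bsub>fun_cat J M\<^esub> u = v \<cdot>\<^bsub>fun_cat J M\<^esub> \<tau>"
  then have u: "is_ntr J M u" and v: "is_ntr J M v"
    and ends: "nsrc u = nsrc \<tau>" "ntgt u = nsrc p" "nsrc v = ntgt \<tau>" "ntgt v = ntgt p"
    by (simp_all add: in_hom)
  have sq: "ncmp p x \<cdot> ncmp u x = ncmp v x \<cdot> ncmp \<tau> x" if "x \<in> Obj J" for x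
    using arg_cong[of _ _ "\<lambda>t. ncmp t x", OF conjunct2[OF conjunct2[OF *]]] that by simp
  \<comment> \<open>\<open>P f r h\<close> says that \<open>h\<close> can serve as component at
    \<open>r\<close> when \<open>f\<close> gives those of lower degree. The guard makes it
    satisfiable off the objects, since the recursion runs over all of \<open>'u\<close>.\<close>
  define P where "P f r h \<longleftrightarrow> (r \<in> Obj J \<longrightarrow> h \<in> Arr M \<and> Dom M h = omap (ntgt \<tau>) r \<and> Cod M h = omap (nsrc p) r \<and>
    h \<cdot> ncmp \<tau> r = ncmp u r \<and> ncmp p r \<cdot> h = ncmp v r \<and>
    (\<forall>a\<in>LO r. h \<cdot> amap (ntgt \<tau>) a = amap (nsrc p) a \<cdot> f (Dom J a)))" for f r h
  \<comment> \<open>Every arrow is an identity, where naturality is trivial, or an object of the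
    latching category at its codomain, where \<open>P\<close> asserts it.\<close>
  have nat: "f (Cod J h) \<cdot> amap (ntgt \<tau>) h = amap (nsrc p) h \<cdot> f (Dom J h)"
    if h: "h \<in> Arr J" and P: "P f (Cod J h) (f (Cod J h))" for f h
    using J.arr_cases[OF h]
  proof
    assume "h = Id J (Cod J h) \<and> Dom J h = Cod J h"
    moreover from this have "amap (ntgt \<tau>) h = Id M (omap (ntgt \<tau>) (Cod J h))" "amap (nsrc p) h = Id M (omap (nsrc p) (Cod J h))"
      using functor_Id[OF ntr_tgt[OF \<tau>], of "Cod J h"] functor_Id[OF ntr_src[OF p], of "Cod J h"] h by simp_all
    ultimately show ?thesis using P h by (simp add: P_def)
  next
    assume "d (Dom J h) < d (Cod J h)"
    then show ?thesis using P h by (simp add: P_def LO_iff)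
  qed
  have "\<exists>f. \<forall>r. P f r (f r)"
  proof (rule dependent_wf_choice[OF wf_measure[of d]])
    \<comment> \<open>Well-founded choice requires that \<open>P\<close> consults \<open>f\<close>
      only below \<open>x\<close>; it does so only at sources of arrows in
      \<open>LO x\<close>.\<close>
    fix f g :: "'u \<Rightarrow> 'm" and x r assume *: "\<And>z. (z, x) \<in> measure d \<Longrightarrow> f z = g z"
    have "f (Dom J a) = g (Dom J a)" if "a \<in> LO x" for a
      using *[of "Dom J a"] that by (simp add: LO_iff)
    then show "P f x r = P g x r" by (simp add: P_def)
  next
    fix r f assume *: "\<And>y. (y, r) \<in> measure d \<Longrightarrow> P f y (f y)"
    show "\<exists>h. P f r h"
    proof (cases "r \<in> Obj J")
      case True
      have *: "P f x (f x)" if "d x < d r" for x using * that by simp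
      have "\<exists>h. h \<in> Arr M \<and> Dom M h = omap (ntgt \<tau>) r \<and> Cod M h = omap (nsrc p) r \<and>
        h \<cdot> ncmp \<tau> r = ncmp u r \<and> ncmp p r \<cdot> h = ncmp v r \<and>
        (\<forall>a\<in>LO r. h \<cdot> amap (ntgt \<tau>) a = amap (nsrc p) a \<cdot> f (Dom J a))"
        using *[unfolded P_def] nat[OF _ *]
        by (intro lift_step[OF \<tau> p u v ends sq True rho[OF True] lift[OF True]]) blast+
      then show ?thesis by (simp add: P_def)
    qed (simp add: P_def)
  qed
  then obtain f where P: "\<And>r. P f r (f r)" by blast
  define h where "h = mk_ntr J (ntgt \<tau>) (nsrc p) f"
  have h: "is_ntr J M h"
    unfolding h_def
    by (rule mk_ntr_is_ntrI[OF J.category_axioms]) (use \<tau> p nat[OF _ P] P in \<open>simp_all add: P_def\<close>)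
  have "h \<cdot>\<^bsub>fun_cat J M\<^esub> \<tau> = u"
    using P mk_ntr_cong[of J "\<lambda>x. ncmp h x \<cdot> ncmp \<tau> x" "ncmp u" "nsrc \<tau>" "nsrc p"] mk_ntr_ncmp[OF ntr_ext[OF u]]
    by (simp add: ends h_def P_def)
  moreover have "p \<cdot>\<^bsub>fun_cat J M\<^esub> h = v"
    using P mk_ntr_cong[of J "\<lambda>x. ncmp p x \<cdot> ncmp h x" "ncmp v" "ntgt \<tau>" "ntgt p"] mk_ntr_ncmp[OF ntr_ext[OF v]]
    by (simp add: ends h_def P_def)
  moreover have "h \<in> hom (fun_cat J M) (Cod (fun_cat J M) \<tau>) (Dom (fun_cat J M) p)"
    using h by (simp add: in_hom h_def)
  ultimately show "\<exists>h. h \<in> hom (fun_cat J M) (Cod (fun_cat J M) \<tau>) (Dom (fun_cat J M) p) \<and>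
      h \<cdot>\<^bsub>fun_cat J M\<^esub> \<tau> = u \<and> p \<cdot>\<^bsub>fun_cat J M\<^esub> h = v"
    by blast
qed

end

section \<open>Closure properties of right lifting classes, and diagrams cofree on arrows into an
  object\<close>

lemma lifts_againstI:
  assumes "category C" "i \<in> Arr C" "p \<in> Arr C"
    and "\<And>u v. \<lbrakk>u \<in> Arr C; Dom C u = Dom C i; Cod C u = Dom C p; v \<in> Arr C; Dom C v = Cod C i; Cod C v = Cod C p;
        p \<cdot>\<^bsub>C\<^esub> u = v \<cdot>\<^bsub>C\<^esub> i\<rbrakk> \<Longrightarrow>
      \<exists>h. h \<in> Arr C \<and> Dom C h = Cod C i \<and> Cod C h = Dom C p \<and> h \<cdot>\<^bsub>C\<^esub> i = u \<and> p \<cdot>\<^bsub>C\<^esub> h = v"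
  shows "lifts_against C i p"
  using assms(4) unfolding lifts_against_def in_hom by blast

lemma lifts_againstD:
  assumes "lifts_against C i p" "u \<in> Arr C" "Dom C u = Dom C i" "Cod C u = Dom C p"
    "v \<in> Arr C" "Dom C v = Cod C i" "Cod C v = Cod C p" "p \<cdot>\<^bsub>C\<^esub> u = v \<cdot>\<^bsub>C\<^esub> i"
  shows "\<exists>h. h \<in> Arr C \<and> Dom C h = Cod C i \<and> Cod C h = Dom C p \<and> h \<cdot>\<^bsub>C\<^esub> i = u \<and> p \<cdot>\<^bsub>C\<^esub> h = v"
  using assms unfolding lifts_against_def in_hom by blast

text \<open>The lower side of the square is itself the diagonal.\<close>

lemma (in category) Id_RLP:
  assumes "x \<in> Obj C" "B \<subseteq> Arr C"
  shows "Id C x \<in> RLP C B"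
  unfolding RLP_def
proof (intro CollectI conjI ballI)
  fix i assume "i \<in> B"
  then show "lifts_against C i (Id C x)"
    using assms by (intro lifts_againstI[OF category_axioms]) auto
qed (use assms in simp)

text \<open>Lifts against the factors are chosen separately and tupled. \<open>W\<close> is
  described by its projections alone, so that components of a natural transformation qualify as they
  stand.\<close>

lemma (in complete_category) product_map_RLP:
  fixes I :: "'u set"
  assumes B: "B \<subseteq> Arr C"
    and w: "\<And>g. g \<in> I \<Longrightarrow> w g \<in> RLP C B \<and> Dom C (w g) = Z g \<and> Cod C (w g) = Z' g"
    and W: "W \<in> Arr C" "Dom C W = product C I Z" "Cod C W = product C I Z'"
      "\<And>g. g \<in> I \<Longrightarrow> product_pr C I Z' g \<cdot> W = w g \<cdot> product_pr C I Z g"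
  shows "W \<in> RLP C B"
proof -
  have wArr: "w g \<in> Arr C" if "g \<in> I" for g using w[OF that] by (simp add: RLP_def)
  have Z: "Z g \<in> Obj C" "Z' g \<in> Obj C" if "g \<in> I" for g
    using w[OF that] wArr[OF that] Dom_Obj[of "w g"] Cod_Obj[of "w g"] by simp_all
  note pr = product_pr_Arr[of I Z, OF Z(1)] Dom_product_pr[of I Z, OF Z(1)] Cod_product_pr[of I Z, OF Z(1)]
  note pr' = product_pr_Arr[of I Z', OF Z(2)] Dom_product_pr[of I Z', OF Z(2)] Cod_product_pr[of I Z', OF Z(2)]
  have "lifts_against C i W" if i: "i \<in> B" for i
  proof (rule lifts_againstI[OF category_axioms])
    show iA: "i \<in> Arr C" "W \<in> Arr C" using i B W by auto
    fix u v assume u: "u \<in> Arr C" "Dom C u = Dom C i" "Cod C u = Dom C W"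
      and v: "v \<in> Arr C" "Dom C v = Cod C i" "Cod C v = Cod C W" and sq: "W \<cdot> u = v \<cdot> i"
    have "\<exists>h. h \<in> Arr C \<and> Dom C h = Cod C i \<and> Cod C h = Z g \<and> h \<cdot> i = product_pr C I Z g \<cdot> u \<and>
        w g \<cdot> h = product_pr C I Z' g \<cdot> v" if g: "g \<in> I" for g
    proof -
      have "lifts_against C i (w g)" using w[OF g] i by (simp add: RLP_def)
      moreover have "w g \<cdot> (product_pr C I Z g \<cdot> u) = product_pr C I Z' g \<cdot> v \<cdot> i"
      proof -
        have "w g \<cdot> (product_pr C I Z g \<cdot> u) = (w g \<cdot> product_pr C I Z g) \<cdot> u"
          using g wArr w u W(1-3) by (simp add: pr)
        also have "\<dots> = product_pr C I Z' g \<cdot> (v \<cdot> i)"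
          using g u W unfolding sq[symmetric] by (intro comp_comp_eq[symmetric]) (simp_all add: pr')
        finally show ?thesis using g iA v W by (simp add: pr')
      qed
      ultimately show ?thesis
        using lifts_againstD[of C i "w g" "product_pr C I Z g \<cdot> u" "product_pr C I Z' g \<cdot> v"] g iA u v W(1-3) w[OF g]
        by (simp add: pr pr')
    qed
    then obtain h where h: "\<And>g. g \<in> I \<Longrightarrow> h g \<in> Arr C \<and> Cod C (h g) = Z g \<and> Dom C (h g) = Cod C i"
        "\<And>g. g \<in> I \<Longrightarrow> h g \<cdot> i = product_pr C I Z g \<cdot> u" "\<And>g. g \<in> I \<Longrightarrow> w g \<cdot> h g = product_pr C I Z' g \<cdot> v"
      by metis
    have c: "Cod C i \<in> Obj C" using iA by simp
    define H where "H = tuple C I Z (Cod C i) h"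
    note H = tuple_Arr[of I Z, OF Z(1) c h(1), folded H_def] Dom_tuple[of I Z, OF Z(1) c h(1), folded H_def]
      Cod_tuple[of I Z, OF Z(1) c h(1), folded H_def] pr_tuple[of I Z, OF Z(1) c h(1), folded H_def]
    have "H \<cdot> i = u"
    proof (rule product_eqI[of I Z])
      fix g assume g: "g \<in> I"
      then have "product_pr C I Z g \<cdot> (H \<cdot> i) = h g \<cdot> i"
        using iA H by (intro comp_comp_eq) (simp_all add: pr)
      then show "product_pr C I Z g \<cdot> (H \<cdot> i) = product_pr C I Z g \<cdot> u" using h(2)[OF g] by simp
    qed (use Z iA H u W in auto)
    moreover have "W \<cdot> H = v"
    proof (rule product_eqI[of I Z'])
      fix g assume g: "g \<in> I"
      then have "product_pr C I Z' g \<cdot> (W \<cdot> H) = (w g \<cdot> product_pr C I Z g) \<cdot> H"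
        using W H by (intro comp_comp_eq) (simp_all add: pr')
      also have "\<dots> = w g \<cdot> h g" using g H wArr w by (simp add: pr)
      finally show "product_pr C I Z' g \<cdot> (W \<cdot> H) = product_pr C I Z' g \<cdot> v" using h(3)[OF g] by simp
    qed (use Z H v W in auto)
    ultimately show "\<exists>h. h \<in> Arr C \<and> Dom C h = Cod C i \<and> Cod C h = Dom C W \<and> h \<cdot> i = u \<and> W \<cdot> h = v"
      using H(1-3) W(1-3) by (intro exI[of _ H]) simp
  qed
  then show ?thesis using W by (simp add: RLP_def)
qed

text \<open>The maps \<open>z g h\<close> make \<open>Z\<close> a functor on the slice of
  \<open>J\<close> over \<open>r\<close>, and \<open>diagram\<close> is its right Kan extension
  along the projection from the slice to \<open>J\<close>. The limits in that extension reduce to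
  products over arrows into \<open>r\<close>, because each component of the comma category in
  question has an initial object.\<close>

locale cofree_diagram = J: category J + M: complete_category M U
  for J :: "('u::infinite, 'u) cat" and M :: "('o, 'm) cat" (structure) and U :: "'u itself" +
  fixes r :: 'u and Z :: "'u \<Rightarrow> 'o" and z :: "'u \<Rightarrow> 'u \<Rightarrow> 'm"
  assumes Z: "\<lbrakk>g \<in> Arr J; Cod J g = r\<rbrakk> \<Longrightarrow> Z g \<in> Obj M"
    and z_Id: "\<lbrakk>g \<in> Arr J; Cod J g = r\<rbrakk> \<Longrightarrow> z g (Id J (Dom J g)) = Id M (Z g)"
    and z_Arr: "\<lbrakk>g \<in> Arr J; Cod J g = r; h \<in> Arr J; Cod J h = Dom J g\<rbrakk> \<Longrightarrow>
      z g h \<in> Arr M \<and> Dom M (z g h) = Z (g \<cdot>\<^bsub>J\<^esub> h) \<and> Cod M (z g h) = Z g"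
    and z_comp: "\<lbrakk>g \<in> Arr J; Cod J g = r; h \<in> Arr J; Cod J h = Dom J g; k \<in> Arr J; Cod J k = Dom J h\<rbrakk> \<Longrightarrow>
      z g (h \<cdot>\<^bsub>J\<^esub> k) = z g h \<cdot> z (g \<cdot>\<^bsub>J\<^esub> h) k"
begin

abbreviation "val s \<equiv> product M (hom J s r) Z"
abbreviation "pr g \<equiv> product_pr M (hom J (Dom J g) r) Z g"

definition diagram :: "('u, 'u, 'o, 'm) ftor" where
  "diagram = mk_functor J val (\<lambda>h. tuple M (hom J (Cod J h) r) Z (val (Dom J h)) (\<lambda>g. z g h \<cdot> pr (g \<cdot>\<^bsub>J\<^esub> h)))"

lemma Z': "g \<in> hom J s r \<Longrightarrow> Z g \<in> Obj M"
  by (simp add: in_hom Z)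

lemmas val_Obj = M.product_Obj[of "hom J s r" Z for s, OF Z']

lemma pr:
  assumes "g \<in> Arr J" "Cod J g = r"
  shows "pr g \<in> Arr M" "Dom M (pr g) = val (Dom J g)" "Cod M (pr g) = Z g"
  using assms M.product_pr_Arr[of "hom J (Dom J g) r" Z, OF Z', where i = g]
    M.Dom_product_pr[of "hom J (Dom J g) r" Z, OF Z', where i = g]
    M.Cod_product_pr[of "hom J (Dom J g) r" Z, OF Z', where i = g]
  by (simp_all add: in_hom)

lemma tup:
  assumes "c \<in> Obj M" "\<And>g. \<lbrakk>g \<in> Arr J; Cod J g = r; Dom J g = s\<rbrakk> \<Longrightarrow> l g \<in> Arr M \<and> Cod M (l g) = Z g \<and> Dom M (l g) = c"
  shows "tuple M (hom J s r) Z c l \<in> Arr M" (is ?c1) "Dom M (tuple M (hom J s r) Z c l) = c" (is ?c2)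
    "Cod M (tuple M (hom J s r) Z c l) = val s" (is ?c3)
    "\<lbrakk>g \<in> Arr J; Cod J g = r; Dom J g = s\<rbrakk> \<Longrightarrow> pr g \<cdot> tuple M (hom J s r) Z c l = l g"
proof -
  have l: "\<And>g. g \<in> hom J s r \<Longrightarrow> l g \<in> Arr M \<and> Cod M (l g) = Z g \<and> Dom M (l g) = c"
    using assms(2) by (simp add: in_hom)
  show ?c1 ?c2
    ?c3
    "\<lbrakk>g \<in> Arr J; Cod J g = r; Dom J g = s\<rbrakk> \<Longrightarrow> pr g \<cdot> tuple M (hom J s r) Z c l = l g"
    using M.tuple_Arr[of "hom J s r" Z, OF Z' assms(1) l] M.Dom_tuple[of "hom J s r" Z, OF Z' assms(1) l]
      M.Cod_tuple[of "hom J s r" Z, OF Z' assms(1) l] M.pr_tuple[of "hom J s r" Z, OF Z' assms(1) l]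
    by (auto simp: in_hom)
qed

lemma val_eqI:
  assumes "h \<in> Arr M" "h' \<in> Arr M" "Cod M h = val s" "Cod M h' = val s" "Dom M h = Dom M h'"
    and "\<And>g. \<lbrakk>g \<in> Arr J; Cod J g = r; Dom J g = s\<rbrakk> \<Longrightarrow> pr g \<cdot> h = pr g \<cdot> h'"
  shows "h = h'"
proof (rule M.product_eqI[of "hom J s r" Z])
  fix g assume "g \<in> hom J s r"
  then show "product_pr M (hom J s r) Z g \<cdot> h = product_pr M (hom J s r) Z g \<cdot> h'"
    using assms(6)[of g] by (simp add: in_hom)
qed (use assms Z' in simp_all)

lemma omap_diagram [simp]: "s \<in> Obj J \<Longrightarrow> omap diagram s = val s"
  by (simp add: diagram_def)

lemma amap_diagram:
  assumes "h \<in> Arr J"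
  shows "amap diagram h \<in> Arr M" "Dom M (amap diagram h) = val (Dom J h)" (is ?c1) "Cod M (amap diagram h) = val (Cod J h)" (is ?c2)
    "\<lbrakk>g \<in> Arr J; Cod J g = r; Dom J g = Cod J h\<rbrakk> \<Longrightarrow> pr g \<cdot> amap diagram h = z g h \<cdot> pr (g \<cdot>\<^bsub>J\<^esub> h)"
proof -
  have "z g h \<cdot> pr (g \<cdot>\<^bsub>J\<^esub> h) \<in> Arr M \<and> Cod M (z g h \<cdot> pr (g \<cdot>\<^bsub>J\<^esub> h)) = Z g \<and>
      Dom M (z g h \<cdot> pr (g \<cdot>\<^bsub>J\<^esub> h)) = val (Dom J h)" if "g \<in> Arr J" "Cod J g = r" "Dom J g = Cod J h" for g
    using that assms pr[of "g \<cdot>\<^bsub>J\<^esub> h"] z_Arr[of g h] by simp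
  note * = tup[OF val_Obj this]
  show "amap diagram h \<in> Arr M" ?c1 ?c2
    "\<lbrakk>g \<in> Arr J; Cod J g = r; Dom J g = Cod J h\<rbrakk> \<Longrightarrow> pr g \<cdot> amap diagram h = z g h \<cdot> pr (g \<cdot>\<^bsub>J\<^esub> h)"
    using assms * by (simp_all add: diagram_def)
qed

text \<open>Tested on projections, the two functor laws become \<open>z_Id\<close> and
  \<open>z_comp\<close>.\<close>

lemma functor_diagram: "is_functor J M diagram"
proof (rule is_functorI)
  fix x assume x: "x \<in> Obj J"
  show "amap diagram (Id J x) = Id M (omap diagram x)"
  proof (rule val_eqI[of _ _ x])
    fix g assume g: "g \<in> Arr J" "Cod J g = r" "Dom J g = x"
    then show "pr g \<cdot> amap diagram (Id J x) = pr g \<cdot> Id M (omap diagram x)"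
      using x pr[of g] z_Id[of g] amap_diagram(4)[of "Id J x" g] by simp
  qed (use x in \<open>simp_all add: amap_diagram val_Obj\<close>)
next
  fix h k assume *: "h \<in> Arr J" "k \<in> Arr J" "Cod J h = Dom J k"
  show "amap diagram (k \<cdot>\<^bsub>J\<^esub> h) = amap diagram k \<cdot> amap diagram h"
  proof (rule val_eqI[of _ _ "Cod J k"])
    fix g assume g: "g \<in> Arr J" "Cod J g = r" "Dom J g = Cod J k"
    have "pr g \<cdot> amap diagram (k \<cdot>\<^bsub>J\<^esub> h) = z g k \<cdot> (z (g \<cdot>\<^bsub>J\<^esub> k) h \<cdot> pr (g \<cdot>\<^bsub>J\<^esub> k \<cdot>\<^bsub>J\<^esub> h))"
      using * g z_Arr[of g k] z_Arr[of "g \<cdot>\<^bsub>J\<^esub> k" h] pr[of "g \<cdot>\<^bsub>J\<^esub> (k \<cdot>\<^bsub>J\<^esub> h)"]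
        amap_diagram(4)[of "k \<cdot>\<^bsub>J\<^esub> h" g]
      by (simp add: z_comp)
    also have "\<dots> = z g k \<cdot> (pr (g \<cdot>\<^bsub>J\<^esub> k) \<cdot> amap diagram h)"
      using * g by (subst amap_diagram(4)[of h "g \<cdot>\<^bsub>J\<^esub> k"]) simp_all
    also have "\<dots> = z g k \<cdot> pr (g \<cdot>\<^bsub>J\<^esub> k) \<cdot> amap diagram h"
      using * g z_Arr[of g k] pr[of "g \<cdot>\<^bsub>J\<^esub> k"] by (simp add: amap_diagram)
    also have "\<dots> = pr g \<cdot> amap diagram k \<cdot> amap diagram h"
      using * g amap_diagram(4)[of k g] by simp
    also have "\<dots> = pr g \<cdot> (amap diagram k \<cdot> amap diagram h)"
      using * g pr[of g] by (simp add: amap_diagram)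
    finally show "pr g \<cdot> amap diagram (k \<cdot>\<^bsub>J\<^esub> h) = pr g \<cdot> (amap diagram k \<cdot> amap diagram h)" .
  qed (use * in \<open>simp_all add: amap_diagram\<close>)
qed (simp_all add: amap_diagram val_Obj, simp_all add: diagram_def)

definition into :: "('u, 'u, 'o, 'm) ftor \<Rightarrow> ('u \<Rightarrow> 'm) \<Rightarrow> ('u, 'u, 'o, 'm) ntr" where
  "into \<Psi> l = mk_ntr J \<Psi> diagram (\<lambda>s. tuple M (hom J s r) Z (omap \<Psi> s) l)"

text \<open>Half of the universal property of the Kan extension: compatible maps to the individual
  factors assemble into a natural transformation.\<close>

lemma into:
  assumes \<Psi>: "is_functor J M \<Psi>"
    and l: "\<And>g. \<lbrakk>g \<in> Arr J; Cod J g = r\<rbrakk> \<Longrightarrow> l g \<in> Arr M \<and> Cod M (l g) = Z g \<and> Dom M (l g) = omap \<Psi> (Dom J g)"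
    and nat: "\<And>g h. \<lbrakk>g \<in> Arr J; Cod J g = r; h \<in> Arr J; Cod J h = Dom J g\<rbrakk> \<Longrightarrow>
      l g \<cdot> amap \<Psi> h = z g h \<cdot> l (g \<cdot>\<^bsub>J\<^esub> h)"
  shows "is_ntr J M (into \<Psi> l)" "nsrc (into \<Psi> l) = \<Psi>" "ntgt (into \<Psi> l) = diagram" (is ?c1)
    "\<lbrakk>g \<in> Arr J; Cod J g = r\<rbrakk> \<Longrightarrow> pr g \<cdot> ncmp (into \<Psi> l) (Dom J g) = l g"
proof -
  have t: "tuple M (hom J s r) Z (omap \<Psi> s) l \<in> Arr M" "Dom M (tuple M (hom J s r) Z (omap \<Psi> s) l) = omap \<Psi> s"
    "Cod M (tuple M (hom J s r) Z (omap \<Psi> s) l) = val s"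
    "\<And>g. \<lbrakk>g \<in> Arr J; Cod J g = r; Dom J g = s\<rbrakk> \<Longrightarrow> pr g \<cdot> tuple M (hom J s r) Z (omap \<Psi> s) l = l g"
    if "s \<in> Obj J" for s
    by (rule tup; use that l \<Psi> in auto)+
  show "is_ntr J M (into \<Psi> l)"
    unfolding into_def
  proof (rule mk_ntr_is_ntrI[OF J.category_axioms \<Psi> functor_diagram])
    fix h assume h: "h \<in> Arr J"
    show "amap diagram h \<cdot> tuple M (hom J (Dom J h) r) Z (omap \<Psi> (Dom J h)) l =
      tuple M (hom J (Cod J h) r) Z (omap \<Psi> (Cod J h)) l \<cdot> amap \<Psi> h" (is "_ \<cdot> ?a = ?b \<cdot> _")
    proof (rule val_eqI[of _ _ "Cod J h"])
      fix g assume g: "g \<in> Arr J" "Cod J g = r" "Dom J g = Cod J h"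
      have "pr g \<cdot> (amap diagram h \<cdot> ?a) = (z g h \<cdot> pr (g \<cdot>\<^bsub>J\<^esub> h)) \<cdot> ?a"
        using g h t[of "Dom J h"] pr[of g] by (intro M.comp_comp_eq amap_diagram) (simp_all add: amap_diagram)
      also have "\<dots> = z g h \<cdot> (pr (g \<cdot>\<^bsub>J\<^esub> h) \<cdot> ?a)"
        using g h t(1-3)[of "Dom J h"] pr[of "g \<cdot>\<^bsub>J\<^esub> h"] z_Arr[of g h] by simp
      also have "\<dots> = l g \<cdot> amap \<Psi> h"
        using g h nat t(4)[of "Dom J h" "g \<cdot>\<^bsub>J\<^esub> h"] by simp
      also have "\<dots> = pr g \<cdot> (?b \<cdot> amap \<Psi> h)"
        using g h t[of "Cod J h"] pr[of g] \<Psi> by (intro M.comp_comp_eq[symmetric]) simp_all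
      finally show "pr g \<cdot> (amap diagram h \<cdot> ?a) = pr g \<cdot> (?b \<cdot> amap \<Psi> h)" .
    qed (use h t \<Psi> in \<open>simp_all add: amap_diagram\<close>)
  qed (use t in auto)
  show "nsrc (into \<Psi> l) = \<Psi>" ?c1
    by (simp_all add: into_def)
  show "\<lbrakk>g \<in> Arr J; Cod J g = r\<rbrakk> \<Longrightarrow> pr g \<cdot> ncmp (into \<Psi> l) (Dom J g) = l g"
    using t(4)[of "Dom J g" g] by (simp add: into_def)
qed

end

section \<open>From lifts of diagrams to relative latching maps\<close>

context direct_diagrams
begin

text \<open>Ties the distinguished factor of the test diagram to the latching object: the remaining
  factors at \<open>r\<close> are indexed by the latching category.\<close>

lemma non_Id_iff: "\<lbrakk>g \<in> Arr J; Cod J g = r\<rbrakk> \<Longrightarrow> g \<noteq> Id J r \<longleftrightarrow> g \<in> LO r"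
  using J.arr_cases[of g] J.Dom_Id[of r] J.Cod_Obj[of g] by (metis LO_iff less_irrefl)

text \<open>Translates a square \<open>k\<close>, \<open>v\<close> from \<open>\<rho>\<close> to
  \<open>q\<close> into a square of diagrams: \<open>k \<cdot> i\<close> gives the map
  \<open>u'\<close> into X, while \<open>v\<close> and \<open>k \<cdot> j\<close> together give the
  map \<open>v'\<close> into Y. A diagonal \<open>H\<close> followed by the projection at the
  identity of \<open>r\<close> solves the original problem.\<close>

lemma lifts_imp_latching:
  assumes \<tau>: "is_ntr J M \<tau>" and B: "B \<subseteq> Arr M" and r: "r \<in> Obj J"
    and rho: "is_relative_latching \<tau> r \<rho>" and q: "q \<in> RLP M B"
    and lift: "\<And>p. p \<in> objectwise J M (RLP M B) \<Longrightarrow> lifts_against (fun_cat J M) \<tau> p"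
  shows "lifts_against M \<rho> q"
proof -
  note fn = ntr_src[OF \<tau>] ntr_tgt[OF \<tau>]
  have qA: "q \<in> Arr M" using q by (simp add: RLP_def)
  have Id_r: "Dom J g = r" if "g = Id J r" for g using that r by simp
  \<comment> \<open>The use of directness that makes the target of the test map a functor: no
    transition starts at the exceptional factor and ends at another one.\<close>
  have nonid_comp: "g \<cdot>\<^bsub>J\<^esub> h \<noteq> Id J r" if "g \<in> Arr J" "Cod J g = r" "h \<in> Arr J" "Cod J h = Dom J g" "g \<noteq> Id J r" for g h
    using that non_Id_iff[of "g \<cdot>\<^bsub>J\<^esub> h" r] non_Id_iff[of g r] LO_comp[of g r h] by simp
  obtain Q i j where po: "is_pushout M (Lmap (nsrc \<tau>) r) (Larr \<tau> r) Q i j"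
    and rel: "\<rho> \<in> hom M Q (omap (ntgt \<tau>) r)" "\<rho> \<cdot> i = ncmp \<tau> r" "\<rho> \<cdot> j = Lmap (ntgt \<tau>) r"
    using rho unfolding is_relative_latching_def by blast
  note relA = rel(1)[unfolded in_hom]
  have ij: "i \<in> Arr M" "Dom M i = omap (nsrc \<tau>) r" "Cod M i = Q" "j \<in> Arr M" "Dom M j = Lob (ntgt \<tau>) r" "Cod M j = Q"
    "i \<cdot> Lmap (nsrc \<tau>) r = j \<cdot> Larr \<tau> r"
    using po r \<tau> by (simp_all add: is_pushout_def Lmap Larr in_hom)
  \<comment> \<open>The factor at the identity is the codomain of \<open>q\<close>, every other
    factor its domain. The only transition that is not an identity is \<open>q\<close>, from an
    ordinary factor to the exceptional one.\<close>
  define ZY where "ZY g = (if g = Id J r then Cod M q else Dom M q)" for g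
  define zY where "zY g h = (if g \<noteq> Id J r then Id M (Dom M q) else if h = Id J r then Id M (Cod M q) else q)" for g h
  define w where "w g = (if g = Id J r then q else Id M (Dom M q))" for g
  interpret X: cofree_diagram J M U r "\<lambda>g. Dom M q" "\<lambda>g h. Id M (Dom M q)"
    by unfold_locales (use qA in simp_all)
  interpret Y: cofree_diagram J M U r ZY zY
  proof unfold_locales
    fix g h k assume gh: "g \<in> Arr J" "Cod J g = r" "h \<in> Arr J" "Cod J h = Dom J g"
    show "zY g h \<in> Arr M \<and> Dom M (zY g h) = ZY (g \<cdot>\<^bsub>J\<^esub> h) \<and> Cod M (zY g h) = ZY g"
      using gh nonid_comp[of g h] qA r by (cases "g = Id J r") (simp_all add: zY_def ZY_def)
    assume k: "k \<in> Arr J" "Cod J k = Dom J h"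
    show "zY g (h \<cdot>\<^bsub>J\<^esub> k) = zY g h \<cdot> zY (g \<cdot>\<^bsub>J\<^esub> h) k"
      using gh k nonid_comp[of g h] nonid_comp[of h k] qA r
      by (cases "g = Id J r"; cases "h = Id J r") (simp_all add: zY_def)
  qed (use qA r in \<open>auto simp: ZY_def zY_def\<close>)
  have w: "w g \<in> Arr M" "Dom M (w g) = Dom M q" "Cod M (w g) = ZY g" for g
    using qA by (simp_all add: w_def ZY_def)
  define \<pi> where "\<pi> = Y.into X.diagram (\<lambda>g. w g \<cdot> X.pr g)"
  \<comment> \<open>The maps \<open>w\<close> commute with the transitions: if \<open>g\<close> is
    the identity, both ways around give \<open>q\<close>, and otherwise both give an
    identity.\<close>
  have nat\<pi>: "w g \<cdot> X.pr g \<cdot> amap X.diagram h = zY g h \<cdot> (w (g \<cdot>\<^bsub>J\<^esub> h) \<cdot> X.pr (g \<cdot>\<^bsub>J\<^esub> h))"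
    if gh: "g \<in> Arr J" "Cod J g = r" "h \<in> Arr J" "Cod J h = Dom J g" for g h
  proof -
    note prh = X.pr[of "g \<cdot>\<^bsub>J\<^esub> h"]
    have "w g \<cdot> X.pr g \<cdot> amap X.diagram h = w g \<cdot> (X.pr g \<cdot> amap X.diagram h)"
      using gh w[of g] X.pr[of g] X.amap_diagram[of h] by simp
    also have "\<dots> = w g \<cdot> X.pr (g \<cdot>\<^bsub>J\<^esub> h)"
      using gh prh X.amap_diagram(4)[of h g] by simp
    also have "\<dots> = (zY g h \<cdot> w (g \<cdot>\<^bsub>J\<^esub> h)) \<cdot> X.pr (g \<cdot>\<^bsub>J\<^esub> h)"
      using gh qA r nonid_comp[of g h] by (cases "g = Id J r") (simp_all add: w_def zY_def)
    finally show ?thesis using gh w[of "g \<cdot>\<^bsub>J\<^esub> h"] prh Y.z_Arr[of g h] by simp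
  qed
  have comp\<pi>: "w g \<cdot> X.pr g \<in> Arr M \<and> Cod M (w g \<cdot> X.pr g) = ZY g \<and>
      Dom M (w g \<cdot> X.pr g) = omap X.diagram (Dom J g)" if "g \<in> Arr J" "Cod J g = r" for g
    using that w[of g] X.pr[of g] by simp
  have \<pi>: "is_ntr J M \<pi>" "nsrc \<pi> = X.diagram" "ntgt \<pi> = Y.diagram"
    "\<And>g. \<lbrakk>g \<in> Arr J; Cod J g = r\<rbrakk> \<Longrightarrow> Y.pr g \<cdot> ncmp \<pi> (Dom J g) = w g \<cdot> X.pr g"
    unfolding \<pi>_def
    by (rule Y.into[OF X.functor_diagram]; ((rule comp\<pi> nat\<pi>; assumption) | assumption))+
  have "\<pi> \<in> objectwise J M (RLP M B)"
    unfolding objectwise_def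
  proof (intro CollectI conjI ballI)
    fix s assume s: "s \<in> Obj J"
    show "ncmp \<pi> s \<in> RLP M B"
    proof (rule M.product_map_RLP[OF B, where I = "hom J s r" and Z = "\<lambda>_. Dom M q" and Z' = ZY and w = w])
      fix g assume g: "g \<in> hom J s r"
      have "w g \<in> RLP M B" using q M.Id_RLP[OF _ B, of "Dom M q"] qA by (simp add: w_def)
      then show "w g \<in> RLP M B \<and> Dom M (w g) = Dom M q \<and> Cod M (w g) = ZY g" using w by simp
      show "product_pr M (hom J s r) ZY g \<cdot> ncmp \<pi> s = w g \<cdot> product_pr M (hom J s r) (\<lambda>_. Dom M q) g"
        using \<pi>(4)[of g] g by (simp add: in_hom)
    qed (use \<pi> s in simp_all)
  qed (use \<pi> in simp)
  from lift[OF this] have lift\<pi>: "lifts_against (fun_cat J M) \<tau> \<pi>" .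
  show ?thesis
  proof (rule lifts_againstI[OF M.category_axioms])
    fix k v assume k: "k \<in> Arr M" "Dom M k = Dom M \<rho>" "Cod M k = Dom M q"
      and v: "v \<in> Arr M" "Dom M v = Cod M \<rho>" "Cod M v = Cod M q" and sq: "q \<cdot> k = v \<cdot> \<rho>"
    note ar = ij(1-6) k v relA qA
    have ki: "k \<cdot> i \<in> Arr M" "Dom M (k \<cdot> i) = omap (nsrc \<tau>) r" "Cod M (k \<cdot> i) = Dom M q"
      and kj: "k \<cdot> j \<in> Arr M" "Dom M (k \<cdot> j) = Lob (ntgt \<tau>) r" "Cod M (k \<cdot> j) = Dom M q"
      using ar by simp_all
    \<comment> \<open>Under the universal properties, \<open>a\<close> encodes
      \<open>k \<cdot> i\<close>. In \<open>b\<close> the entry at the identity is \<open>v\<close>,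
      and the other entries are the legs of \<open>k \<cdot> j\<close> on the latching
      object.\<close>
    define a where "a g = k \<cdot> i \<cdot> amap (nsrc \<tau>) g" for g
    define b where "b g = (if g = Id J r then v else k \<cdot> j \<cdot> Lin (ntgt \<tau>) r g)" for g
    have a: "a g \<in> Arr M \<and> Cod M (a g) = Dom M q \<and> Dom M (a g) = omap (nsrc \<tau>) (Dom J g)"
      if "g \<in> Arr J" "Cod J g = r" for g
      unfolding a_def using that ki fn by simp
    have b: "b g \<in> Arr M \<and> Cod M (b g) = ZY g \<and> Dom M (b g) = omap (ntgt \<tau>) (Dom J g)"
      if "g \<in> Arr J" "Cod J g = r" for g
      using that kj fn ar Lin(1-3)[OF fn(2), of g r] non_Id_iff[of g r] r
      by (cases "g = Id J r") (simp_all add: b_def ZY_def)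
    have a_nat: "a g \<cdot> amap (nsrc \<tau>) h = Id M (Dom M q) \<cdot> a (g \<cdot>\<^bsub>J\<^esub> h)"
      if "g \<in> Arr J" "Cod J g = r" "h \<in> Arr J" "Cod J h = Dom J g" for g h
      using that a[of "g \<cdot>\<^bsub>J\<^esub> h"] ar fn by (simp add: a_def functor_comp)
    \<comment> \<open>The compatibility between the exceptional entry of \<open>b\<close> and the
      others: it is the given square \<open>sq\<close> restricted along \<open>j\<close> and then to
      a leg of the latching object.\<close>
    have vq: "v \<cdot> amap (ntgt \<tau>) g = q \<cdot> (k \<cdot> j \<cdot> Lin (ntgt \<tau>) r g)" if g: "g \<in> LO r" for g
    proof -
      have "v \<cdot> amap (ntgt \<tau>) g = v \<cdot> (\<rho> \<cdot> j \<cdot> Lin (ntgt \<tau>) r g)"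
        using Lmap(4)[OF fn(2) r g] rel(3) by simp
      also have "\<dots> = v \<cdot> \<rho> \<cdot> (j \<cdot> Lin (ntgt \<tau>) r g)"
        using ar g fn by (simp add: Lin)
      also have "\<dots> = q \<cdot> (k \<cdot> j \<cdot> Lin (ntgt \<tau>) r g)"
        unfolding sq[symmetric] using ar g fn by (simp add: Lin)
      finally show ?thesis .
    qed
    have b_nat: "b g \<cdot> amap (ntgt \<tau>) h = zY g h \<cdot> b (g \<cdot>\<^bsub>J\<^esub> h)"
      if gh: "g \<in> Arr J" "Cod J g = r" "h \<in> Arr J" "Cod J h = Dom J g" for g h
    proof (cases "g = Id J r")
      case True
      show ?thesis
      proof (cases "h = Id J r")
        case True
        then show ?thesis using gh \<open>g = Id J r\<close> ar r fn by (simp add: b_def zY_def functor_Id)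
      next
        case False
        then have "h \<in> LO r" using non_Id_iff[of h r] gh \<open>g = Id J r\<close> r by simp
        then show ?thesis using gh \<open>g = Id J r\<close> vq[of h] r False by (simp add: b_def zY_def)
      qed
    next
      case False
      then have g: "g \<in> LO r" using gh non_Id_iff by simp
      have "k \<cdot> j \<cdot> Lin (ntgt \<tau>) r g \<cdot> amap (ntgt \<tau>) h = k \<cdot> j \<cdot> Lin (ntgt \<tau>) r (g \<cdot>\<^bsub>J\<^esub> h)"
        using gh g ar Lin[OF fn(2) g] Lin(1-3)[OF fn(2) LO_comp[OF g gh(3,4)]] fn by simp
      then show ?thesis
        using b[of "g \<cdot>\<^bsub>J\<^esub> h"] gh nonid_comp[of g h] False by (simp add: b_def zY_def ZY_def)
    qed
    define u' where "u' = X.into (nsrc \<tau>) a"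
    define v' where "v' = Y.into (ntgt \<tau>) b"
    have u': "is_ntr J M u'" "nsrc u' = nsrc \<tau>" "ntgt u' = X.diagram"
      "\<And>g. \<lbrakk>g \<in> Arr J; Cod J g = r\<rbrakk> \<Longrightarrow> X.pr g \<cdot> ncmp u' (Dom J g) = a g"
      unfolding u'_def by (rule X.into[OF fn(1)]; ((rule a a_nat; assumption) | assumption))+
    have v': "is_ntr J M v'" "nsrc v' = ntgt \<tau>" "ntgt v' = Y.diagram"
      "\<And>g. \<lbrakk>g \<in> Arr J; Cod J g = r\<rbrakk> \<Longrightarrow> Y.pr g \<cdot> ncmp v' (Dom J g) = b g"
      unfolding v'_def by (rule Y.into[OF fn(2)]; ((rule b b_nat; assumption) | assumption))+
    \<comment> \<open>Compared on projections. At the identity this is the given square restricted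
      along \<open>i\<close>; at any other arrow it is the commutativity of the pushout
      square.\<close>
    have sq': "ncmp \<pi> s \<cdot> ncmp u' s = ncmp v' s \<cdot> ncmp \<tau> s" if s: "s \<in> Obj J" for s
    proof (rule Y.val_eqI[of _ _ s])
      fix g assume g: "g \<in> Arr J" "Cod J g = r" "Dom J g = s"
      have "Y.pr g \<cdot> (ncmp \<pi> s \<cdot> ncmp u' s) = (w g \<cdot> X.pr g) \<cdot> ncmp u' s"
        using g s \<pi> u' Y.pr[of g] by (intro M.comp_comp_eq) auto
      also have "\<dots> = w g \<cdot> (X.pr g \<cdot> ncmp u' s)"
        using g s u' X.pr[of g] w[of g] by simp
      also have "\<dots> = w g \<cdot> a g" using g u'(4)[of g] by simp
      also have "\<dots> = b g \<cdot> ncmp \<tau> s"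
      proof (cases "g = Id J r")
        case True
        have "w g \<cdot> a g = q \<cdot> k \<cdot> i"
          using True r ar fn by (simp add: w_def a_def functor_Id)
        also have "\<dots> = v \<cdot> (\<rho> \<cdot> i)" unfolding sq using ar by simp
        finally show ?thesis using True g(3) r by (simp add: b_def rel)
      next
        case False
        then have gL: "g \<in> LO r" using g non_Id_iff by simp
        have "w g \<cdot> a g = k \<cdot> i \<cdot> (Lmap (nsrc \<tau>) r \<cdot> Lin (nsrc \<tau>) r g)"
          using a[OF g(1,2)] False by (simp add: w_def a_def Lmap(4)[OF fn(1) r gL])
        also have "\<dots> = k \<cdot> (i \<cdot> Lmap (nsrc \<tau>) r) \<cdot> Lin (nsrc \<tau>) r g"
          using ar r gL fn by (simp add: Lmap(1-3) Lin)
        also have "\<dots> = k \<cdot> j \<cdot> (Larr \<tau> r \<cdot> Lin (nsrc \<tau>) r g)"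
          unfolding ij(7) using ar r gL fn \<tau> by (simp add: Larr(1-3) Lin)
        also have "\<dots> = k \<cdot> j \<cdot> Lin (ntgt \<tau>) r g \<cdot> ncmp \<tau> s"
          unfolding Larr(4)[OF \<tau> gL] using ar s g gL fn \<tau> by (simp add: Lin)
        finally show ?thesis using False by (simp add: b_def)
      qed
      also have "\<dots> = Y.pr g \<cdot> (ncmp v' s \<cdot> ncmp \<tau> s)"
        using g s v' \<tau> Y.pr[of g] by (intro M.comp_comp_eq[symmetric]) auto
      finally show "Y.pr g \<cdot> (ncmp \<pi> s \<cdot> ncmp u' s) = Y.pr g \<cdot> (ncmp v' s \<cdot> ncmp \<tau> s)" .
    qed (use s u' v' \<pi> \<tau> in simp_all)
    have "\<pi> \<cdot>\<^bsub>fun_cat J M\<^esub> u' = v' \<cdot>\<^bsub>fun_cat J M\<^esub> \<tau>"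
      using mk_ntr_cong[of J "\<lambda>x. ncmp \<pi> x \<cdot> ncmp u' x" "\<lambda>x. ncmp v' x \<cdot> ncmp \<tau> x" "nsrc \<tau>" Y.diagram, OF sq']
      by (simp add: u' v' \<pi>)
    then obtain H where H: "is_ntr J M H" "nsrc H = ntgt \<tau>" "ntgt H = X.diagram"
      "H \<cdot>\<^bsub>fun_cat J M\<^esub> \<tau> = u'" "\<pi> \<cdot>\<^bsub>fun_cat J M\<^esub> H = v'"
      using lifts_againstD[OF lift\<pi>, of u' v'] u' v' \<pi> by auto
    have H\<tau>: "ncmp H x \<cdot> ncmp \<tau> x = ncmp u' x" if "x \<in> Obj J" for x
      using arg_cong[of _ _ "\<lambda>t. ncmp t x", OF H(4)] that by simp
    have \<pi>H: "ncmp \<pi> x \<cdot> ncmp H x = ncmp v' x" if "x \<in> Obj J" for x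
      using arg_cong[of _ _ "\<lambda>t. ncmp t x", OF H(5)] that by simp
    \<comment> \<open>At the identity of \<open>r\<close> this is the triangle of \<open>h\<close>
      with \<open>q\<close>; at the other arrows it computes the projections of \<open>H\<close>,
      because there \<open>w g\<close> is an identity.\<close>
    have wH: "w g \<cdot> (X.pr g \<cdot> ncmp H (Dom J g)) = b g" if g: "g \<in> Arr J" "Cod J g = r" for g
    proof -
      have "w g \<cdot> (X.pr g \<cdot> ncmp H (Dom J g)) = (w g \<cdot> X.pr g) \<cdot> ncmp H (Dom J g)"
        using g H w[of g] X.pr[of g] by simp
      also have "\<dots> = Y.pr g \<cdot> (ncmp \<pi> (Dom J g) \<cdot> ncmp H (Dom J g))"
        using g H \<pi> Y.pr[of g] by (intro M.comp_comp_eq[symmetric]) auto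
      finally show ?thesis using g \<pi>H v'(4)[of g] by simp
    qed
    let ?pr = "X.pr (Id J r)"
    have pr: "?pr \<in> Arr M" "Dom M ?pr = X.val r" "Cod M ?pr = Dom M q"
      using X.pr[of "Id J r"] r by simp_all
    define h where "h = ?pr \<cdot> ncmp H r"
    have h: "h \<in> Arr M" "Dom M h = omap (ntgt \<tau>) r" "Cod M h = Dom M q"
      using pr H r by (simp_all add: h_def)
    have "q \<cdot> h = v"
      using wH[of "Id J r"] r by (simp add: h_def w_def b_def)
    moreover have "h \<cdot> \<rho> = k"
    proof (rule M.pushout_eqI[OF Lmap(1)[OF fn(1) r] Larr(1)[OF \<tau>] po, of _ "Dom M q"])
      have "h \<cdot> \<rho> \<cdot> i = h \<cdot> (\<rho> \<cdot> i)" using h ar by simp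
      also have "\<dots> = ?pr \<cdot> (ncmp H r \<cdot> ncmp \<tau> r)" using rel pr H r \<tau> by (simp add: h_def)
      also have "\<dots> = a (Id J r)" using H\<tau>[OF r] u'(4)[of "Id J r"] r by simp
      finally show "h \<cdot> \<rho> \<cdot> i = k \<cdot> i"
        using r ar fn by (simp add: a_def functor_Id)
      show "h \<cdot> \<rho> \<cdot> j = k \<cdot> j"
      proof (rule L_eqI[OF fn(2)])
        fix g assume gL: "g \<in> LO r"
        then have g: "g \<in> Arr J" "Cod J g = r" "g \<noteq> Id J r" using non_Id_iff[of g r] by (auto simp: LO_iff)
        have "h \<cdot> \<rho> \<cdot> j \<cdot> Lin (ntgt \<tau>) r g = h \<cdot> (\<rho> \<cdot> j \<cdot> Lin (ntgt \<tau>) r g)"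
          using h ar gL fn by (simp add: Lin)
        also have "\<dots> = h \<cdot> amap (ntgt \<tau>) g"
          using Lmap(4)[OF fn(2) r gL] rel(3) by simp
        \<comment> \<open>Naturality of \<open>H\<close> along \<open>g\<close> turns the projection
          at the identity into the projection at \<open>g\<close>, which \<open>wH\<close>
          determines.\<close>
        also have "\<dots> = ?pr \<cdot> (amap X.diagram g \<cdot> ncmp H (Dom J g))"
          using ntr_nat[OF H(1) g(1)] pr H r g fn by (simp add: h_def)
        also have "\<dots> = (Id M (Dom M q) \<cdot> X.pr g) \<cdot> ncmp H (Dom J g)"
          using pr H r g X.amap_diagram[of g] X.amap_diagram(4)[of g "Id J r"] by (intro M.comp_comp_eq) auto
        also have "\<dots> = w g \<cdot> (X.pr g \<cdot> ncmp H (Dom J g))"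
          using g H X.pr[of g] by (simp add: w_def)
        also have "\<dots> = k \<cdot> j \<cdot> Lin (ntgt \<tau>) r g"
          using wH[OF g(1,2)] g(3) by (simp add: b_def)
        finally show "h \<cdot> \<rho> \<cdot> j \<cdot> Lin (ntgt \<tau>) r g = k \<cdot> j \<cdot> Lin (ntgt \<tau>) r g" .
      qed (use h ar in simp_all)
    qed (use h ar in \<open>simp_all add: in_hom\<close>)
    ultimately show "\<exists>h. h \<in> Arr M \<and> Dom M h = Cod M \<rho> \<and> Cod M h = Dom M q \<and> h \<cdot> \<rho> = k \<and> q \<cdot> h = v"
      using h relA by auto
  qed (use relA qA in simp_all)
qed

text \<open>For \<open>B\<close> the cofibrations of a model structure, \<open>RLP M B\<close>
  consists of the trivial fibrations and \<open>LLP M (RLP M B)\<close> is \<open>B\<close>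
  again.\<close>

theorem latching_LLP_iff:
  assumes "is_ntr J M \<tau>" "B \<subseteq> Arr M" and rho: "\<And>r. r \<in> Obj J \<Longrightarrow> is_relative_latching \<tau> r (\<rho> r)"
  shows "\<tau> \<in> LLP (fun_cat J M) (objectwise J M (RLP M B)) \<longleftrightarrow> (\<forall>r\<in>Obj J. \<rho> r \<in> LLP M (RLP M B))"
proof
  assume "\<tau> \<in> LLP (fun_cat J M) (objectwise J M (RLP M B))"
  then have lift: "\<And>p. p \<in> objectwise J M (RLP M B) \<Longrightarrow> lifts_against (fun_cat J M) \<tau> p"
    by (simp add: LLP_def)
  show "\<forall>r\<in>Obj J. \<rho> r \<in> LLP M (RLP M B)"
  proof
    fix r assume r: "r \<in> Obj J"
    have "\<rho> r \<in> Arr M" using rho[OF r] by (auto simp: is_relative_latching_def in_hom)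
    then show "\<rho> r \<in> LLP M (RLP M B)"
      using lifts_imp_latching[OF assms(1,2) r rho[OF r] _ lift] by (simp add: LLP_def)
  qed
next
  assume *: "\<forall>r\<in>Obj J. \<rho> r \<in> LLP M (RLP M B)"
  have "lifts_against (fun_cat J M) \<tau> p" if "p \<in> objectwise J M (RLP M B)" for p
    using that * by (intro latching_imp_lifts[of \<tau> p \<rho>] assms rho) (auto simp: objectwise_def LLP_def)
  then show "\<tau> \<in> LLP (fun_cat J M) (objectwise J M (RLP M B))"
    using assms(1) by (simp add: LLP_def)
qed

end

section \<open>Diagrams and latching data restricted to a wide subcategory\<close>

section \<open>Restriction to wide subcategories\<close>

lemma wide_simps [simp]:
  "Obj (wide C A) = Obj C" "Arr (wide C A) = A" "Dom (wide C A) = Dom C" "Cod (wide C A) = Cod C"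
  "Id (wide C A) = Id C" "g \<cdot>\<^bsub>wide C A\<^esub> f = g \<cdot>\<^bsub>C\<^esub> f"
  by (simp_all add: wide_def)

lemma category_wide:
  assumes "category C" "wide_subcategory C A"
  shows "category (wide C A)"
proof -
  interpret category C by fact
  have A: "f \<in> Arr C" if "f \<in> A" for f
    using assms(2) that by (auto simp: wide_subcategory_def)
  show ?thesis
    using assms(2) by (intro categoryI) (auto simp: A wide_subcategory_def)
qed

lemma wide_opp: "wide (opp C) A = opp (wide C A)"
  by (simp add: wide_def opp_def)

lemma wide_subcategory_opp: "wide_subcategory (opp C) A \<longleftrightarrow> wide_subcategory C A"
  by (auto simp: wide_subcategory_def)

lemma restr_diag_simps [simp]:
  "omap (restr_diag I F) = restrict (omap F) (Obj I)" "amap (restr_diag I F) = restrict (amap F) (Arr I)"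
  by (simp_all add: restr_diag_def)

lemma restr_diag_opp [simp]: "restr_diag (opp I) = restr_diag I"
  by (simp add: restr_diag_def fun_eq_iff)

lemma functor_restr:
  assumes "category (wide J A)" "A \<subseteq> Arr J" "is_functor J C F"
  shows "is_functor (wide J A) C (restr_diag (wide J A) F)"
  unfolding restr_diag_def
  by (rule mk_functor_is_functorI[OF assms(1)]) (use assms in \<open>auto simp: functor_Id functor_comp subset_eq\<close>)

text \<open>The arrow part of \<open>restriction\<close> as a total function, free of membership
  side conditions.\<close>

definition restr_ntr :: "('o, 'm) cat \<Rightarrow> ('o, 'm, 'p, 'n) ntr \<Rightarrow> ('o, 'm, 'p, 'n) ntr" where
  "restr_ntr I t = mk_ntr I (restr_diag I (nsrc t)) (restr_diag I (ntgt t)) (ncmp t)"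

lemma restr_ntr_simps [simp]:
  "nsrc (restr_ntr I t) = restr_diag I (nsrc t)" "ntgt (restr_ntr I t) = restr_diag I (ntgt t)"
  "ncmp (restr_ntr I t) = restrict (ncmp t) (Obj I)"
  by (simp_all add: restr_ntr_def)

lemma restr_ntr_opp: "restr_ntr (opp I) (opp_ntr t) = opp_ntr (restr_ntr I t)"
  by (simp add: restr_ntr_def)

lemma ntr_restr:
  assumes "category (wide J A)" "A \<subseteq> Arr J" "is_ntr J C t"
  shows "is_ntr (wide J A) C (restr_ntr (wide J A) t)"
  unfolding restr_ntr_def
proof (rule mk_ntr_is_ntrI[OF assms(1)])
  interpret category "wide J A" by fact
  fix f assume "f \<in> Arr (wide J A)"
  then show "amap (restr_diag (wide J A) (ntgt t)) f \<cdot>\<^bsub>C\<^esub> ncmp t (Dom (wide J A) f) =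
    ncmp t (Cod (wide J A) f) \<cdot>\<^bsub>C\<^esub> amap (restr_diag (wide J A) (nsrc t)) f"
    using assms ntr_nat[of J C t f] by auto
qed (use assms in \<open>auto simp: functor_restr\<close>)

lemma amap_restriction: "is_ntr J C t \<Longrightarrow> amap (restriction I J C) t = restr_ntr I t"
  and omap_restriction: "is_functor J C F \<Longrightarrow> omap (restriction I J C) F = restr_diag I F"
  by (simp_all add: restriction_def restr_ntr_def)

lemma colim_desc_cong: "(\<And>j. j \<in> Obj J \<Longrightarrow> l j = l' j) \<Longrightarrow> colim_desc J C D c l = colim_desc J C D c l'"
  by (simp add: colim_desc_def cong: ball_cong)

text \<open>The latching category mentions only arrows of \<open>P\<close>, so it is the same record
  for \<open>R\<close> and for \<open>wide R P\<close>. Hence results about direct categories apply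
  to a diagram on \<open>R\<close> through its restriction.\<close>

lemma latching_wide:
  assumes "category R" "wide_subcategory R P" "r \<in> Obj R"
  shows "latching_map (wide R P) d P M (restr_diag (wide R P) \<Phi>) r = latching_map R d P M \<Phi> r"
    and "latching_arr (wide R P) d P M (restr_ntr (wide R P) \<tau>) r = latching_arr R d P M \<tau> r"
proof -
  interpret R: category R by fact
  have P: "f \<in> Arr R" if "f \<in> P" for f
    using assms(2) that by (auto simp: wide_subcategory_def)
  let ?W = "wide R P"
  have lo: "latching_objs ?W d P = latching_objs R d P"
    by (simp add: latching_objs_def fun_eq_iff)
  have lo': "Obj (latching_cat R d P r) = latching_objs R d P r" by (simp add: latching_cat_def)
  have lo'': "f \<in> P" "Dom R f \<in> Obj R" if "f \<in> latching_objs R d P r" for f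
    using that P by (simp_all add: latching_objs_def)
  have lc: "latching_cat ?W d P = latching_cat R d P"
    by (rule ext) (simp add: latching_cat_def lo)
  have ld: "latching_diag ?W d P (restr_diag ?W \<Phi>) r = latching_diag R d P \<Phi> r" for \<Phi>
    unfolding latching_diag_def lc
  proof (rule mk_functor_cong)
    fix u assume "u \<in> Arr (latching_cat R d P r)"
    then show "(case u of (f, h, g) \<Rightarrow> amap (restr_diag ?W \<Phi>) h) = (case u of (f, h, g) \<Rightarrow> amap \<Phi> h)"
      by (cases u) (simp add: latching_cat_def)
  qed (simp add: lo' lo'')
  have "omap (restr_diag ?W \<Phi>) r = omap \<Phi> r" using assms(3) by simp
  then show "latching_map ?W d P M (restr_diag ?W \<Phi>) r = latching_map R d P M \<Phi> r"
    unfolding latching_map_def ld lc by (simp only:) (rule colim_desc_cong, use lo'' in \<open>simp add: lo'\<close>)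
  show "latching_arr ?W d P M (restr_ntr ?W \<tau>) r = latching_arr R d P M \<tau> r"
    unfolding latching_arr_def latching_ob_def restr_ntr_simps ld lc
    by (rule colim_desc_cong) (use lo'' in \<open>simp add: lo'\<close>)
qed

section \<open>Transfer of latching results to matching objects\<close>

section \<open>Matching objects as latching objects of the opposite\<close>

text \<open>The two shapes are opposite only up to reversing triples: \<open>(f, h, g)\<close> on
  one side is \<open>(g, h, f)\<close> on the other. Cones and cocones do not see this relabelling,
  so the universal properties agree although the categories are not literally opposite.\<close>

lemma is_limit_matching:
  "is_limit (matching_cat R d N r) M (matching_diag R d N \<Phi> r) =
    is_colimit (latching_cat (opp R) d N r) (opp M) (latching_diag (opp R) d N \<Phi> r)"
proof -
  let ?m = "matching_cat R d N r" and ?l = "latching_cat (opp R) d N r"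
  have obj: "Obj ?l = Obj ?m"
    by (simp add: latching_cat_def matching_cat_def latching_objs_def matching_objs_def)
  have arr: "(f, h, g) \<in> Arr ?l \<longleftrightarrow> (g, h, f) \<in> Arr ?m" for f h g
    by (auto simp: latching_cat_def matching_cat_def latching_objs_def matching_objs_def)
  have dc: "Dom ?l (f, h, g) = f" "Cod ?l (f, h, g) = g" "Dom ?m (f, h, g) = f" "Cod ?m (f, h, g) = g" for f h g
    by (simp_all add: latching_cat_def matching_cat_def)
  have dobj: "j \<in> Obj ?m \<Longrightarrow> omap (latching_diag (opp R) d N \<Phi> r) j = omap (matching_diag R d N \<Phi> r) j" for j
    using obj by (simp add: latching_diag_def matching_diag_def)
  have darr: "(f, h, g) \<in> Arr ?l \<Longrightarrow> amap (latching_diag (opp R) d N \<Phi> r) (f, h, g) = amap \<Phi> h"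
    "(f, h, g) \<in> Arr ?m \<Longrightarrow> amap (matching_diag R d N \<Phi> r) (f, h, g) = amap \<Phi> h" for f h g
    by (simp_all add: latching_diag_def matching_diag_def)
  have "is_cocone ?l (opp M) (latching_diag (opp R) d N \<Phi> r) c k \<longleftrightarrow> is_cone ?m M (matching_diag R d N \<Phi> r) c k" for c k
  proof -
    have "(\<forall>u\<in>Arr ?l. k (Cod ?l u) \<cdot>\<^bsub>opp M\<^esub> amap (latching_diag (opp R) d N \<Phi> r) u = k (Dom ?l u)) \<longleftrightarrow>
        (\<forall>f h g. (f, h, g) \<in> Arr ?l \<longrightarrow> amap \<Phi> h \<cdot>\<^bsub>M\<^esub> k g = k f)"
      by (auto simp: dc darr)
    moreover have "(\<forall>u\<in>Arr ?m. amap (matching_diag R d N \<Phi> r) u \<cdot>\<^bsub>M\<^esub> k (Dom ?m u) = k (Cod ?m u)) \<longleftrightarrow>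
        (\<forall>f h g. (f, h, g) \<in> Arr ?m \<longrightarrow> amap \<Phi> h \<cdot>\<^bsub>M\<^esub> k f = k g)"
      by (auto simp: dc darr)
    ultimately show ?thesis
      by (auto simp: is_cocone_def is_cone_def hom_opp obj dobj arr)
  qed
  then show ?thesis
    by (simp add: is_limit_def is_colimit_def hom_opp obj fun_eq_iff)
qed

text \<open>The pushout legs come out in the order opposite to that of
  \<open>relative_latching_map\<close>; this is the case provided for by
  \<open>relative_latching_map_flipped\<close>.\<close>

lemma relative_matching_map_opp:
  "relative_matching_map R d N M \<tau> r =
    pushout_desc (opp M) (latching_arr (opp R) d N (opp M) (opp_ntr \<tau>) r) (latching_map (opp R) d N (opp M) (ntgt \<tau>) r)
      (latching_map (opp R) d N (opp M) (nsrc \<tau>) r) (ncmp \<tau> r)"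
proof -
  let ?m = "matching_cat R d N r" and ?l = "latching_cat (opp R) d N r"
  have obj: "Obj ?l = Obj ?m"
    by (simp add: latching_cat_def matching_cat_def latching_objs_def matching_objs_def)
  have lim: "lim ?m M (matching_diag R d N \<Phi> r) = colim ?l (opp M) (latching_diag (opp R) d N \<Phi> r)" for \<Phi>
    by (simp add: lim_def colim_def is_limit_matching)
  have ob: "matching_ob R d N M \<Phi> r = latching_ob (opp R) d N (opp M) \<Phi> r" for \<Phi>
    by (simp add: matching_ob_def latching_ob_def lim_ob_def colim_ob_def lim)
  have lift: "lim_lift ?m M (matching_diag R d N \<Phi> r) = colim_desc ?l (opp M) (latching_diag (opp R) d N \<Phi> r)" for \<Phi>
    by (simp add: lim_lift_def colim_desc_def lim_ob_def colim_ob_def lim_pr_def colim_in_def lim obj hom_opp fun_eq_iff)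
  have map: "matching_map R d N M \<Phi> r = latching_map (opp R) d N (opp M) \<Phi> r" for \<Phi>
    by (simp add: matching_map_def latching_map_def lift)
  have arr: "matching_arr R d N M \<tau> r = latching_arr (opp R) d N (opp M) (opp_ntr \<tau>) r"
    by (simp add: matching_arr_def latching_arr_def lift ob lim_pr_def colim_in_def lim)
  show ?thesis
    by (simp add: relative_matching_map_def pushout_desc_opp map arr)
qed

lemma lifts_against_fun_cat_opp:
  "lifts_against (fun_cat (opp J) (opp C)) (opp_ntr i) (opp_ntr p) \<longleftrightarrow> lifts_against (fun_cat J C) p i"
proof -
  have *: "lifts_against (fun_cat J C) p i"
    if l: "lifts_against (fun_cat (opp J) (opp C)) (opp_ntr i) (opp_ntr p)"
    for J :: "('a, 'b) cat" and C :: "('c, 'd) cat" and i p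
    unfolding lifts_against_def
  proof (intro allI impI)
    fix u v assume *: "u \<in> hom (fun_cat J C) (Dom (fun_cat J C) p) (Dom (fun_cat J C) i) \<and>
      v \<in> hom (fun_cat J C) (Cod (fun_cat J C) p) (Cod (fun_cat J C) i) \<and> i \<cdot>\<^bsub>fun_cat J C\<^esub> u = v \<cdot>\<^bsub>fun_cat J C\<^esub> p"
    then have "opp_ntr p \<cdot>\<^bsub>fun_cat (opp J) (opp C)\<^esub> opp_ntr v = opp_ntr u \<cdot>\<^bsub>fun_cat (opp J) (opp C)\<^esub> opp_ntr i"
      by (auto simp: in_hom)
    then have "\<exists>h. h \<in> Arr (fun_cat (opp J) (opp C)) \<and> nsrc h = nsrc i \<and> ntgt h = ntgt p \<and>
      h \<cdot>\<^bsub>fun_cat (opp J) (opp C)\<^esub> opp_ntr i = opp_ntr v \<and> opp_ntr p \<cdot>\<^bsub>fun_cat (opp J) (opp C)\<^esub> h = opp_ntr u"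
      using lifts_againstD[OF l, of "opp_ntr v" "opp_ntr u"] * by (simp add: in_hom)
    then obtain h where h: "is_ntr (opp J) (opp C) h" "nsrc h = nsrc i" "ntgt h = ntgt p"
      "h \<cdot>\<^bsub>fun_cat (opp J) (opp C)\<^esub> opp_ntr i = opp_ntr v" "opp_ntr p \<cdot>\<^bsub>fun_cat (opp J) (opp C)\<^esub> h = opp_ntr u"
      by auto
    have "is_ntr J C (opp_ntr h)" using h(1) is_ntr_opp[of J C "opp_ntr h"] by simp
    then show "\<exists>h. h \<in> hom (fun_cat J C) (Cod (fun_cat J C) p) (Dom (fun_cat J C) i) \<and>
      h \<cdot>\<^bsub>fun_cat J C\<^esub> p = u \<and> i \<cdot>\<^bsub>fun_cat J C\<^esub> h = v"
      using h by (intro exI[of _ "opp_ntr h"]) (simp add: in_hom)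
  qed
  from *[of J C i p] *[of "opp J" "opp C" "opp_ntr p" "opp_ntr i"] show ?thesis by auto
qed

lemma objectwise_opp: "opp_ntr t \<in> objectwise (opp J) (opp C) A \<longleftrightarrow> t \<in> objectwise J C A"
  by (simp add: objectwise_def)

text \<open>\<open>opp_ntr\<close> is a bijection between the arrows of the two functor categories
  and preserves objectwise classes, so the quantifier over test maps carries over.\<close>

lemma RLP_fun_cat_opp:
  "opp_ntr t \<in> LLP (fun_cat (opp J) (opp C)) (objectwise (opp J) (opp C) A) \<longleftrightarrow>
    t \<in> RLP (fun_cat J C) (objectwise J C A)"
proof -
  have "(\<forall>p\<in>objectwise (opp J) (opp C) A. lifts_against (fun_cat (opp J) (opp C)) (opp_ntr t) p) \<longleftrightarrow>
    (\<forall>p\<in>objectwise J C A. lifts_against (fun_cat J C) p t)"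
    by (metis lifts_against_fun_cat_opp objectwise_opp opp_ntr_simps(4))
  then show ?thesis
    by (simp add: LLP_def RLP_def)
qed

section \<open>Reedy cofibrations and fibrations as lifting properties of restrictions\<close>

section \<open>Reedy cofibrations and fibrations\<close>

text \<open>The first alternative for \<open>\<rho>\<close> serves the cofibrations; the second is
  the shape that a relative matching map takes in the opposite categories.\<close>

lemma latching_LLP_restriction_iff:
  fixes U :: "'u::infinite itself" and R :: "('u, 'u) cat"
  assumes R: "category R" "wide_subcategory R P"
    and raises: "\<And>f. \<lbrakk>f \<in> P; f \<notin> Id R ` Obj R\<rbrakk> \<Longrightarrow> d (Dom R f) < d (Cod R f)"
    and M: "category M" "complete U M" "cocomplete U M"
    and \<tau>: "is_ntr R M \<tau>" and B: "B \<subseteq> Arr M"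
    and rho: "\<And>r. r \<in> Obj R \<Longrightarrow> \<rho> r = relative_latching_map R d P M \<tau> r \<or>
      \<rho> r = pushout_desc M (latching_arr R d P M \<tau> r) (latching_map R d P M (nsrc \<tau>) r)
        (latching_map R d P M (ntgt \<tau>) r) (ncmp \<tau> r)"
  shows "restr_ntr (wide R P) \<tau> \<in> LLP (fun_cat (wide R P) M) (objectwise (wide R P) M (RLP M B)) \<longleftrightarrow>
    (\<forall>r\<in>Obj R. \<rho> r \<in> LLP M (RLP M B))"
proof -
  interpret M: category M by fact
  have W: "category (wide R P)" by (rule category_wide[OF R])
  interpret direct_diagrams "wide R P" d M U
    using W raises M
    by (intro direct_diagrams.intro direct_category.intro direct_category_axioms.intro cocomplete_category.intro
        cocomplete_category_axioms.intro complete_category.intro complete_category_axioms.intro) simp_all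
  have "P \<subseteq> Arr R" using R(2) by (simp add: wide_subcategory_def)
  note \<tau>' = ntr_restr[OF W this \<tau>]
  have "is_relative_latching (restr_ntr (wide R P) \<tau>) r (\<rho> r)" if r: "r \<in> Obj R" for r
    using rho[OF r] relative_latching_map[OF \<tau>', of r] relative_latching_map_flipped[OF \<tau>', of r] r
    by (auto simp: relative_latching_map_def latching_wide[OF R r])
  with latching_LLP_iff[OF \<tau>' B, of \<rho>] show ?thesis by simp
qed

text \<open>Arrows of \<open>N\<close> lower the degree in \<open>R\<close>, hence raise it in
  \<open>opp R\<close>. The previous result therefore applies to the opposites of \<open>R\<close>
  and \<open>M\<close>, with left and right lifting classes exchanged.\<close>

lemma matching_RLP_restriction_iff:
  fixes U :: "'u::infinite itself" and R :: "('u, 'u) cat"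
  assumes R: "category R" "wide_subcategory R N"
    and lowers: "\<And>f. \<lbrakk>f \<in> N; f \<notin> Id R ` Obj R\<rbrakk> \<Longrightarrow> d (Cod R f) < d (Dom R f)"
    and M: "category M" "complete U M" "cocomplete U M"
    and \<tau>: "is_ntr R M \<tau>" and B: "B \<subseteq> Arr M"
  shows "restr_ntr (wide R N) \<tau> \<in> RLP (fun_cat (wide R N) M) (objectwise (wide R N) M (LLP M B)) \<longleftrightarrow>
    (\<forall>r\<in>Obj R. relative_matching_map R d N M \<tau> r \<in> RLP M (LLP M B))"
proof -
  have "restr_ntr (wide (opp R) N) (opp_ntr \<tau>) \<in> LLP (fun_cat (wide (opp R) N) (opp M)) (objectwise (wide (opp R) N) (opp M) (RLP (opp M) B)) \<longleftrightarrow>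
    (\<forall>r\<in>Obj (opp R). relative_matching_map R d N M \<tau> r \<in> LLP (opp M) (RLP (opp M) B))"
    by (rule latching_LLP_restriction_iff[where U = U, OF _ _ _ _ _ _ _ _ disjI2[OF relative_matching_map_opp[THEN trans]]])
      (use assms in \<open>simp_all add: category_opp wide_subcategory_opp complete_opp cocomplete_opp\<close>)
  then show ?thesis
    by (simp add: wide_opp restr_ntr_opp RLP_fun_cat_opp LLP_opp RLP_opp)
qed

section \<open>Algebras of the monad as functorial families of maps\<close>

section \<open>Algebras over the monad of a category of diagrams\<close>

lemma ids_simps [simp]:
  "Obj (ids C) = Obj C" "Arr (ids C) = Id C ` Obj C" "Dom (ids C) = Dom C" "Cod (ids C) = Cod C"
  "Id (ids C) = Id C" "g \<cdot>\<^bsub>ids C\<^esub> f = g \<cdot>\<^bsub>C\<^esub> f"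
  by (simp_all add: ids_def)

lemma ids_wide: "ids (wide C A) = ids C"
  by (simp add: ids_def wide_def)

lemma ids_opp: "ids (opp C) = opp (ids C)"
  by (simp add: ids_def wide_opp)

lemma (in category) wide_subcategory_ids: "wide_subcategory C (Id C ` Obj C)"
  by (auto simp: wide_subcategory_def)

lemma (in category) category_ids: "category (ids C)"
  unfolding ids_def by (rule category_wide[OF category_axioms wide_subcategory_ids])

lemma (in category) Ids_Arr: "Id C ` Obj C \<subseteq> Arr C"
  by auto

lemma (in category) functor_ids: "is_functor C D F \<Longrightarrow> is_functor (ids C) D (restr_diag (ids C) F)"
  using functor_restr[OF category_ids[unfolded ids_def] Ids_Arr] by (simp add: ids_def)

lemma (in category) ntr_ids: "is_ntr C D t \<Longrightarrow> is_ntr (ids C) D (restr_ntr (ids C) t)"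
  using ntr_restr[OF category_ids[unfolded ids_def] Ids_Arr] by (simp add: ids_def)

text \<open>All arrows of the discrete category are identities, so naturality is automatic.\<close>

lemma mk_ntr_ids:
  assumes "category J" "category C" "is_functor (ids J) C F" "is_functor (ids J) C G"
    and "\<And>x. x \<in> Obj J \<Longrightarrow> c x \<in> Arr C \<and> Dom C (c x) = omap F x \<and> Cod C (c x) = omap G x"
  shows "is_ntr (ids J) C (mk_ntr (ids J) F G c)"
proof -
  interpret J: category J by fact
  interpret C: category C by fact
  show ?thesis
  proof (rule mk_ntr_is_ntrI[OF J.category_ids assms(3,4)])
    fix f assume "f \<in> Arr (ids J)"
    then obtain x where x: "x \<in> Obj J" "f = Id J x" by auto
    then have "amap F f = Id C (omap F x)" "amap G f = Id C (omap G x)"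
      using functor_Id[OF assms(3), of x] functor_Id[OF assms(4), of x] by simp_all
    then show "amap G f \<cdot>\<^bsub>C\<^esub> c (Dom (ids J) f) = c (Cod (ids J) f) \<cdot>\<^bsub>C\<^esub> amap F f"
      using x assms(5)[OF x(1)] by simp
  qed (use assms(5) in simp)
qed

locale free_diagrams = J: category J + M: cocomplete_category M U
  for J :: "('u::infinite, 'u) cat" and M :: "('o, 'm) cat" (structure) and U :: "'u itself"
begin

abbreviation "D \<equiv> fun_cat (ids J) M"
abbreviation "T \<equiv> direct_monad J M"

lemma summand_Obj: "\<lbrakk>is_functor (ids J) M X; f \<in> in_arrs J r\<rbrakk> \<Longrightarrow> omap X (Dom J f) \<in> Obj M"
  by (simp add: in_arrs_def)

lemma lan_at_Obj: "is_functor (ids J) M X \<Longrightarrow> lan_at J M X r \<in> Obj M"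
  by (rule M.coprod_Obj) (rule summand_Obj)

lemma lan_in:
  assumes "is_functor (ids J) M X" "f \<in> Arr J" "Cod J f = r"
  shows "lan_in J M X r f \<in> Arr M" "Dom M (lan_in J M X r f) = omap X (Dom J f)" (is ?c1)
    "Cod M (lan_in J M X r f) = lan_at J M X r" (is ?c2)
proof -
  have "f \<in> in_arrs J r" using assms by (simp add: in_arrs_def)
  then show "lan_in J M X r f \<in> Arr M" ?c1
    ?c2
    using M.coprod_in_Arr M.Dom_coprod_in M.Cod_coprod_in summand_Obj[OF assms(1), of _ r] by simp_all
qed

lemma lan_cotuple:
  assumes X: "is_functor (ids J) M X" and c: "c \<in> Obj M"
    and l: "\<And>f. \<lbrakk>f \<in> Arr J; Cod J f = r\<rbrakk> \<Longrightarrow> l f \<in> Arr M \<and> Dom M (l f) = omap X (Dom J f) \<and> Cod M (l f) = c"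
  shows "lan_cotuple J M X r c l \<in> Arr M" (is ?c1) "Dom M (lan_cotuple J M X r c l) = lan_at J M X r" (is ?c2)
    "Cod M (lan_cotuple J M X r c l) = c" (is ?c3)
    "\<lbrakk>f \<in> Arr J; Cod J f = r\<rbrakk> \<Longrightarrow> lan_cotuple J M X r c l \<cdot> lan_in J M X r f = l f"
proof -
  have l': "\<And>f. f \<in> in_arrs J r \<Longrightarrow> l f \<in> Arr M \<and> Dom M (l f) = omap X (Dom J f) \<and> Cod M (l f) = c"
    using l by (simp add: in_arrs_def)
  note * = summand_Obj[OF X] c l'
  show ?c1 by (rule M.cotuple_Arr) (rule *; assumption)+
  show ?c2 by (rule M.Dom_cotuple) (rule *; assumption)+
  show ?c3 by (rule M.Cod_cotuple) (rule *; assumption)+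
  assume "f \<in> Arr J" "Cod J f = r"
  then have f: "f \<in> in_arrs J r" by (simp add: in_arrs_def)
  show "lan_cotuple J M X r c l \<cdot> lan_in J M X r f = l f"
    by (rule M.cotuple_in[OF _ _ _ f]) (rule *; assumption)+
qed

lemma lan_eqI:
  assumes "is_functor (ids J) M X" "h \<in> Arr M" "Dom M h = lan_at J M X r" "h' \<in> Arr M" "Dom M h' = lan_at J M X r"
    and "Cod M h = Cod M h'"
    and "\<And>f. \<lbrakk>f \<in> Arr J; Cod J f = r\<rbrakk> \<Longrightarrow> h \<cdot> lan_in J M X r f = h' \<cdot> lan_in J M X r f"
  shows "h = h'"
  by (rule M.coprod_eqI[OF _ assms(2-6)]) (use assms(1,7) in \<open>auto simp: in_arrs_def\<close>)

lemma omap_lan_ob [simp]: "r \<in> Obj J \<Longrightarrow> omap (lan_ob J M X) r = lan_at J M X r"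
  by (simp add: lan_ob_def)

lemma amap_lan_ob:
  assumes X: "is_functor (ids J) M X" and h: "h \<in> Arr J"
  shows "amap (lan_ob J M X) h \<in> Arr M" (is ?c1) "Dom M (amap (lan_ob J M X) h) = lan_at J M X (Dom J h)" (is ?c2)
    "Cod M (amap (lan_ob J M X) h) = lan_at J M X (Cod J h)" (is ?c3)
    "\<lbrakk>f \<in> Arr J; Cod J f = Dom J h\<rbrakk> \<Longrightarrow> amap (lan_ob J M X) h \<cdot> lan_in J M X (Dom J h) f = lan_in J M X (Cod J h) (h \<cdot>\<^bsub>J\<^esub> f)"
proof -
  have *: "amap (lan_ob J M X) h = lan_cotuple J M X (Dom J h) (lan_at J M X (Cod J h)) (\<lambda>f. lan_in J M X (Cod J h) (h \<cdot>\<^bsub>J\<^esub> f))"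
    using h by (simp add: lan_ob_def)
  have l: "lan_in J M X (Cod J h) (h \<cdot>\<^bsub>J\<^esub> f) \<in> Arr M \<and> Dom M (lan_in J M X (Cod J h) (h \<cdot>\<^bsub>J\<^esub> f)) = omap X (Dom J f) \<and>
      Cod M (lan_in J M X (Cod J h) (h \<cdot>\<^bsub>J\<^esub> f)) = lan_at J M X (Cod J h)" if "f \<in> Arr J" "Cod J f = Dom J h" for f
    using lan_in[OF X, of "h \<cdot>\<^bsub>J\<^esub> f" "Cod J h"] that h by simp
  show ?c1 ?c2
    ?c3
    "\<lbrakk>f \<in> Arr J; Cod J f = Dom J h\<rbrakk> \<Longrightarrow> amap (lan_ob J M X) h \<cdot> lan_in J M X (Dom J h) f = lan_in J M X (Cod J h) (h \<cdot>\<^bsub>J\<^esub> f)"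
    unfolding * by (rule lan_cotuple[OF X lan_at_Obj[OF X]]; ((rule l; assumption) | assumption))+
qed

lemma functor_lan_ob:
  assumes X: "is_functor (ids J) M X"
  shows "is_functor J M (lan_ob J M X)"
proof (rule is_functorI)
  fix x assume x: "x \<in> Obj J"
  have o: "omap (lan_ob J M X) x = lan_at J M X x" using x by simp
  show "amap (lan_ob J M X) (Id J x) = Id M (omap (lan_ob J M X) x)"
    unfolding o
  proof (rule lan_eqI[OF X])
    fix f assume f: "f \<in> Arr J" "Cod J f = x"
    show "amap (lan_ob J M X) (Id J x) \<cdot> lan_in J M X x f = Id M (lan_at J M X x) \<cdot> lan_in J M X x f"
      using amap_lan_ob(4)[OF X J.Id_Arr[OF x], of f] x f lan_in[OF X f] by simp
  qed (use amap_lan_ob[OF X J.Id_Arr[OF x]] x lan_at_Obj[OF X] in simp_all)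
next
  fix h k assume *: "h \<in> Arr J" "k \<in> Arr J" "Cod J h = Dom J k"
  then have hk: "k \<cdot>\<^bsub>J\<^esub> h \<in> Arr J" by simp
  note h = amap_lan_ob[OF X *(1)] and k = amap_lan_ob[OF X *(2)] and hk = amap_lan_ob[OF X hk]
  show "amap (lan_ob J M X) (k \<cdot>\<^bsub>J\<^esub> h) = amap (lan_ob J M X) k \<cdot> amap (lan_ob J M X) h"
  proof (rule lan_eqI[OF X])
    fix f assume f: "f \<in> Arr J" "Cod J f = Dom J h"
    have "amap (lan_ob J M X) k \<cdot> amap (lan_ob J M X) h \<cdot> lan_in J M X (Dom J h) f =
        amap (lan_ob J M X) k \<cdot> (amap (lan_ob J M X) h \<cdot> lan_in J M X (Dom J h) f)"
      using * f h(1-3) k(1-3) lan_in[OF X f] by simp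
    also have "\<dots> = lan_in J M X (Cod J k) (k \<cdot>\<^bsub>J\<^esub> (h \<cdot>\<^bsub>J\<^esub> f))"
      using h(4)[OF f] k(4)[of "h \<cdot>\<^bsub>J\<^esub> f"] * f by simp
    finally show "amap (lan_ob J M X) (k \<cdot>\<^bsub>J\<^esub> h) \<cdot> lan_in J M X (Dom J h) f =
        amap (lan_ob J M X) k \<cdot> amap (lan_ob J M X) h \<cdot> lan_in J M X (Dom J h) f"
      using hk(4)[of f] * f by simp
  qed (use * h k hk in simp_all)
qed (use amap_lan_ob[OF X] lan_at_Obj[OF X] in simp_all, simp_all add: lan_ob_def)

text \<open>The monad on objects, written without the composite functor; \<open>omap_T\<close>
  identifies the two on diagrams.\<close>

definition free :: "('u, 'u, 'o, 'm) ftor \<Rightarrow> ('u, 'u, 'o, 'm) ftor" where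
  "free X = restr_diag (ids J) (lan_ob J M X)"

lemma functor_free: "is_functor (ids J) M X \<Longrightarrow> is_functor (ids J) M (free X)"
  unfolding free_def by (intro J.functor_ids functor_lan_ob)

lemma omap_free [simp]: "r \<in> Obj J \<Longrightarrow> omap (free X) r = lan_at J M X r"
  by (simp add: free_def)

lemma lan_ntr:
  assumes t: "is_ntr (ids J) M t"
  shows "is_ntr J M (amap (lan J M) t)" "nsrc (amap (lan J M) t) = lan_ob J M (nsrc t)" (is ?c1)
    "ntgt (amap (lan J M) t) = lan_ob J M (ntgt t)" (is ?c2)
    "\<lbrakk>f \<in> Arr J; Cod J f = r\<rbrakk> \<Longrightarrow> ncmp (amap (lan J M) t) r \<cdot> lan_in J M (nsrc t) r f = lan_in J M (ntgt t) r f \<cdot> ncmp t (Dom J f)"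
proof -
  note X = ntr_src[OF t] and Y = ntr_tgt[OF t]
  let ?c = "\<lambda>r. lan_cotuple J M (nsrc t) r (lan_at J M (ntgt t) r) (\<lambda>f. lan_in J M (ntgt t) r f \<cdot> ncmp t (Dom J f))"
  have *: "amap (lan J M) t = mk_ntr J (lan_ob J M (nsrc t)) (lan_ob J M (ntgt t)) ?c"
    using t by (simp add: lan_def)
  have l: "lan_in J M (ntgt t) r f \<cdot> ncmp t (Dom J f) \<in> Arr M \<and>
      Dom M (lan_in J M (ntgt t) r f \<cdot> ncmp t (Dom J f)) = omap (nsrc t) (Dom J f) \<and>
      Cod M (lan_in J M (ntgt t) r f \<cdot> ncmp t (Dom J f)) = lan_at J M (ntgt t) r" if "f \<in> Arr J" "Cod J f = r" for f r
    using lan_in[OF Y that] t that by simp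
  have c: "?c r \<in> Arr M" "Dom M (?c r) = lan_at J M (nsrc t) r" "Cod M (?c r) = lan_at J M (ntgt t) r"
    "\<And>f. \<lbrakk>f \<in> Arr J; Cod J f = r\<rbrakk> \<Longrightarrow> ?c r \<cdot> lan_in J M (nsrc t) r f = lan_in J M (ntgt t) r f \<cdot> ncmp t (Dom J f)" for r
    by (rule lan_cotuple[OF X lan_at_Obj[OF Y]]; ((rule l; assumption) | assumption))+
  show "is_ntr J M (amap (lan J M) t)"
    unfolding *
  proof (rule mk_ntr_is_ntrI[OF J.category_axioms functor_lan_ob[OF X] functor_lan_ob[OF Y]])
    fix h assume h: "h \<in> Arr J"
    show "amap (lan_ob J M (ntgt t)) h \<cdot> ?c (Dom J h) = ?c (Cod J h) \<cdot> amap (lan_ob J M (nsrc t)) h"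
    proof (rule lan_eqI[OF X])
      fix f assume f: "f \<in> Arr J" "Cod J f = Dom J h"
      note i = lan_in[OF X f] lan_in[OF Y f]
      have "amap (lan_ob J M (ntgt t)) h \<cdot> ?c (Dom J h) \<cdot> lan_in J M (nsrc t) (Dom J h) f =
          amap (lan_ob J M (ntgt t)) h \<cdot> (lan_in J M (ntgt t) (Dom J h) f \<cdot> ncmp t (Dom J f))"
        using c(1-3)[of "Dom J h"] c(4)[OF f] amap_lan_ob(1-3)[OF Y h] i by simp
      also have "\<dots> = lan_in J M (ntgt t) (Cod J h) (h \<cdot>\<^bsub>J\<^esub> f) \<cdot> ncmp t (Dom J f)"
        using amap_lan_ob[OF Y h] i f t by (intro M.comp_comp_eq) simp_all
      also have "\<dots> = ?c (Cod J h) \<cdot> (amap (lan_ob J M (nsrc t)) h \<cdot> lan_in J M (nsrc t) (Dom J h) f)"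
        using c(4)[of "h \<cdot>\<^bsub>J\<^esub> f" "Cod J h"] amap_lan_ob(4)[OF X h f] f h by simp
      also have "\<dots> = ?c (Cod J h) \<cdot> amap (lan_ob J M (nsrc t)) h \<cdot> lan_in J M (nsrc t) (Dom J h) f"
        using c(1-3)[of "Cod J h"] amap_lan_ob(1-3)[OF X h] i by simp
      finally show "amap (lan_ob J M (ntgt t)) h \<cdot> ?c (Dom J h) \<cdot> lan_in J M (nsrc t) (Dom J h) f =
        ?c (Cod J h) \<cdot> amap (lan_ob J M (nsrc t)) h \<cdot> lan_in J M (nsrc t) (Dom J h) f" .
    qed (use c amap_lan_ob[OF Y h] amap_lan_ob[OF X h] in simp_all)
  qed (use c in simp)
  show ?c1 ?c2
    by (simp_all add: *)
  assume f: "f \<in> Arr J" "Cod J f = r"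
  then have "r \<in> Obj J" by auto
  then show "ncmp (amap (lan J M) t) r \<cdot> lan_in J M (nsrc t) r f = lan_in J M (ntgt t) r f \<cdot> ncmp t (Dom J f)"
    unfolding * using c(4)[OF f] by simp
qed

lemma omap_T:
  assumes "is_functor (ids J) M X"
  shows "omap (mfun T) X = free X"
  using assms functor_lan_ob[OF assms]
  by (simp add: direct_monad_def adj_monad_def comp_functor_def lan_def omap_restriction free_def)

lemma amap_T:
  assumes t: "is_ntr (ids J) M t"
  shows "is_ntr (ids J) M (amap (mfun T) t)" (is ?c1) "nsrc (amap (mfun T) t) = free (nsrc t)" (is ?c2)
    "ntgt (amap (mfun T) t) = free (ntgt t)" (is ?c3)
    "\<lbrakk>f \<in> Arr J; Cod J f = r\<rbrakk> \<Longrightarrow> ncmp (amap (mfun T) t) r \<cdot> lan_in J M (nsrc t) r f = lan_in J M (ntgt t) r f \<cdot> ncmp t (Dom J f)"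
proof -
  have *: "amap (mfun T) t = restr_ntr (ids J) (amap (lan J M) t)"
    using t by (simp add: direct_monad_def adj_monad_def comp_functor_def amap_restriction[OF lan_ntr(1)[OF t]])
  show ?c1 ?c2
    ?c3
    unfolding * using J.ntr_ids[OF lan_ntr(1)[OF t]] lan_ntr[OF t] by (simp_all add: free_def)
  assume f: "f \<in> Arr J" "Cod J f = r"
  then have "r \<in> Obj J" by auto
  with lan_ntr(4)[OF t f]
  show "ncmp (amap (mfun T) t) r \<cdot> lan_in J M (nsrc t) r f = lan_in J M (ntgt t) r f \<cdot> ncmp t (Dom J f)"
    unfolding * by simp
qed

lemma unit_T:
  assumes X: "is_functor (ids J) M X"
  shows "is_ntr (ids J) M (munit T X)" "nsrc (munit T X) = X" "ntgt (munit T X) = free X"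
    "r \<in> Obj J \<Longrightarrow> ncmp (munit T X) r = lan_in J M X r (Id J r)"
proof -
  have *: "munit T X = mk_ntr (ids J) X (free X) (\<lambda>r. lan_in J M X r (Id J r))"
    by (simp add: direct_monad_def adj_monad_def lan_unit_def free_def)
  show "is_ntr (ids J) M (munit T X)"
    unfolding * by (rule mk_ntr_ids[OF J.category_axioms M.category_axioms X functor_free[OF X]])
      (use lan_in[OF X] in simp)
  show "nsrc (munit T X) = X" "ntgt (munit T X) = free X"
    "r \<in> Obj J \<Longrightarrow> ncmp (munit T X) r = lan_in J M X r (Id J r)"
    by (simp_all add: *)
qed

text \<open>The structure map of the Eilenberg-Moore comparison functor. For a left Kan extension it
  is the multiplication of the monad, see \<open>mult_T\<close>.\<close>

definition alg :: "('u, 'u, 'o, 'm) ftor \<Rightarrow> ('u, 'u, 'o, 'm) ntr" where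
  "alg \<Psi> = amap (restriction (ids J) J M) (lan_counit J M \<Psi>)"

lemma counit_ntr:
  assumes \<Psi>: "is_functor J M \<Psi>"
  shows "is_ntr J M (lan_counit J M \<Psi>)" (is ?c1)
    "\<lbrakk>f \<in> Arr J; Cod J f = r\<rbrakk> \<Longrightarrow> ncmp (lan_counit J M \<Psi>) r \<cdot> lan_in J M (restr_diag (ids J) \<Psi>) r f = amap \<Psi> f"
proof -
  let ?X = "restr_diag (ids J) \<Psi>"
  have X: "is_functor (ids J) M ?X" by (rule J.functor_ids[OF \<Psi>])
  let ?c = "\<lambda>r. lan_cotuple J M ?X r (omap \<Psi> r) (\<lambda>f. amap \<Psi> f)"
  have c: "?c r \<in> Arr M" "Dom M (?c r) = lan_at J M ?X r" "Cod M (?c r) = omap \<Psi> r"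
    "\<And>f. \<lbrakk>f \<in> Arr J; Cod J f = r\<rbrakk> \<Longrightarrow> ?c r \<cdot> lan_in J M ?X r f = amap \<Psi> f" if "r \<in> Obj J" for r
    by (rule lan_cotuple[OF X]; use that \<Psi> in simp)+
  show ?c1
    unfolding lan_counit_def
  proof (rule mk_ntr_is_ntrI[OF J.category_axioms functor_lan_ob[OF X] \<Psi>])
    fix h assume h: "h \<in> Arr J"
    note ch = c[OF J.Dom_Obj[OF h]] and ch' = c[OF J.Cod_Obj[OF h]]
    show "amap \<Psi> h \<cdot> ?c (Dom J h) = ?c (Cod J h) \<cdot> amap (lan_ob J M ?X) h"
    proof (rule lan_eqI[OF X])
      fix f assume f: "f \<in> Arr J" "Cod J f = Dom J h"
      note i = lan_in[OF X f]
      have "amap \<Psi> h \<cdot> ?c (Dom J h) \<cdot> lan_in J M ?X (Dom J h) f = amap \<Psi> h \<cdot> amap \<Psi> f"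
        using i ch(1-3) ch(4)[OF f] h \<Psi> by simp
      also have "\<dots> = amap \<Psi> (h \<cdot>\<^bsub>J\<^esub> f)" using f h by (simp add: functor_comp[OF \<Psi>])
      also have "\<dots> = ?c (Cod J h) \<cdot> (amap (lan_ob J M ?X) h \<cdot> lan_in J M ?X (Dom J h) f)"
        using ch'(4)[of "h \<cdot>\<^bsub>J\<^esub> f"] amap_lan_ob(4)[OF X h f] f h by simp
      also have "\<dots> = ?c (Cod J h) \<cdot> amap (lan_ob J M ?X) h \<cdot> lan_in J M ?X (Dom J h) f"
        using ch'(1-3) amap_lan_ob(1-3)[OF X h] i by simp
      finally show "amap \<Psi> h \<cdot> ?c (Dom J h) \<cdot> lan_in J M ?X (Dom J h) f =
        ?c (Cod J h) \<cdot> amap (lan_ob J M ?X) h \<cdot> lan_in J M ?X (Dom J h) f" .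
    qed (use ch ch' \<Psi> h amap_lan_ob[OF X h] in simp_all)
  qed (use c in simp)
  assume f: "f \<in> Arr J" "Cod J f = r"
  then have "r \<in> Obj J" by auto
  then show "ncmp (lan_counit J M \<Psi>) r \<cdot> lan_in J M ?X r f = amap \<Psi> f"
    using c(4)[OF _ f] by (simp add: lan_counit_def)
qed

lemma alg:
  assumes \<Psi>: "is_functor J M \<Psi>"
  shows "is_ntr (ids J) M (alg \<Psi>)" "nsrc (alg \<Psi>) = free (restr_diag (ids J) \<Psi>)" (is ?c1) "ntgt (alg \<Psi>) = restr_diag (ids J) \<Psi>" (is ?c2)
    "\<lbrakk>f \<in> Arr J; Cod J f = r\<rbrakk> \<Longrightarrow> ncmp (alg \<Psi>) r \<cdot> lan_in J M (restr_diag (ids J) \<Psi>) r f = amap \<Psi> f"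
proof -
  note c = counit_ntr[OF \<Psi>]
  have *: "alg \<Psi> = restr_ntr (ids J) (lan_counit J M \<Psi>)"
    unfolding alg_def by (rule amap_restriction[OF c(1)])
  show "is_ntr (ids J) M (alg \<Psi>)" ?c1 ?c2
    unfolding * using J.ntr_ids[OF c(1)] by (simp_all add: lan_counit_def free_def)
  assume f: "f \<in> Arr J" "Cod J f = r"
  then have "r \<in> Obj J" by auto
  then show "ncmp (alg \<Psi>) r \<cdot> lan_in J M (restr_diag (ids J) \<Psi>) r f = amap \<Psi> f"
    unfolding * using c(2)[OF f] by simp
qed

lemma mult_T: "mmult T X = alg (lan_ob J M X)" if "is_functor (ids J) M X"
  using that by (simp add: direct_monad_def adj_monad_def alg_def lan_def)

definition act :: "('u, 'u, 'o, 'm) ntr \<Rightarrow> 'u \<Rightarrow> 'm" where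
  "act a f = ncmp a (Cod J f) \<cdot> lan_in J M (ntgt a) (Cod J f) f"

text \<open>Candidates for structure maps: of the right type, with the carrier recorded as
  \<open>ntgt a\<close>, and before any axiom is imposed. Such a candidate is the same as its family
  of components \<open>act a f\<close>.\<close>

definition actions :: "('u, 'u, 'o, 'm) ntr set" where
  "actions = {a. is_ntr (ids J) M a \<and> nsrc a = free (ntgt a)}"

lemma act:
  assumes "a \<in> actions" "f \<in> Arr J"
  shows "act a f \<in> Arr M" "Dom M (act a f) = omap (ntgt a) (Dom J f)" (is ?c1) "Cod M (act a f) = omap (ntgt a) (Cod J f)" (is ?c2)
proof -
  have a: "is_ntr (ids J) M a" "nsrc a = free (ntgt a)" using assms(1) by (simp_all add: actions_def)
  show "act a f \<in> Arr M" ?c1 ?c2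
    using assms(2) a lan_in[OF ntr_tgt[OF a(1)] assms(2) refl] by (simp_all add: act_def)
qed

lemma alg_actions: "is_functor J M \<Psi> \<Longrightarrow> alg \<Psi> \<in> actions"
  using alg by (simp add: actions_def)

lemma act_alg: "\<lbrakk>is_functor J M \<Psi>; f \<in> Arr J\<rbrakk> \<Longrightarrow> act (alg \<Psi>) f = amap \<Psi> f"
  using alg by (simp add: act_def)

lemma actions_eqI:
  assumes a: "a \<in> actions" and b: "b \<in> actions" and X: "ntgt a = ntgt b"
    and act: "\<And>f. f \<in> Arr J \<Longrightarrow> act a f = act b f"
  shows "a = b"
proof (rule ntr_eqI)
  show "is_ntr (ids J) M a" "is_ntr (ids J) M b" "nsrc a = nsrc b" "ntgt a = ntgt b"
    using assms by (simp_all add: actions_def)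
  have a': "is_ntr (ids J) M a" "nsrc a = free (ntgt a)" and b': "is_ntr (ids J) M b" "nsrc b = free (ntgt b)"
    using a b by (simp_all add: actions_def)
  fix r assume r: "r \<in> Obj (ids J)"
  show "ncmp a r = ncmp b r"
  proof (rule lan_eqI[OF ntr_tgt[OF b'(1)]])
    fix f assume "f \<in> Arr J" "Cod J f = r"
    then show "ncmp a r \<cdot> lan_in J M (ntgt b) r f = ncmp b r \<cdot> lan_in J M (ntgt b) r f"
      using act[of f] X by (simp add: act_def)
  qed (use r a' b' X in simp_all)
qed

text \<open>Both sides are maps out of a coproduct and are compared on its summands. The form covers
  morphisms of algebras and also the associativity axiom, which says that the structure map is
  itself a morphism from the free algebra.\<close>

lemma commutes_iff:
  assumes a: "a \<in> actions" and b: "b \<in> actions" and t: "is_ntr (ids J) M t" "nsrc t = ntgt a" "ntgt t = ntgt b"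
  shows "t \<cdot>\<^bsub>D\<^esub> a = b \<cdot>\<^bsub>D\<^esub> amap (mfun T) t \<longleftrightarrow>
    (\<forall>f\<in>Arr J. ncmp t (Cod J f) \<cdot> act a f = act b f \<cdot> ncmp t (Dom J f))"
proof -
  have a': "is_ntr (ids J) M a" "nsrc a = free (ntgt a)" and b': "is_ntr (ids J) M b" "nsrc b = free (ntgt b)"
    using a b by (simp_all add: actions_def)
  note X = ntr_tgt[OF a'(1)] and Y = ntr_tgt[OF b'(1)]
  note Tt = amap_T[OF t(1), unfolded t(2,3)]
  let ?l = "\<lambda>r. ncmp t r \<cdot> ncmp a r" and ?r = "\<lambda>r. ncmp b r \<cdot> ncmp (amap (mfun T) t) r"
  have l: "?l (Cod J f) \<cdot> lan_in J M (ntgt a) (Cod J f) f = ncmp t (Cod J f) \<cdot> act a f" if f: "f \<in> Arr J" for f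
    using lan_in[OF X f refl] f a' t by (simp add: act_def)
  have r: "?r (Cod J f) \<cdot> lan_in J M (ntgt a) (Cod J f) f = act b f \<cdot> ncmp t (Dom J f)" if f: "f \<in> Arr J" for f
  proof -
    have "?r (Cod J f) \<cdot> lan_in J M (ntgt a) (Cod J f) f =
        ncmp b (Cod J f) \<cdot> (ncmp (amap (mfun T) t) (Cod J f) \<cdot> lan_in J M (ntgt a) (Cod J f) f)"
      using lan_in[OF X f refl] f b' Tt(1-3) by simp
    also have "\<dots> = act b f \<cdot> ncmp t (Dom J f)"
      using lan_in[OF Y f refl] f b' t Tt(4)[OF f refl] by (simp add: act_def)
    finally show ?thesis .
  qed
  have "t \<cdot>\<^bsub>D\<^esub> a = b \<cdot>\<^bsub>D\<^esub> amap (mfun T) t \<longleftrightarrow> (\<forall>r\<in>Obj J. ?l r = ?r r)"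
  proof
    assume *: "t \<cdot>\<^bsub>D\<^esub> a = b \<cdot>\<^bsub>D\<^esub> amap (mfun T) t"
    show "\<forall>r\<in>Obj J. ?l r = ?r r"
      using arg_cong[OF *, of ncmp] by (auto simp: fun_eq_iff restrict_def split: if_splits)
  next
    assume "\<forall>r\<in>Obj J. ?l r = ?r r"
    then show "t \<cdot>\<^bsub>D\<^esub> a = b \<cdot>\<^bsub>D\<^esub> amap (mfun T) t"
      using mk_ntr_cong[of "ids J" ?l ?r "nsrc a" "ntgt t"] a' t Tt by simp
  qed
  also have "\<dots> \<longleftrightarrow> (\<forall>f\<in>Arr J. ncmp t (Cod J f) \<cdot> act a f = act b f \<cdot> ncmp t (Dom J f))"
  proof
    assume "\<forall>r\<in>Obj J. ?l r = ?r r"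
    then show "\<forall>f\<in>Arr J. ncmp t (Cod J f) \<cdot> act a f = act b f \<cdot> ncmp t (Dom J f)"
      using l r by simp
  next
    assume *: "\<forall>f\<in>Arr J. ncmp t (Cod J f) \<cdot> act a f = act b f \<cdot> ncmp t (Dom J f)"
    show "\<forall>r\<in>Obj J. ?l r = ?r r"
    proof
      fix r' assume r': "r' \<in> Obj J"
      show "?l r' = ?r r'"
      proof (rule lan_eqI[OF X])
        fix f assume f: "f \<in> Arr J" "Cod J f = r'"
        show "?l r' \<cdot> lan_in J M (ntgt a) r' f = ?r r' \<cdot> lan_in J M (ntgt a) r' f"
          using l[OF f(1)] r[OF f(1)] bspec[OF * f(1)] f(2) by simp
      qed (use r' a' b' t Tt in simp_all)
    qed
  qed
  finally show ?thesis .
qed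

text \<open>The unit law picks out the summand of the identity. For associativity,
  \<open>commutes_iff\<close> with \<open>a\<close> in the role of \<open>t\<close> gives one
  equation of maps out of a coproduct for each \<open>g\<close>; comparing its summands
  \<open>f\<close> yields preservation of composites.\<close>

lemma is_algebra_iff:
  assumes a: "a \<in> actions"
  shows "is_algebra D T (ntgt a) a \<longleftrightarrow>
    (\<forall>x\<in>Obj J. act a (Id J x) = Id M (omap (ntgt a) x)) \<and>
    (\<forall>f\<in>Arr J. \<forall>g\<in>Arr J. Cod J f = Dom J g \<longrightarrow> act a (g \<cdot>\<^bsub>J\<^esub> f) = act a g \<cdot> act a f)"
proof -
  have a': "is_ntr (ids J) M a" "nsrc a = free (ntgt a)" using a by (simp_all add: actions_def)
  note X = ntr_tgt[OF a'(1)]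
  note unit = unit_T[OF X]
  have "a \<cdot>\<^bsub>D\<^esub> munit T (ntgt a) = Id D (ntgt a) \<longleftrightarrow> (\<forall>x\<in>Obj J. act a (Id J x) = Id M (omap (ntgt a) x))"
  proof -
    let ?l = "\<lambda>x. ncmp a x \<cdot> ncmp (munit T (ntgt a)) x" and ?r = "\<lambda>x. Id M (omap (ntgt a) x)"
    have "a \<cdot>\<^bsub>D\<^esub> munit T (ntgt a) = Id D (ntgt a) \<longleftrightarrow> (\<forall>x\<in>Obj J. ?l x = ?r x)"
    proof
      assume *: "a \<cdot>\<^bsub>D\<^esub> munit T (ntgt a) = Id D (ntgt a)"
      show "\<forall>x\<in>Obj J. ?l x = ?r x"
        using arg_cong[OF *, of ncmp] by (auto simp: fun_eq_iff restrict_def split: if_splits)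
    next
      assume "\<forall>x\<in>Obj J. ?l x = ?r x"
      then show "a \<cdot>\<^bsub>D\<^esub> munit T (ntgt a) = Id D (ntgt a)"
        using mk_ntr_cong[of "ids J" ?l ?r "ntgt a" "ntgt a"] unit by simp
    qed
    then show ?thesis by (simp add: unit act_def)
  qed
  moreover have "a \<cdot>\<^bsub>D\<^esub> mmult T (ntgt a) = a \<cdot>\<^bsub>D\<^esub> amap (mfun T) a \<longleftrightarrow>
    (\<forall>f\<in>Arr J. \<forall>g\<in>Arr J. Cod J f = Dom J g \<longrightarrow> act a (g \<cdot>\<^bsub>J\<^esub> f) = act a g \<cdot> act a f)"
  proof -
    note m = mult_T[OF X]
    note L = functor_lan_ob[OF X]
    have b: "alg (lan_ob J M (ntgt a)) \<in> actions" by (rule alg_actions[OF L])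
    have bt: "ntgt (alg (lan_ob J M (ntgt a))) = free (ntgt a)" using alg(3)[OF L] by (simp add: free_def)
    have "a \<cdot>\<^bsub>D\<^esub> mmult T (ntgt a) = a \<cdot>\<^bsub>D\<^esub> amap (mfun T) a \<longleftrightarrow>
      (\<forall>g\<in>Arr J. ncmp a (Cod J g) \<cdot> act (alg (lan_ob J M (ntgt a))) g = act a g \<cdot> ncmp a (Dom J g))"
      unfolding m by (rule commutes_iff[OF b a a'(1)]) (use a' bt in simp_all)
    also have "\<dots> \<longleftrightarrow> (\<forall>g\<in>Arr J. \<forall>f\<in>Arr J. Cod J f = Dom J g \<longrightarrow> act a (g \<cdot>\<^bsub>J\<^esub> f) = act a g \<cdot> act a f)"
    proof (rule ball_cong[OF refl])
      fix g assume g: "g \<in> Arr J"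
      let ?l = "ncmp a (Cod J g) \<cdot> amap (lan_ob J M (ntgt a)) g" and ?r = "act a g \<cdot> ncmp a (Dom J g)"
      note Lg = amap_lan_ob[OF X g]
      have l: "?l \<cdot> lan_in J M (ntgt a) (Dom J g) f = act a (g \<cdot>\<^bsub>J\<^esub> f)" if f: "f \<in> Arr J" "Cod J f = Dom J g" for f
        using f g Lg(1-3) Lg(4)[OF f] lan_in[OF X f] a' by (simp add: act_def)
      have r: "?r \<cdot> lan_in J M (ntgt a) (Dom J g) f = act a g \<cdot> act a f" if f: "f \<in> Arr J" "Cod J f = Dom J g" for f
        using f g act[OF a g] lan_in[OF X f] a' by (simp add: act_def[of a f])
      have "?l = ?r \<longleftrightarrow> (\<forall>f\<in>Arr J. Cod J f = Dom J g \<longrightarrow> act a (g \<cdot>\<^bsub>J\<^esub> f) = act a g \<cdot> act a f)"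
      proof
        assume "?l = ?r" then show "\<forall>f\<in>Arr J. Cod J f = Dom J g \<longrightarrow> act a (g \<cdot>\<^bsub>J\<^esub> f) = act a g \<cdot> act a f"
          using l r by metis
      next
        assume *: "\<forall>f\<in>Arr J. Cod J f = Dom J g \<longrightarrow> act a (g \<cdot>\<^bsub>J\<^esub> f) = act a g \<cdot> act a f"
        show "?l = ?r"
        proof (rule lan_eqI[OF X])
          fix f assume f: "f \<in> Arr J" "Cod J f = Dom J g"
          show "?l \<cdot> lan_in J M (ntgt a) (Dom J g) f = ?r \<cdot> lan_in J M (ntgt a) (Dom J g) f"
            unfolding l[OF f] r[OF f] using * f by simp
        qed (use Lg a' g act[OF a g] in simp_all)
      qed
      then show "(ncmp a (Cod J g) \<cdot> act (alg (lan_ob J M (ntgt a))) g = act a g \<cdot> ncmp a (Dom J g)) \<longleftrightarrow>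
        (\<forall>f\<in>Arr J. Cod J f = Dom J g \<longrightarrow> act a (g \<cdot>\<^bsub>J\<^esub> f) = act a g \<cdot> act a f)"
        using act_alg[OF L g] by simp
    qed
    finally show ?thesis by blast
  qed
  ultimately show ?thesis
    using a' X by (simp add: is_algebra_def in_hom omap_T)
qed

lemma algebra_actions: "is_algebra D T X a \<Longrightarrow> a \<in> actions \<and> ntgt a = X"
  by (auto simp: is_algebra_def in_hom actions_def omap_T)

end

section \<open>Coalgebras of the comonad, obtained from algebras by duality\<close>

section \<open>Coalgebras over the comonad of a category of diagrams\<close>

lemma in_arrs_opp [simp]: "in_arrs (opp J) = out_arrs J"
  by (simp add: in_arrs_def out_arrs_def fun_eq_iff)

lemma ran_at_opp: "lan_at (opp J) (opp M) X r = ran_at J M X r"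
  and ran_pr_opp: "lan_in (opp J) (opp M) X r = ran_pr J M X r"
  and ran_tuple_opp: "lan_cotuple (opp J) (opp M) X r = ran_tuple J M X r"
  by (simp_all add: product_opp product_pr_opp tuple_opp)

lemma ran_ob_opp: "lan_ob (opp J) (opp M) X = ran_ob J M X"
  unfolding lan_ob_def ran_ob_def by (simp add: product_opp product_pr_opp tuple_opp)

lemma fun_cat_comp_opp: "opp_ntr (t \<cdot>\<^bsub>fun_cat J C\<^esub> s) = opp_ntr s \<cdot>\<^bsub>fun_cat (opp J) (opp C)\<^esub> opp_ntr t"
  by simp

lemma amap_ran:
  assumes "is_ntr (ids J) M t"
  shows "amap (ran J M) t = opp_ntr (amap (lan (opp J) (opp M)) (opp_ntr t))"
proof -
  have "is_ntr (ids (opp J)) (opp M) (opp_ntr t)" using assms by (simp add: ids_opp)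
  then show ?thesis
    using assms unfolding lan_def ran_def
    by (simp add: ran_ob_opp) (simp add: product_opp product_pr_opp tuple_opp)
qed

text \<open>The comonad for \<open>J\<close> and \<open>M\<close> is the monad for
  \<open>opp J\<close> and \<open>opp M\<close> with natural transformations reversed. The facts
  below are carried over along this correspondence.\<close>

locale cofree_diagrams = J: category J + M: complete_category M U
  for J :: "('u::infinite, 'u) cat" and M :: "('o, 'm) cat" (structure) and U :: "'u itself"
begin

sublocale opp: free_diagrams "opp J" "opp M" U
  by (intro free_diagrams.intro category_opp J.category_axioms M.opp.cocomplete_category_axioms)

abbreviation "D \<equiv> fun_cat (ids J) M"
abbreviation "K \<equiv> inverse_comonad J M"

definition cofree :: "('u, 'u, 'o, 'm) ftor \<Rightarrow> ('u, 'u, 'o, 'm) ftor" where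
  "cofree X = restr_diag (ids J) (ran_ob J M X)"

lemma opp_free: "opp.free X = cofree X"
  by (simp add: opp.free_def cofree_def ids_opp ran_ob_opp)

lemma functor_cofree: "is_functor (ids J) M X \<Longrightarrow> is_functor (ids J) M (cofree X)"
  using opp.functor_free[of X] by (simp add: ids_opp opp_free)

lemma omap_cofree [simp]: "r \<in> Obj J \<Longrightarrow> omap (cofree X) r = ran_at J M X r"
  by (simp add: cofree_def ran_ob_def)

lemma ran_at_Obj: "is_functor (ids J) M X \<Longrightarrow> ran_at J M X r \<in> Obj M"
  using opp.lan_at_Obj[of X r] unfolding ids_opp ran_at_opp by simp

lemma ran_pr:
  assumes "is_functor (ids J) M X" "g \<in> Arr J" "Dom J g = r"
  shows "ran_pr J M X r g \<in> Arr M" "Dom M (ran_pr J M X r g) = ran_at J M X r"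
    "Cod M (ran_pr J M X r g) = omap X (Cod J g)"
  using opp.lan_in[of X g r] assms unfolding ids_opp ran_at_opp ran_pr_opp by simp_all

lemma ran_tuple:
  assumes X: "is_functor (ids J) M X" and c: "c \<in> Obj M"
    and l: "\<And>g. \<lbrakk>g \<in> Arr J; Dom J g = r\<rbrakk> \<Longrightarrow> l g \<in> Arr M \<and> Cod M (l g) = omap X (Cod J g) \<and> Dom M (l g) = c"
  shows "ran_tuple J M X r c l \<in> Arr M" "Cod M (ran_tuple J M X r c l) = ran_at J M X r"
    "Dom M (ran_tuple J M X r c l) = c"
    "\<lbrakk>g \<in> Arr J; Dom J g = r\<rbrakk> \<Longrightarrow> ran_pr J M X r g \<cdot> ran_tuple J M X r c l = l g"
  using opp.lan_cotuple[of X c r l] assms unfolding ids_opp ran_at_opp ran_pr_opp ran_tuple_opp by simp_all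

lemma ran_eqI:
  assumes "is_functor (ids J) M X" "h \<in> Arr M" "Cod M h = ran_at J M X r" "h' \<in> Arr M" "Cod M h' = ran_at J M X r"
    and "Dom M h = Dom M h'"
    and "\<And>g. \<lbrakk>g \<in> Arr J; Dom J g = r\<rbrakk> \<Longrightarrow> ran_pr J M X r g \<cdot> h = ran_pr J M X r g \<cdot> h'"
  shows "h = h'"
  using opp.lan_eqI[of X h r h'] assms unfolding ids_opp ran_at_opp ran_pr_opp by simp

lemma omap_K:
  assumes "is_functor (ids J) M X"
  shows "omap (cfun K) X = cofree X"
proof -
  have "is_functor J M (ran_ob J M X)"
    using opp.functor_lan_ob[of X] assms by (simp add: ids_opp ran_ob_opp)
  then show ?thesis
    using assms by (simp add: inverse_comonad_def adj_comonad_def comp_functor_def ran_def omap_restriction cofree_def)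
qed

lemma amap_K_opp:
  assumes t: "is_ntr (ids J) M t"
  shows "amap (cfun K) t = opp_ntr (amap (mfun opp.T) (opp_ntr t))"
proof -
  have t': "is_ntr (ids (opp J)) (opp M) (opp_ntr t)" using t by (simp add: ids_opp)
  have l: "is_ntr (opp J) (opp M) (amap (lan (opp J) (opp M)) (opp_ntr t))" by (rule opp.lan_ntr(1)[OF t'])
  then have "is_ntr J M (amap (ran J M) t)"
    using amap_ran[OF t] is_ntr_opp[of "opp J" "opp M"] by simp
  then show ?thesis
    using t t' l
    by (simp add: inverse_comonad_def adj_comonad_def direct_monad_def adj_monad_def comp_functor_def amap_restriction
        ids_opp amap_ran flip: restr_ntr_opp)
qed

lemma amap_K:
  assumes t: "is_ntr (ids J) M t"
  shows "is_ntr (ids J) M (amap (cfun K) t)" (is ?c1) "nsrc (amap (cfun K) t) = cofree (nsrc t)" (is ?c2)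
    "ntgt (amap (cfun K) t) = cofree (ntgt t)" (is ?c3)
    "\<lbrakk>g \<in> Arr J; Dom J g = r\<rbrakk> \<Longrightarrow> ran_pr J M (ntgt t) r g \<cdot> ncmp (amap (cfun K) t) r = ncmp t (Cod J g) \<cdot> ran_pr J M (nsrc t) r g"
proof -
  have "is_ntr (ids (opp J)) (opp M) (opp_ntr t)" using t by (simp add: ids_opp)
  note * = opp.amap_T[OF this, unfolded ran_pr_opp opp_free]
  show ?c1
    using *(1) is_ntr_opp[of "ids (opp J)" "opp M"] by (simp add: amap_K_opp[OF t] ids_opp)
  show ?c2 ?c3
    "\<lbrakk>g \<in> Arr J; Dom J g = r\<rbrakk> \<Longrightarrow> ran_pr J M (ntgt t) r g \<cdot> ncmp (amap (cfun K) t) r = ncmp t (Cod J g) \<cdot> ran_pr J M (nsrc t) r g"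
    using *(2-4) by (simp_all add: amap_K_opp[OF t])
qed

definition coalg :: "('u, 'u, 'o, 'm) ftor \<Rightarrow> ('u, 'u, 'o, 'm) ntr" where
  "coalg \<Psi> = amap (restriction (ids J) J M) (ran_unit J M \<Psi>)"

definition coact :: "('u, 'u, 'o, 'm) ntr \<Rightarrow> 'u \<Rightarrow> 'm" where
  "coact k g = ran_pr J M (nsrc k) (Dom J g) g \<cdot> ncmp k (Dom J g)"

definition coactions :: "('u, 'u, 'o, 'm) ntr set" where
  "coactions = {k. is_ntr (ids J) M k \<and> ntgt k = cofree (nsrc k)}"

lemma coactions_opp: "opp_ntr k \<in> opp.actions \<longleftrightarrow> k \<in> coactions"
  by (simp add: opp.actions_def coactions_def opp_free ids_opp)

lemma coact_opp: "opp.act (opp_ntr k) g = coact k g"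
  unfolding opp.act_def coact_def ran_pr_opp by simp

lemma ran_unit_opp: "ran_unit J M \<Psi> = opp_ntr (lan_counit (opp J) (opp M) \<Psi>)"
  unfolding ran_unit_def lan_counit_def ran_tuple_opp by (simp add: ids_opp ran_ob_opp)

lemma coalg_opp:
  assumes "is_functor J M \<Psi>"
  shows "opp.alg \<Psi> = opp_ntr (coalg \<Psi>)"
proof -
  have c: "is_ntr (opp J) (opp M) (lan_counit (opp J) (opp M) \<Psi>)"
    using opp.counit_ntr[of \<Psi>] assms by simp
  then have "is_ntr J M (ran_unit J M \<Psi>)"
    using is_ntr_opp[of "opp J" "opp M"] by (simp add: ran_unit_opp)
  then show ?thesis
    using c by (simp add: opp.alg_def coalg_def amap_restriction ran_unit_opp ids_opp flip: restr_ntr_opp)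
qed

lemma coalg:
  assumes "is_functor J M \<Psi>"
  shows "coalg \<Psi> \<in> coactions" "nsrc (coalg \<Psi>) = restr_diag (ids J) \<Psi>" (is ?c1)
    "g \<in> Arr J \<Longrightarrow> coact (coalg \<Psi>) g = amap \<Psi> g"
proof -
  show "coalg \<Psi> \<in> coactions"
    using opp.alg_actions[of \<Psi>] assms by (simp add: coalg_opp coactions_opp)
  show ?c1
    using opp.alg(3)[of \<Psi>] assms by (simp add: coalg_opp ids_opp)
  show "g \<in> Arr J \<Longrightarrow> coact (coalg \<Psi>) g = amap \<Psi> g"
    using opp.act_alg[of \<Psi> g] assms by (simp add: coalg_opp coact_opp)
qed

lemma coact:
  assumes "k \<in> coactions" "g \<in> Arr J"
  shows "coact k g \<in> Arr M" "Dom M (coact k g) = omap (nsrc k) (Dom J g)" "Cod M (coact k g) = omap (nsrc k) (Cod J g)"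
  using opp.act[of "opp_ntr k" g] assms by (simp_all add: coactions_opp coact_opp)

lemma coactions_eqI:
  assumes "k \<in> coactions" "l \<in> coactions" "nsrc k = nsrc l" "\<And>g. g \<in> Arr J \<Longrightarrow> coact k g = coact l g"
  shows "k = l"
  using opp.actions_eqI[of "opp_ntr k" "opp_ntr l"] assms by (simp add: coactions_opp coact_opp)

lemma cocommutes_iff:
  assumes "k \<in> coactions" "l \<in> coactions" "is_ntr (ids J) M t" "nsrc t = nsrc k" "ntgt t = nsrc l"
  shows "l \<cdot>\<^bsub>D\<^esub> t = amap (cfun K) t \<cdot>\<^bsub>D\<^esub> k \<longleftrightarrow>
    (\<forall>g\<in>Arr J. coact l g \<cdot> ncmp t (Dom J g) = ncmp t (Cod J g) \<cdot> coact k g)"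
proof -
  have "l \<cdot>\<^bsub>D\<^esub> t = amap (cfun K) t \<cdot>\<^bsub>D\<^esub> k \<longleftrightarrow> opp_ntr (l \<cdot>\<^bsub>D\<^esub> t) = opp_ntr (amap (cfun K) t \<cdot>\<^bsub>D\<^esub> k)"
    by (simp only: opp_ntr_eq_iff)
  also have "\<dots> \<longleftrightarrow> opp_ntr t \<cdot>\<^bsub>opp.D\<^esub> opp_ntr l = opp_ntr k \<cdot>\<^bsub>opp.D\<^esub> amap (mfun opp.T) (opp_ntr t)"
    unfolding fun_cat_comp_opp ids_opp amap_K_opp[OF assms(3)] opp_ntr_simps(4) ..
  also have "\<dots> \<longleftrightarrow> (\<forall>g\<in>Arr J. coact l g \<cdot> ncmp t (Dom J g) = ncmp t (Cod J g) \<cdot> coact k g)"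
    using assms by (subst opp.commutes_iff) (simp_all add: coactions_opp coact_opp ids_opp)
  finally show ?thesis .
qed

text \<open>\<open>opp_ntr\<close> reverses composition and exchanges unit with counit and
  multiplication with comultiplication, so the axioms correspond one by one. If \<open>X\<close> or
  \<open>k\<close> has the wrong kind, both sides are false.\<close>

lemma is_coalgebra_opp:
  "is_coalgebra D K X k \<longleftrightarrow> is_algebra opp.D opp.T X (opp_ntr k)"
proof (cases "is_functor (ids J) M X \<and> is_ntr (ids J) M k")
  case True
  then have X: "is_functor (ids J) M X" and k: "is_ntr (ids J) M k" by auto
  have X': "is_functor (ids (opp J)) (opp M) X" using X by (simp add: ids_opp)
  have "is_functor J M (ran_ob J M X)"
    using opp.functor_lan_ob[OF X'] by (simp add: ran_ob_opp)
  then have mult: "ccomult K X = opp_ntr (mmult opp.T X)"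
    using X by (simp add: opp.mult_T[OF X'] inverse_comonad_def adj_comonad_def ran_def ran_ob_opp coalg_opp)
      (simp add: coalg_def)
  have unit: "ccounit K X = opp_ntr (munit opp.T X)"
    unfolding inverse_comonad_def adj_comonad_def direct_monad_def adj_monad_def ran_counit_def lan_unit_def ran_pr_opp ran_ob_opp
    by (simp add: ids_opp)
  have *: "s \<cdot>\<^bsub>D\<^esub> t = s' \<cdot>\<^bsub>D\<^esub> t' \<longleftrightarrow> opp_ntr t \<cdot>\<^bsub>opp.D\<^esub> opp_ntr s = opp_ntr t' \<cdot>\<^bsub>opp.D\<^esub> opp_ntr s'" for s t s' t'
    unfolding ids_opp fun_cat_comp_opp[symmetric] opp_ntr_eq_iff ..
  have **: "s \<cdot>\<^bsub>D\<^esub> t = Id D X \<longleftrightarrow> opp_ntr t \<cdot>\<^bsub>opp.D\<^esub> opp_ntr s = Id opp.D X" for s t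
    unfolding ids_opp fun_cat_comp_opp[symmetric] by simp
  show ?thesis
    unfolding is_coalgebra_def is_algebra_def * ** mult unit amap_K_opp[OF k] opp_ntr_simps(4)
    using X X' k by (auto simp: in_hom omap_K opp.omap_T opp_free ids_opp)
next
  case False
  then show ?thesis
    by (auto simp: is_coalgebra_def is_algebra_def in_hom ids_opp)
qed

lemma is_coalgebra_iff:
  assumes "k \<in> coactions"
  shows "is_coalgebra D K (nsrc k) k \<longleftrightarrow>
    (\<forall>x\<in>Obj J. coact k (Id J x) = Id M (omap (nsrc k) x)) \<and>
    (\<forall>f\<in>Arr J. \<forall>g\<in>Arr J. Cod J f = Dom J g \<longrightarrow> coact k (g \<cdot>\<^bsub>J\<^esub> f) = coact k g \<cdot> coact k f)"
  using opp.is_algebra_iff[of "opp_ntr k"] assms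
  unfolding is_coalgebra_opp coactions_opp coact_opp by (simp add: eq_commute) blast

lemma coalgebra_coactions: "is_coalgebra D K X k \<Longrightarrow> k \<in> coactions \<and> nsrc k = X"
  using opp.algebra_actions[of X "opp_ntr k"] by (simp add: is_coalgebra_opp coactions_opp)

end

section \<open>The distributive law and the bialgebra law in components\<close>

section \<open>Reedy diagrams as bialgebras\<close>

locale reedy_diagrams = M: cocomplete_category M U + M: complete_category M U
  for M :: "('o, 'm) cat" (structure) and U :: "'u::infinite itself" +
  fixes R :: "('u, 'u) cat" and d :: "'u \<Rightarrow> nat" and P N :: "'u set"
  assumes reedy: "reedy_category R d P N"
begin

sublocale R: category R
  using reedy by (simp add: reedy_category_def)

lemma wide_P: "wide_subcategory R P" and wide_N: "wide_subcategory R N"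
  using reedy by (simp_all add: reedy_category_def)

lemma P_Arr [simp]: "f \<in> P \<Longrightarrow> f \<in> Arr R" and N_Arr [simp]: "f \<in> N \<Longrightarrow> f \<in> Arr R"
  using wide_P wide_N by (auto simp: wide_subcategory_def)

lemma Id_P [simp]: "x \<in> Obj R \<Longrightarrow> Id R x \<in> P" and Id_N [simp]: "x \<in> Obj R \<Longrightarrow> Id R x \<in> N"
  using wide_P wide_N by (auto simp: wide_subcategory_def)

lemma comp_P [simp]: "\<lbrakk>f \<in> P; g \<in> P; Cod R f = Dom R g\<rbrakk> \<Longrightarrow> g \<cdot>\<^bsub>R\<^esub> f \<in> P"
  and comp_N [simp]: "\<lbrakk>f \<in> N; g \<in> N; Cod R f = Dom R g\<rbrakk> \<Longrightarrow> g \<cdot>\<^bsub>R\<^esub> f \<in> N"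
  using wide_P wide_N by (auto simp: wide_subcategory_def)

abbreviation "Rp \<equiv> wide R P"
abbreviation "Rn \<equiv> wide R N"
abbreviation "D \<equiv> fun_cat (ids R) M"
abbreviation "factor \<equiv> reedy_factor R P N"

text \<open>The rewriting of \<open>ids Rp\<close>, and likewise of \<open>ids Rn\<close>, to
  \<open>ids R\<close> makes monad and comonad live on literally the same functor category.\<close>

sublocale F: free_diagrams Rp M U
  rewrites "ids Rp = ids R"
  by (intro free_diagrams.intro category_wide R.category_axioms wide_P M.cocomplete_category_axioms) (rule ids_wide)

sublocale G: cofree_diagrams Rn M U
  rewrites "ids Rn = ids R"
  by (intro cofree_diagrams.intro category_wide R.category_axioms wide_N M.complete_category_axioms) (rule ids_wide)

lemma unique_factor: "f \<in> Arr R \<Longrightarrow> \<exists>!(i, q). i \<in> P \<and> q \<in> N \<and> Cod R q = Dom R i \<and> f = i \<cdot>\<^bsub>R\<^esub> q"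
  using reedy by (simp add: reedy_category_def)

lemma factorE:
  assumes "f \<in> Arr R"
  obtains i q where "factor f = (i, q)" "i \<in> P" "q \<in> N" "Cod R q = Dom R i" "f = i \<cdot>\<^bsub>R\<^esub> q"
    "Dom R q = Dom R f" "Cod R i = Cod R f"
proof -
  have *: "case factor f of (i, q) \<Rightarrow> i \<in> P \<and> q \<in> N \<and> Cod R q = Dom R i \<and> f = i \<cdot>\<^bsub>R\<^esub> q"
    unfolding reedy_factor_def by (rule theI'[OF unique_factor[OF assms]])
  obtain i q where "factor f = (i, q)" by (cases "factor f")
  with * show ?thesis by (intro that[of i q]) auto
qed

lemma factor_eq:
  assumes "i \<in> P" "q \<in> N" "Cod R q = Dom R i"
  shows "factor (i \<cdot>\<^bsub>R\<^esub> q) = (i, q)"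
proof -
  have f: "i \<cdot>\<^bsub>R\<^esub> q \<in> Arr R" using assms by simp
  show ?thesis
    unfolding reedy_factor_def by (rule the1_equality[OF unique_factor[OF f]]) (use assms in simp)
qed

lemma factor_P: "f \<in> P \<Longrightarrow> factor f = (f, Id R (Dom R f))"
  using factor_eq[of f "Id R (Dom R f)"] by simp

lemma factor_N: "f \<in> N \<Longrightarrow> factor f = (Id R (Cod R f), f)"
  using factor_eq[of "Id R (Cod R f)" f] by simp

lemma dist_law:
  fixes X
  defines "\<chi> \<equiv> reedy_dist_law R P N M X"
  assumes X: "is_functor (ids R) M X"
  shows "is_ntr (ids R) M \<chi>" "nsrc \<chi> = F.free (G.cofree X)" (is ?c1) "ntgt \<chi> = G.cofree (F.free X)" (is ?c2)
    and "\<lbrakk>f \<in> P; g \<in> N; Cod R f = Dom R g; factor (g \<cdot>\<^bsub>R\<^esub> f) = (i, q)\<rbrakk> \<Longrightarrow>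
      ran_pr Rn M (F.free X) (Dom R g) g \<cdot> (ncmp \<chi> (Dom R g) \<cdot> lan_in Rp M (G.cofree X) (Dom R g) f) =
      lan_in Rp M X (Cod R g) i \<cdot> ran_pr Rn M X (Dom R f) q"
proof -
  note T = F.functor_free[OF X] and K = G.functor_cofree[OF X]
  \<comment> \<open>\<open>e f g\<close> is the matrix entry of the law from the summand
    \<open>f\<close> to the factor \<open>g\<close>.\<close>
  define e where "e f g = (let (i, q) = factor (g \<cdot>\<^bsub>R\<^esub> f) in lan_in Rp M X (Cod R g) i \<cdot> ran_pr Rn M X (Dom R f) q)" for f g
  let ?t = "\<lambda>r f. ran_tuple Rn M (F.free X) r (omap (G.cofree X) (Dom R f)) (e f)"
  let ?c = "\<lambda>r. lan_cotuple Rp M (G.cofree X) r (ran_at Rn M (F.free X) r) (?t r)"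
  have \<chi>: "\<chi> = mk_ntr (ids R) (F.free (G.cofree X)) (G.cofree (F.free X)) ?c"
    by (simp add: \<chi>_def reedy_dist_law_def F.omap_T[OF X] F.omap_T[OF K] G.omap_K[OF X] G.omap_K[OF T] e_def[abs_def] Let_def)
  have e: "e f g \<in> Arr M \<and> Cod M (e f g) = omap (F.free X) (Cod R g) \<and> Dom M (e f g) = omap (G.cofree X) (Dom R f)"
    if fg: "f \<in> P" "g \<in> N" "Cod R f = Dom R g" for f g
  proof -
    have gf: "g \<cdot>\<^bsub>R\<^esub> f \<in> Arr R" "Dom R (g \<cdot>\<^bsub>R\<^esub> f) = Dom R f" "Cod R (g \<cdot>\<^bsub>R\<^esub> f) = Cod R g" using fg by simp_all
    obtain i q where "factor (g \<cdot>\<^bsub>R\<^esub> f) = (i, q)" "i \<in> P" "q \<in> N" "Cod R q = Dom R i" "Dom R q = Dom R f" "Cod R i = Cod R g"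
      by (rule factorE[OF gf(1)]) (use gf in simp)
    then show ?thesis
      using F.lan_in[OF X, of i "Cod R g"] G.ran_pr[OF X, of q "Dom R f"] fg by (simp add: e_def)
  qed
  have t: "?t r f \<in> Arr M \<and> Dom M (?t r f) = omap (G.cofree X) (Dom R f) \<and> Cod M (?t r f) = ran_at Rn M (F.free X) r"
    "\<And>g. \<lbrakk>g \<in> N; Dom R g = r\<rbrakk> \<Longrightarrow> ran_pr Rn M (F.free X) r g \<cdot> ?t r f = e f g"
    if f: "f \<in> P" "Cod R f = r" for r f
  proof -
    have c: "omap (G.cofree X) (Dom R f) \<in> Obj M" using f G.ran_at_Obj[OF X, of "Dom R f"] by simp
    have e': "\<And>g. \<lbrakk>g \<in> Arr Rn; Dom Rn g = r\<rbrakk> \<Longrightarrow>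
      e f g \<in> Arr M \<and> Cod M (e f g) = omap (F.free X) (Cod Rn g) \<and> Dom M (e f g) = omap (G.cofree X) (Dom R f)"
      using e f by simp
    note t = G.ran_tuple[OF T c e']
    show "?t r f \<in> Arr M \<and> Dom M (?t r f) = omap (G.cofree X) (Dom R f) \<and> Cod M (?t r f) = ran_at Rn M (F.free X) r"
      using t(1-3) by blast
    show "ran_pr Rn M (F.free X) r g \<cdot> ?t r f = e f g" if "g \<in> N" "Dom R g = r" for g
      by (rule t(4)) (use that in simp_all)
  qed
  have c: "?c r \<in> Arr M" "Dom M (?c r) = lan_at Rp M (G.cofree X) r" "Cod M (?c r) = ran_at Rn M (F.free X) r"
    "\<And>f. \<lbrakk>f \<in> P; Cod R f = r\<rbrakk> \<Longrightarrow> ?c r \<cdot> lan_in Rp M (G.cofree X) r f = ?t r f" for r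
  proof -
    have t': "\<And>f. \<lbrakk>f \<in> Arr Rp; Cod Rp f = r\<rbrakk> \<Longrightarrow> ?t r f \<in> Arr M \<and> Dom M (?t r f) = omap (G.cofree X) (Dom Rp f) \<and>
        Cod M (?t r f) = ran_at Rn M (F.free X) r"
      using t(1)[of _ r] by simp
    note c = F.lan_cotuple[OF K G.ran_at_Obj[OF T] t']
    show "?c r \<in> Arr M" "Dom M (?c r) = lan_at Rp M (G.cofree X) r" "Cod M (?c r) = ran_at Rn M (F.free X) r"
      using c(1-3) by blast+
    show "?c r \<cdot> lan_in Rp M (G.cofree X) r f = ?t r f" if "f \<in> P" "Cod R f = r" for f
      by (rule c(4)) (use that in simp_all)
  qed
  show "is_ntr (ids R) M \<chi>"
    unfolding \<chi>
  proof (rule mk_ntr_ids[OF R.category_axioms M.category_axioms F.functor_free[OF K] G.functor_cofree[OF T]])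
    fix r assume "r \<in> Obj R"
    then show "?c r \<in> Arr M \<and> Dom M (?c r) = omap (F.free (G.cofree X)) r \<and> Cod M (?c r) = omap (G.cofree (F.free X)) r"
      using c(1-3)[of r] by simp
  qed
  show ?c1 ?c2
    by (simp_all add: \<chi>)
  assume *: "f \<in> P" "g \<in> N" "Cod R f = Dom R g" "factor (g \<cdot>\<^bsub>R\<^esub> f) = (i, q)"
  have "ncmp \<chi> (Dom R g) = ?c (Dom R g)" using * by (simp add: \<chi>)
  then show "ran_pr Rn M (F.free X) (Dom R g) g \<cdot> (ncmp \<chi> (Dom R g) \<cdot> lan_in Rp M (G.cofree X) (Dom R g) f) =
      lan_in Rp M X (Cod R g) i \<cdot> ran_pr Rn M X (Dom R f) q"
    using c(4)[OF *(1,3)] t(2)[OF *(1,3,2) refl] *(4) by (simp only:) (simp add: e_def)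
qed

text \<open>At each object both sides of the law map a coproduct indexed by \<open>P\<close> to a
  product indexed by \<open>N\<close>, so they are matrices and can be compared entry by
  entry.\<close>

lemma bialgebra_law_iff:
  assumes a: "a \<in> F.actions" "ntgt a = X" and k: "k \<in> G.coactions" "nsrc k = X"
  shows "k \<cdot>\<^bsub>D\<^esub> a = amap (cfun G.K) a \<cdot>\<^bsub>D\<^esub> (reedy_dist_law R P N M X \<cdot>\<^bsub>D\<^esub> amap (mfun F.T) k) \<longleftrightarrow>
    (\<forall>f\<in>P. \<forall>g\<in>N. Cod R f = Dom R g \<longrightarrow>
       (case factor (g \<cdot>\<^bsub>R\<^esub> f) of (i, q) \<Rightarrow> G.coact k g \<cdot> F.act a f = F.act a i \<cdot> G.coact k q))"
proof -
  let ?\<chi> = "reedy_dist_law R P N M X"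
  have a': "is_ntr (ids R) M a" "nsrc a = F.free X" using a by (simp_all add: F.actions_def)
  have k': "is_ntr (ids R) M k" "ntgt k = G.cofree X" using k by (simp_all add: G.coactions_def)
  have X: "is_functor (ids R) M X" using ntr_tgt[OF a'(1)] a by simp
  note T = F.functor_free[OF X] and K = G.functor_cofree[OF X]
  note \<chi> = dist_law[OF X]
  note Tk = F.amap_T[OF k'(1), unfolded k(2) k'(2)] and Ka = G.amap_K[OF a'(1), unfolded a(2) a'(2)]
  let ?l = "\<lambda>r. ncmp k r \<cdot> ncmp a r"
  let ?r = "\<lambda>r. ncmp (amap (cfun G.K) a) r \<cdot> (ncmp ?\<chi> r \<cdot> ncmp (amap (mfun F.T) k) r)"
  have lr: "?l r \<in> Arr M" "Dom M (?l r) = lan_at Rp M X r" "Cod M (?l r) = ran_at Rn M X r"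
    "?r r \<in> Arr M" "Dom M (?r r) = lan_at Rp M X r" "Cod M (?r r) = ran_at Rn M X r" if "r \<in> Obj R" for r
    using that a a' k k' \<chi>(1-3) Tk(1-3) Ka(1-3) by simp_all
  have "k \<cdot>\<^bsub>D\<^esub> a = amap (cfun G.K) a \<cdot>\<^bsub>D\<^esub> (?\<chi> \<cdot>\<^bsub>D\<^esub> amap (mfun F.T) k) \<longleftrightarrow> (\<forall>r\<in>Obj R. ?l r = ?r r)"
  proof
    assume *: "k \<cdot>\<^bsub>D\<^esub> a = amap (cfun G.K) a \<cdot>\<^bsub>D\<^esub> (?\<chi> \<cdot>\<^bsub>D\<^esub> amap (mfun F.T) k)"
    show "\<forall>r\<in>Obj R. ?l r = ?r r"
    proof
      fix r assume "r \<in> Obj R"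
      then show "?l r = ?r r" using arg_cong[OF *, of "\<lambda>t. ncmp t r"] by simp
    qed
  next
    assume *: "\<forall>r\<in>Obj R. ?l r = ?r r"
    have "mk_ntr (ids R) (F.free X) (G.cofree X) (\<lambda>r. ncmp k r \<cdot> ncmp a r) =
        mk_ntr (ids R) (F.free X) (G.cofree X) (\<lambda>r. ncmp (amap (cfun G.K) a) r \<cdot>
          restrict (\<lambda>x. ncmp ?\<chi> x \<cdot> ncmp (amap (mfun F.T) k) x) (Obj (ids R)) r)"
      by (rule mk_ntr_cong) (use * in simp)
    then show "k \<cdot>\<^bsub>D\<^esub> a = amap (cfun G.K) a \<cdot>\<^bsub>D\<^esub> (?\<chi> \<cdot>\<^bsub>D\<^esub> amap (mfun F.T) k)"
      using a' k' Tk Ka by simp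
  qed
  also have "\<dots> \<longleftrightarrow> (\<forall>r\<in>Obj R. \<forall>f\<in>P. \<forall>g\<in>N. Cod R f = r \<longrightarrow> Dom R g = r \<longrightarrow>
      ran_pr Rn M X r g \<cdot> (?l r \<cdot> lan_in Rp M X r f) = ran_pr Rn M X r g \<cdot> (?r r \<cdot> lan_in Rp M X r f))"
  proof (rule ball_cong[OF refl], rule iffI)
    fix r assume r: "r \<in> Obj R" and *: "\<forall>f\<in>P. \<forall>g\<in>N. Cod R f = r \<longrightarrow> Dom R g = r \<longrightarrow>
      ran_pr Rn M X r g \<cdot> (?l r \<cdot> lan_in Rp M X r f) = ran_pr Rn M X r g \<cdot> (?r r \<cdot> lan_in Rp M X r f)"
    note lr = lr[OF r]
    show "?l r = ?r r"
    \<comment> \<open>Equality is tested first on the inclusions of the coproduct, then on the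
      projections of the product.\<close>
    proof (rule F.lan_eqI[OF X lr(1,2,4,5)])
      fix f assume f: "f \<in> Arr Rp" "Cod Rp f = r"
      note i = F.lan_in[OF X f]
      show "?l r \<cdot> lan_in Rp M X r f = ?r r \<cdot> lan_in Rp M X r f"
      proof (rule G.ran_eqI[OF X])
        fix g assume "g \<in> Arr Rn" "Dom Rn g = r"
        then show "ran_pr Rn M X r g \<cdot> (?l r \<cdot> lan_in Rp M X r f) = ran_pr Rn M X r g \<cdot> (?r r \<cdot> lan_in Rp M X r f)"
          using * f by simp
      qed (use lr i M.comp_Arr[OF i(1) lr(1)] M.comp_Arr[OF i(1) lr(4)] M.Cod_comp[OF i(1) lr(1)] M.Cod_comp[OF i(1) lr(4)]
          M.Dom_comp[OF i(1) lr(1)] M.Dom_comp[OF i(1) lr(4)] in \<open>simp_all only:\<close>)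
    qed (simp only: lr)
  qed simp
  also have "\<dots> \<longleftrightarrow> (\<forall>f\<in>P. \<forall>g\<in>N. Cod R f = Dom R g \<longrightarrow>
       (case factor (g \<cdot>\<^bsub>R\<^esub> f) of (i, q) \<Rightarrow> G.coact k g \<cdot> F.act a f = F.act a i \<cdot> G.coact k q))"
  proof -
    have "(ran_pr Rn M X (Dom R g) g \<cdot> (?l (Dom R g) \<cdot> lan_in Rp M X (Dom R g) f) =
        ran_pr Rn M X (Dom R g) g \<cdot> (?r (Dom R g) \<cdot> lan_in Rp M X (Dom R g) f)) \<longleftrightarrow>
      (case factor (g \<cdot>\<^bsub>R\<^esub> f) of (i, q) \<Rightarrow> G.coact k g \<cdot> F.act a f = F.act a i \<cdot> G.coact k q)"
      if fg: "f \<in> P" "g \<in> N" "Cod R f = Dom R g" for f g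
    proof -
      let ?s = "Dom R g"
      have s: "?s \<in> Obj R" "Cod R g \<in> Obj R" "Dom R f \<in> Obj R" using fg by simp_all
      have fW: "f \<in> Arr Rp" "Cod Rp f = ?s" and gW: "g \<in> Arr Rn" "Dom Rn g = ?s" using fg by simp_all
      note i = F.lan_in[OF X fW, simplified] and p = G.ran_pr[OF X gW, simplified]
        and i' = F.lan_in[OF K fW, simplified] and p' = G.ran_pr[OF T gW, simplified]
      have gf: "g \<cdot>\<^bsub>R\<^esub> f \<in> Arr R" "Dom R (g \<cdot>\<^bsub>R\<^esub> f) = Dom R f" "Cod R (g \<cdot>\<^bsub>R\<^esub> f) = Cod R g" using fg by simp_all
      obtain j q where jq: "factor (g \<cdot>\<^bsub>R\<^esub> f) = (j, q)" "j \<in> P" "q \<in> N" "Cod R q = Dom R j" "Dom R q = Dom R f" "Cod R j = Cod R g"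
        by (rule factorE[OF gf(1)]) (use gf in simp)
      have jW: "j \<in> Arr Rp" "Cod Rp j = Cod R g" and qW: "q \<in> Arr Rn" "Dom Rn q = Dom R f" using jq by simp_all
      note ij = F.lan_in[OF X jW, simplified] and pq = G.ran_pr[OF X qW, simplified]
      have "ran_pr Rn M X ?s g \<cdot> (?l ?s \<cdot> lan_in Rp M X ?s f) = G.coact k g \<cdot> F.act a f"
        using s a a' k k' i p fg by (simp add: G.coact_def F.act_def)
      moreover have "ran_pr Rn M X ?s g \<cdot> (?r ?s \<cdot> lan_in Rp M X ?s f) = F.act a j \<cdot> G.coact k q"
      proof -
        have Ka_s: "ncmp (amap (cfun G.K) a) ?s \<in> Arr M" "Dom M (ncmp (amap (cfun G.K) a) ?s) = ran_at Rn M (F.free X) ?s"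
          "Cod M (ncmp (amap (cfun G.K) a) ?s) = ran_at Rn M X ?s"
          using s Ka(1-3) by simp_all
        have \<chi>_s: "ncmp ?\<chi> ?s \<in> Arr M" "Dom M (ncmp ?\<chi> ?s) = lan_at Rp M (G.cofree X) ?s" "Cod M (ncmp ?\<chi> ?s) = ran_at Rn M (F.free X) ?s"
          using s \<chi>(1-3) by simp_all
        have Tk_s: "ncmp (amap (mfun F.T) k) ?s \<in> Arr M" "Dom M (ncmp (amap (mfun F.T) k) ?s) = lan_at Rp M X ?s"
          "Cod M (ncmp (amap (mfun F.T) k) ?s) = lan_at Rp M (G.cofree X) ?s"
          using s Tk(1-3) by simp_all
        have k_f: "ncmp k (Dom R f) \<in> Arr M" "Dom M (ncmp k (Dom R f)) = omap X (Dom R f)" "Cod M (ncmp k (Dom R f)) = ran_at Rn M X (Dom R f)"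
          using s k k' by simp_all
        have a_g: "ncmp a (Cod R g) \<in> Arr M" "Dom M (ncmp a (Cod R g)) = lan_at Rp M X (Cod R g)" "Cod M (ncmp a (Cod R g)) = omap X (Cod R g)"
          using s a a' by simp_all
        have o: "omap (F.free X) (Cod R g) = lan_at Rp M X (Cod R g)" "omap (G.cofree X) (Dom R f) = ran_at Rn M X (Dom R f)"
          using s by simp_all
        note ar = Ka_s \<chi>_s Tk_s k_f a_g i p i' p' ij pq o jq(4)
        have "ran_pr Rn M X ?s g \<cdot> (?r ?s \<cdot> lan_in Rp M X ?s f) =
          ran_pr Rn M X ?s g \<cdot> (ncmp (amap (cfun G.K) a) ?s \<cdot> (ncmp ?\<chi> ?s \<cdot> (ncmp (amap (mfun F.T) k) ?s \<cdot> lan_in Rp M X ?s f)))"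
          by (simp add: ar)
        \<comment> \<open>The inclusion is moved past the monad applied to \<open>k\<close>, then
          the projection past the comonad applied to \<open>a\<close>; a single entry of the law
          remains in the middle.\<close>
        also have "\<dots> = ran_pr Rn M X ?s g \<cdot> (ncmp (amap (cfun G.K) a) ?s \<cdot> (ncmp ?\<chi> ?s \<cdot> (lan_in Rp M (G.cofree X) ?s f \<cdot> ncmp k (Dom R f))))"
          using Tk(4)[OF fW] by simp
        also have "\<dots> = (ncmp a (Cod R g) \<cdot> ran_pr Rn M (F.free X) ?s g) \<cdot> (ncmp ?\<chi> ?s \<cdot> (lan_in Rp M (G.cofree X) ?s f \<cdot> ncmp k (Dom R f)))"
          using Ka(4)[OF gW] by (intro M.comp_comp_eq) (simp_all add: ar)
        also have "\<dots> = ncmp a (Cod R g) \<cdot> ((ran_pr Rn M (F.free X) ?s g \<cdot> (ncmp ?\<chi> ?s \<cdot> lan_in Rp M (G.cofree X) ?s f)) \<cdot> ncmp k (Dom R f))"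
          by (simp add: ar)
        also have "\<dots> = ncmp a (Cod R g) \<cdot> ((lan_in Rp M X (Cod R g) j \<cdot> ran_pr Rn M X (Dom R f) q) \<cdot> ncmp k (Dom R f))"
          unfolding \<chi>(4)[OF fg jq(1)] ..
        also have "\<dots> = F.act a j \<cdot> G.coact k q"
          by (simp add: F.act_def G.coact_def ar jq a k)
        finally show ?thesis .
      qed
      ultimately show ?thesis using jq(1) by simp
    qed
    note eq = this
    have *: "(\<forall>r\<in>Obj R. \<forall>f\<in>P. \<forall>g\<in>N. Cod R f = r \<longrightarrow> Dom R g = r \<longrightarrow> E r f g) \<longleftrightarrow>
        (\<forall>f\<in>P. \<forall>g\<in>N. Cod R f = Dom R g \<longrightarrow> E (Dom R g) f g)" for E
      by (metis N_Arr R.Dom_Obj)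
    show ?thesis
      unfolding * by (intro ball_cong refl imp_cong eq)
  qed
  finally show ?thesis .
qed

end

section \<open>Bijectivity of the comparison functor on objects and arrows\<close>

lemma bialgebra_cat_simps [simp]:
  "Obj (bialgebra_cat C T K \<chi>) = bialgebras C T K \<chi>"
  "Dom (bialgebra_cat C T K \<chi>) (A, f, B) = A" "Cod (bialgebra_cat C T K \<chi>) (A, f, B) = B"
  "Id (bialgebra_cat C T K \<chi>) A = (A, Id C (fst A), A)"
  "(A', g, B') \<cdot>\<^bsub>bialgebra_cat C T K \<chi>\<^esub> (A, f, B) = (A, g \<cdot>\<^bsub>C\<^esub> f, B')"
  "((X, a, k), f, (Y, b, l)) \<in> Arr (bialgebra_cat C T K \<chi>) \<longleftrightarrow>
    (X, a, k) \<in> bialgebras C T K \<chi> \<and> (Y, b, l) \<in> bialgebras C T K \<chi> \<and>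
    f \<in> hom C X Y \<and> f \<cdot>\<^bsub>C\<^esub> a = b \<cdot>\<^bsub>C\<^esub> amap (mfun T) f \<and> l \<cdot>\<^bsub>C\<^esub> f = amap (cfun K) f \<cdot>\<^bsub>C\<^esub> k"
  by (simp_all add: bialgebra_cat_def)

context reedy_diagrams
begin

abbreviation "\<chi> \<equiv> reedy_dist_law R P N M"
abbreviation "bialg \<equiv> bialgebras D F.T G.K \<chi>"
abbreviation "cmp \<equiv> bialgebra_of_diag R P N M"

lemma reedy_bialgebras_eq: "reedy_bialgebras R P N M = bialgebra_cat D F.T G.K \<chi>"
  by (simp add: reedy_bialgebras_def)

text \<open>In this form a bialgebra is a functor on \<open>P\<close> and a functor on
  \<open>N\<close> with common values on objects, joined by an exchange rule.\<close>

lemma bialgebra_iff: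
  "(X, a, k) \<in> bialg \<longleftrightarrow> a \<in> F.actions \<and> ntgt a = X \<and> k \<in> G.coactions \<and> nsrc k = X \<and>
    (\<forall>x\<in>Obj R. F.act a (Id R x) = Id M (omap X x)) \<and>
    (\<forall>f\<in>P. \<forall>g\<in>P. Cod R f = Dom R g \<longrightarrow> F.act a (g \<cdot>\<^bsub>R\<^esub> f) = F.act a g \<cdot> F.act a f) \<and>
    (\<forall>x\<in>Obj R. G.coact k (Id R x) = Id M (omap X x)) \<and>
    (\<forall>f\<in>N. \<forall>g\<in>N. Cod R f = Dom R g \<longrightarrow> G.coact k (g \<cdot>\<^bsub>R\<^esub> f) = G.coact k g \<cdot> G.coact k f) \<and>
    (\<forall>f\<in>P. \<forall>g\<in>N. Cod R f = Dom R g \<longrightarrow>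
       (case factor (g \<cdot>\<^bsub>R\<^esub> f) of (i, q) \<Rightarrow> G.coact k g \<cdot> F.act a f = F.act a i \<cdot> G.coact k q))"
proof (cases "a \<in> F.actions \<and> ntgt a = X \<and> k \<in> G.coactions \<and> nsrc k = X")
  case True
  then have a: "a \<in> F.actions" "ntgt a = X" and k: "k \<in> G.coactions" "nsrc k = X" by auto
  show ?thesis
    using F.is_algebra_iff[OF a(1)] G.is_coalgebra_iff[OF k(1)] bialgebra_law_iff[OF a k] a k
    by (simp only: bialgebras_def a k mem_Collect_eq case_prod_conv wide_simps conj_assoc simp_thms)
next
  case False
  then show ?thesis
    using F.algebra_actions[of X a] G.coalgebra_coactions[of X k] by (auto simp: bialgebras_def)
qed

lemma functor_Rp: "is_functor R M \<Phi> \<Longrightarrow> is_functor Rp M (restr_diag Rp \<Phi>)"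
  and functor_Rn: "is_functor R M \<Phi> \<Longrightarrow> is_functor Rn M (restr_diag Rn \<Phi>)"
  by (rule functor_restr; use F.J.category_axioms G.J.category_axioms in auto)+

lemma restr_restr: "restr_diag (ids R) (restr_diag Rp \<Phi>) = restr_diag (ids R) \<Phi>"
    "restr_diag (ids R) (restr_diag Rn \<Phi>) = restr_diag (ids R) \<Phi>"
  unfolding restr_diag_def[of "ids R"] by (rule mk_functor_cong; auto)+

lemma cmp_eq: "cmp \<Phi> = (restr_diag (ids R) \<Phi>, F.alg (restr_diag Rp \<Phi>), G.coalg (restr_diag Rn \<Phi>))"
  by (simp add: bialgebra_of_diag_def F.alg_def G.coalg_def)

lemma cmp_data:
  assumes \<Phi>: "is_functor R M \<Phi>"
  shows "F.alg (restr_diag Rp \<Phi>) \<in> F.actions" "ntgt (F.alg (restr_diag Rp \<Phi>)) = restr_diag (ids R) \<Phi>"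
    "G.coalg (restr_diag Rn \<Phi>) \<in> G.coactions" "nsrc (G.coalg (restr_diag Rn \<Phi>)) = restr_diag (ids R) \<Phi>"
    "f \<in> P \<Longrightarrow> F.act (F.alg (restr_diag Rp \<Phi>)) f = amap \<Phi> f"
    "g \<in> N \<Longrightarrow> G.coact (G.coalg (restr_diag Rn \<Phi>)) g = amap \<Phi> g"
  using F.alg_actions[OF functor_Rp[OF \<Phi>]] F.alg(3)[OF functor_Rp[OF \<Phi>]] G.coalg[OF functor_Rn[OF \<Phi>]]
    F.act_alg[OF functor_Rp[OF \<Phi>], of f] G.coalg(3)[OF functor_Rn[OF \<Phi>], of g]
  by (simp_all add: restr_restr)

lemma functor_factor:
  assumes "is_functor R M \<Phi>" "f \<in> Arr R" "factor f = (i, q)"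
  shows "amap \<Phi> f = amap \<Phi> i \<cdot> amap \<Phi> q"
proof -
  have "i \<in> P" "q \<in> N" "Cod R q = Dom R i" "f = i \<cdot>\<^bsub>R\<^esub> q"
    using factorE[OF assms(2)] assms(3) by (metis prod.inject)+
  then show ?thesis by (simp add: functor_comp[OF assms(1)])
qed

text \<open>For a diagram, both sides of the exchange rule are its value at the composite, computed
  from two factorisations of it.\<close>

lemma cmp_bialg:
  assumes \<Phi>: "is_functor R M \<Phi>"
  shows "cmp \<Phi> \<in> bialg"
  unfolding cmp_eq bialgebra_iff
proof (intro conjI ballI impI)
  fix f g assume fg: "f \<in> P" "g \<in> N" "Cod R f = Dom R g"
  let ?a = "F.alg (restr_diag Rp \<Phi>)" and ?k = "G.coalg (restr_diag Rn \<Phi>)"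
  have gf: "g \<cdot>\<^bsub>R\<^esub> f \<in> Arr R" using fg by simp
  obtain i q where iq: "factor (g \<cdot>\<^bsub>R\<^esub> f) = (i, q)" "i \<in> P" "q \<in> N" using factorE[OF gf] by metis
  show "case factor (g \<cdot>\<^bsub>R\<^esub> f) of (i, q) \<Rightarrow> G.coact ?k g \<cdot> F.act ?a f = F.act ?a i \<cdot> G.coact ?k q"
    using functor_factor[OF \<Phi> gf iq(1)] fg iq by (simp add: cmp_data[OF \<Phi>] functor_comp[OF \<Phi>])
qed (use \<Phi> in \<open>simp_all add: cmp_data functor_Id functor_comp\<close>)

text \<open>The value of a diagram at an arrow is determined by its values at the two Reedy factors,
  which are components of the algebra and of the coalgebra.\<close>

lemma cmp_inj:
  assumes \<Phi>: "is_functor R M \<Phi>" and \<Psi>: "is_functor R M \<Psi>" and eq: "cmp \<Phi> = cmp \<Psi>"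
  shows "\<Phi> = \<Psi>"
proof (rule functor_eqI[OF \<Phi> \<Psi>])
  have eq': "restr_diag (ids R) \<Phi> = restr_diag (ids R) \<Psi>" "F.alg (restr_diag Rp \<Phi>) = F.alg (restr_diag Rp \<Psi>)"
    "G.coalg (restr_diag Rn \<Phi>) = G.coalg (restr_diag Rn \<Psi>)"
    using eq by (simp_all add: cmp_eq)
  show "omap \<Phi> x = omap \<Psi> x" if "x \<in> Obj R" for x
    using arg_cong[OF eq'(1), of "\<lambda>F. omap F x"] that by simp
  fix f assume f: "f \<in> Arr R"
  obtain i q where iq: "factor f = (i, q)" "i \<in> P" "q \<in> N" using factorE[OF f] by metis
  have "amap \<Phi> i = amap \<Psi> i" "amap \<Phi> q = amap \<Psi> q"
    using cmp_data(5)[OF \<Phi> iq(2)] cmp_data(5)[OF \<Psi> iq(2)] cmp_data(6)[OF \<Phi> iq(3)] cmp_data(6)[OF \<Psi> iq(3)] eq'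
    by simp_all
  then show "amap \<Phi> f = amap \<Psi> f"
    using functor_factor[OF \<Phi> f iq(1)] functor_factor[OF \<Psi> f iq(1)] by simp
qed

lemma cmp_surj:
  assumes "(X, a, k) \<in> bialg"
  shows "\<exists>\<Phi>. is_functor R M \<Phi> \<and> cmp \<Phi> = (X, a, k)"
proof -
  have a: "a \<in> F.actions" "ntgt a = X" and k: "k \<in> G.coactions" "nsrc k = X"
    using assms by (simp_all add: bialgebra_iff)
  have a': "is_ntr (ids R) M a" using a by (simp add: F.actions_def)
  have X: "is_functor (ids R) M X" using ntr_tgt[OF a'] a by simp
  have Id: "F.act a (Id R x) = Id M (omap X x)" "G.coact k (Id R x) = Id M (omap X x)" if "x \<in> Obj R" for x
    using assms that by (simp_all add: bialgebra_iff)
  have act_comp: "F.act a (g \<cdot>\<^bsub>R\<^esub> f) = F.act a g \<cdot> F.act a f" if "f \<in> P" "g \<in> P" "Cod R f = Dom R g" for f g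
    using assms that by (simp add: bialgebra_iff)
  have coact_comp: "G.coact k (g \<cdot>\<^bsub>R\<^esub> f) = G.coact k g \<cdot> G.coact k f" if "f \<in> N" "g \<in> N" "Cod R f = Dom R g" for f g
    using assms that by (simp add: bialgebra_iff)
  have law: "G.coact k g \<cdot> F.act a f = F.act a i \<cdot> G.coact k q"
    if "f \<in> P" "g \<in> N" "Cod R f = Dom R g" "factor (g \<cdot>\<^bsub>R\<^esub> f) = (i, q)" for f g i q
  proof -
    have "\<forall>f\<in>P. \<forall>g\<in>N. Cod R f = Dom R g \<longrightarrow>
       (case factor (g \<cdot>\<^bsub>R\<^esub> f) of (i, q) \<Rightarrow> G.coact k g \<cdot> F.act a f = F.act a i \<cdot> G.coact k q)"
      using assms unfolding bialgebra_iff by (elim conjE) assumption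
    from bspec[OF bspec[OF this that(1)] that(2)] that(3,4) show ?thesis by simp
  qed
  have act: "F.act a f \<in> Arr M" "Dom M (F.act a f) = omap X (Dom R f)" "Cod M (F.act a f) = omap X (Cod R f)" if "f \<in> P" for f
    using F.act[OF a(1), of f] that a by simp_all
  have coact: "G.coact k f \<in> Arr M" "Dom M (G.coact k f) = omap X (Dom R f)" "Cod M (G.coact k f) = omap X (Cod R f)" if "f \<in> N" for f
    using G.coact[OF k(1), of f] that k by simp_all
  \<comment> \<open>The only possible extension: coact along the inverse factor, then act along the
    direct one.\<close>
  define \<phi> where "\<phi> f = (case factor f of (i, q) \<Rightarrow> F.act a i \<cdot> G.coact k q)" for f
  have \<phi>: "\<phi> f \<in> Arr M \<and> Dom M (\<phi> f) = omap X (Dom R f) \<and> Cod M (\<phi> f) = omap X (Cod R f)" if f: "f \<in> Arr R" for f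
    by (rule factorE[OF f]) (simp add: \<phi>_def act coact)
  have \<phi>P: "\<phi> f = F.act a f" if "f \<in> P" for f
    using that act[of f] by (simp add: \<phi>_def factor_P Id)
  have \<phi>N: "\<phi> f = G.coact k f" if "f \<in> N" for f
    using that coact[of f] by (simp add: \<phi>_def factor_N Id)
  have \<phi>_comp: "\<phi> (g \<cdot>\<^bsub>R\<^esub> f) = \<phi> g \<cdot> \<phi> f" if fg: "f \<in> Arr R" "g \<in> Arr R" "Cod R f = Dom R g" for f g
  proof -
    obtain i q where iq: "factor f = (i, q)" "i \<in> P" "q \<in> N" "Cod R q = Dom R i" "f = i \<cdot>\<^bsub>R\<^esub> q" "Cod R i = Cod R f"
      using factorE[OF fg(1)] by metis
    obtain i' q' where iq': "factor g = (i', q')" "i' \<in> P" "q' \<in> N" "Cod R q' = Dom R i'" "g = i' \<cdot>\<^bsub>R\<^esub> q'" "Dom R q' = Dom R g"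
      using factorE[OF fg(2)] by metis
    have m: "Cod R i = Dom R q'" using iq(6) iq'(6) fg(3) by simp
    then have q'i: "q' \<cdot>\<^bsub>R\<^esub> i \<in> Arr R" "Dom R (q' \<cdot>\<^bsub>R\<^esub> i) = Dom R i" "Cod R (q' \<cdot>\<^bsub>R\<^esub> i) = Cod R q'"
      using iq(2-4) iq'(2-4) by simp_all
    obtain j p where jp: "factor (q' \<cdot>\<^bsub>R\<^esub> i) = (j, p)" "j \<in> P" "p \<in> N" "Cod R p = Dom R j" "q' \<cdot>\<^bsub>R\<^esub> i = j \<cdot>\<^bsub>R\<^esub> p"
      "Dom R p = Dom R i" "Cod R j = Cod R q'"
      using factorE[OF q'i(1)] q'i(2,3) by metis
    have "g \<cdot>\<^bsub>R\<^esub> f = i' \<cdot>\<^bsub>R\<^esub> ((q' \<cdot>\<^bsub>R\<^esub> i) \<cdot>\<^bsub>R\<^esub> q)"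
      unfolding iq(5) iq'(5) using iq(2-4) iq'(2-4) m by simp
    also have "\<dots> = (i' \<cdot>\<^bsub>R\<^esub> j) \<cdot>\<^bsub>R\<^esub> (p \<cdot>\<^bsub>R\<^esub> q)"
      unfolding jp(5) using iq(2-4) iq'(2-4) jp(2-4,6,7) by simp
    finally have "factor (g \<cdot>\<^bsub>R\<^esub> f) = (i' \<cdot>\<^bsub>R\<^esub> j, p \<cdot>\<^bsub>R\<^esub> q)"
      using factor_eq[of "i' \<cdot>\<^bsub>R\<^esub> j" "p \<cdot>\<^bsub>R\<^esub> q"] iq(2-4) iq'(2-4) jp(2-4,6,7) by simp
    then have "\<phi> (g \<cdot>\<^bsub>R\<^esub> f) = F.act a i' \<cdot> ((F.act a j \<cdot> G.coact k p) \<cdot> G.coact k q)"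
      using iq(2-4) iq'(2-4) jp(2-4,6,7) by (simp add: \<phi>_def act_comp coact_comp act coact)
    also have "\<dots> = F.act a i' \<cdot> ((G.coact k q' \<cdot> F.act a i) \<cdot> G.coact k q)"
      using law[OF iq(2) iq'(3) m jp(1)] by simp
    also have "\<dots> = \<phi> g \<cdot> \<phi> f"
      using iq(1-4) iq'(1-4) m by (simp add: \<phi>_def act coact)
    finally show ?thesis .
  qed
  define \<Phi> where "\<Phi> = mk_functor R (omap X) \<phi>"
  have \<Phi>: "is_functor R M \<Phi>"
    unfolding \<Phi>_def
    by (rule mk_functor_is_functorI[OF R.category_axioms]) (use X \<phi> \<phi>_comp \<phi>P Id in simp_all)
  have "restr_diag (ids R) \<Phi> = X"
  proof (rule functor_eqI[OF R.functor_ids[OF \<Phi>] X])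
    fix f assume "f \<in> Arr (ids R)"
    then obtain x where "x \<in> Obj R" "f = Id R x" by auto
    then show "amap (restr_diag (ids R) \<Phi>) f = amap X f"
      using functor_Id[OF X, of x] by (simp add: \<Phi>_def \<phi>P Id)
  qed (simp add: \<Phi>_def)
  moreover from this have "F.alg (restr_diag Rp \<Phi>) = a"
    by (intro F.actions_eqI) (use a cmp_data[OF \<Phi>] in \<open>simp_all add: \<Phi>_def \<phi>P\<close>)
  moreover from \<open>restr_diag (ids R) \<Phi> = X\<close> have "G.coalg (restr_diag Rn \<Phi>) = k"
    by (intro G.coactions_eqI) (use k cmp_data[OF \<Phi>] in \<open>simp_all add: \<Phi>_def \<phi>N\<close>)
  ultimately show ?thesis using \<Phi> by (auto simp: cmp_eq)
qed

text \<open>Compatibility with the algebras is naturality along \<open>P\<close>, compatibility with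
  the coalgebras is naturality along \<open>N\<close>. Since every arrow factors through both,
  pasting the two squares gives naturality on all of \<open>R\<close>.\<close>

lemma cmp_arrow_iff:
  assumes \<Phi>: "is_functor R M \<Phi>" and \<Psi>: "is_functor R M \<Psi>"
  shows "(cmp \<Phi>, t, cmp \<Psi>) \<in> Arr (bialgebra_cat D F.T G.K \<chi>) \<longleftrightarrow>
    is_ntr (ids R) M t \<and> nsrc t = restr_diag (ids R) \<Phi> \<and> ntgt t = restr_diag (ids R) \<Psi> \<and>
    (\<forall>f\<in>Arr R. amap \<Psi> f \<cdot> ncmp t (Dom R f) = ncmp t (Cod R f) \<cdot> amap \<Phi> f)"
proof (cases "is_ntr (ids R) M t \<and> nsrc t = restr_diag (ids R) \<Phi> \<and> ntgt t = restr_diag (ids R) \<Psi>")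
  case True
  then have t: "is_ntr (ids R) M t" "nsrc t = restr_diag (ids R) \<Phi>" "ntgt t = restr_diag (ids R) \<Psi>" by auto
  note d = cmp_data[OF \<Phi>] and e = cmp_data[OF \<Psi>]
  have A: "t \<cdot>\<^bsub>D\<^esub> F.alg (restr_diag Rp \<Phi>) = F.alg (restr_diag Rp \<Psi>) \<cdot>\<^bsub>D\<^esub> amap (mfun F.T) t \<longleftrightarrow>
      (\<forall>f\<in>P. ncmp t (Cod R f) \<cdot> amap \<Phi> f = amap \<Psi> f \<cdot> ncmp t (Dom R f))"
    using t d e by (subst F.commutes_iff) simp_all
  have B: "G.coalg (restr_diag Rn \<Psi>) \<cdot>\<^bsub>D\<^esub> t = amap (cfun G.K) t \<cdot>\<^bsub>D\<^esub> G.coalg (restr_diag Rn \<Phi>) \<longleftrightarrow>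
      (\<forall>g\<in>N. amap \<Psi> g \<cdot> ncmp t (Dom R g) = ncmp t (Cod R g) \<cdot> amap \<Phi> g)"
    using t d e by (subst G.cocommutes_iff) simp_all
  have arr: "(cmp \<Phi>, t, cmp \<Psi>) \<in> Arr (bialgebra_cat D F.T G.K \<chi>) \<longleftrightarrow>
    t \<cdot>\<^bsub>D\<^esub> F.alg (restr_diag Rp \<Phi>) = F.alg (restr_diag Rp \<Psi>) \<cdot>\<^bsub>D\<^esub> amap (mfun F.T) t \<and>
    G.coalg (restr_diag Rn \<Psi>) \<cdot>\<^bsub>D\<^esub> t = amap (cfun G.K) t \<cdot>\<^bsub>D\<^esub> G.coalg (restr_diag Rn \<Phi>)"
    using t cmp_bialg[OF \<Phi>] cmp_bialg[OF \<Psi>] unfolding cmp_eq bialgebra_cat_simps by (simp add: in_hom)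
  have "amap \<Psi> f \<cdot> ncmp t (Dom R f) = ncmp t (Cod R f) \<cdot> amap \<Phi> f"
    if p: "\<forall>f\<in>P. ncmp t (Cod R f) \<cdot> amap \<Phi> f = amap \<Psi> f \<cdot> ncmp t (Dom R f)"
      and n: "\<forall>g\<in>N. amap \<Psi> g \<cdot> ncmp t (Dom R g) = ncmp t (Cod R g) \<cdot> amap \<Phi> g" and f: "f \<in> Arr R" for f
  proof -
    obtain i q where iq: "factor f = (i, q)" "i \<in> P" "q \<in> N" "Cod R q = Dom R i" "Dom R q = Dom R f" "Cod R i = Cod R f"
      using factorE[OF f] by metis
    have i: "i \<in> Arr R" "q \<in> Arr R" using iq by simp_all
    have tA: "ncmp t x \<in> Arr M" "Dom M (ncmp t x) = omap \<Phi> x" "Cod M (ncmp t x) = omap \<Psi> x" if "x \<in> Obj R" for x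
      using t that by simp_all
    have "amap \<Psi> f \<cdot> ncmp t (Dom R f) = amap \<Psi> i \<cdot> (amap \<Psi> q \<cdot> ncmp t (Dom R q))"
      using functor_factor[OF \<Psi> f iq(1)] i iq \<Psi> tA f by simp
    also have "\<dots> = amap \<Psi> i \<cdot> (ncmp t (Dom R i) \<cdot> amap \<Phi> q)"
      using n[rule_format, OF iq(3)] iq(4) by simp
    also have "\<dots> = (ncmp t (Cod R i) \<cdot> amap \<Phi> i) \<cdot> amap \<Phi> q"
      using p[rule_format, OF iq(2)] i iq \<Phi> \<Psi> tA by (intro M.comp_comp_eq) simp_all
    also have "\<dots> = ncmp t (Cod R f) \<cdot> amap \<Phi> f"
      using functor_factor[OF \<Phi> f iq(1)] i iq \<Phi> tA f by simp
    finally show ?thesis .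
  qed
  then show ?thesis
    unfolding arr A B using t by auto
next
  case False
  then show ?thesis unfolding cmp_eq bialgebra_cat_simps by (auto simp: in_hom)
qed

theorem comparison_iso:
  "is_iso_functor (fun_cat R M) (reedy_bialgebras R P N M) (comparison_functor R P N M)"
proof -
  let ?B = "bialgebra_cat D F.T G.K \<chi>" and ?C = "comparison_functor R P N M"
  have o: "omap ?C \<Phi> = cmp \<Phi>" if "is_functor R M \<Phi>" for \<Phi>
    using that by (simp add: comparison_functor_def)
  have ar: "amap ?C \<tau> = (cmp (nsrc \<tau>), restr_ntr (ids R) \<tau>, cmp (ntgt \<tau>))" if "is_ntr R M \<tau>" for \<tau>
    using that by (simp add: comparison_functor_def amap_restriction)
  have arr: "(cmp (nsrc \<tau>), restr_ntr (ids R) \<tau>, cmp (ntgt \<tau>)) \<in> Arr ?B" if \<tau>: "is_ntr R M \<tau>" for \<tau>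
    unfolding cmp_arrow_iff[OF ntr_src[OF \<tau>] ntr_tgt[OF \<tau>]]
    using R.ntr_ids[OF \<tau>] ntr_nat[OF \<tau>] by simp
  note cat = category_fun_cat[OF R.category_axioms M.category_axioms]
  have "is_functor (fun_cat R M) ?B ?C"
    unfolding comparison_functor_def
  proof (rule mk_functor_is_functorI[OF cat])
    fix \<Phi> assume \<Phi>: "\<Phi> \<in> Obj (fun_cat R M)"
    then have i: "is_ntr R M (Id (fun_cat R M) \<Phi>)"
      using id_ntr[OF R.category_axioms M.category_axioms] by simp
    have "restr_ntr (ids R) (Id (fun_cat R M) \<Phi>) = Id D (restr_diag (ids R) \<Phi>)"
      unfolding restr_ntr_def by simp (rule mk_ntr_cong, simp)
    then show "(cmp (nsrc (Id (fun_cat R M) \<Phi>)), amap (restriction (ids R) R M) (Id (fun_cat R M) \<Phi>),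
        cmp (ntgt (Id (fun_cat R M) \<Phi>))) = Id ?B (cmp \<Phi>)"
      using \<Phi> unfolding amap_restriction[OF i] by (simp add: cmp_eq)
  next
    fix s t assume *: "s \<in> Arr (fun_cat R M)" "t \<in> Arr (fun_cat R M)" "Cod (fun_cat R M) s = Dom (fun_cat R M) t"
    then have st: "is_ntr R M (t \<cdot>\<^bsub>fun_cat R M\<^esub> s)"
      using comp_ntr[OF R.category_axioms M.category_axioms] by simp
    have "restr_ntr (ids R) (t \<cdot>\<^bsub>fun_cat R M\<^esub> s) = restr_ntr (ids R) t \<cdot>\<^bsub>D\<^esub> restr_ntr (ids R) s"
      unfolding restr_ntr_def by simp (rule mk_ntr_cong, simp)
    then show "(cmp (nsrc (t \<cdot>\<^bsub>fun_cat R M\<^esub> s)), amap (restriction (ids R) R M) (t \<cdot>\<^bsub>fun_cat R M\<^esub> s),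
        cmp (ntgt (t \<cdot>\<^bsub>fun_cat R M\<^esub> s))) =
      (cmp (nsrc t), amap (restriction (ids R) R M) t, cmp (ntgt t)) \<cdot>\<^bsub>?B\<^esub>
      (cmp (nsrc s), amap (restriction (ids R) R M) s, cmp (ntgt s))"
      using * amap_restriction[OF st, of "ids R"] by (simp add: amap_restriction)
  qed (use arr cmp_bialg in \<open>simp_all add: amap_restriction\<close>)
  moreover have "bij_betw (omap ?C) (Obj (fun_cat R M)) (Obj ?B)"
    unfolding bij_betw_def inj_on_def
  proof (intro conjI ballI impI subset_antisym subsetI)
    fix A assume "A \<in> Obj ?B"
    moreover obtain X a k where "A = (X, a, k)" by (cases A)
    ultimately obtain \<Phi> where "is_functor R M \<Phi>" "cmp \<Phi> = A" using cmp_surj[of X a k] by auto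
    then show "A \<in> omap ?C ` Obj (fun_cat R M)" using o by (intro image_eqI[of _ _ \<Phi>]) simp_all
  qed (use o cmp_inj cmp_bialg in auto)
  moreover have "bij_betw (amap ?C) (Arr (fun_cat R M)) (Arr ?B)"
    unfolding bij_betw_def
  proof (intro conjI inj_onI subset_antisym subsetI)
    fix s t assume *: "s \<in> Arr (fun_cat R M)" "t \<in> Arr (fun_cat R M)" "amap ?C s = amap ?C t"
    then have s: "is_ntr R M s" and t: "is_ntr R M t" by simp_all
    have eq: "cmp (nsrc s) = cmp (nsrc t)" "cmp (ntgt s) = cmp (ntgt t)" "restr_ntr (ids R) s = restr_ntr (ids R) t"
      using *(3) by (simp_all add: ar s t)
    show "s = t"
    proof (rule ntr_eqI[OF s t])
      show "nsrc s = nsrc t" "ntgt s = ntgt t"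
        using s t eq by (intro cmp_inj; simp)+
      show "ncmp s x = ncmp t x" if "x \<in> Obj R" for x
        using arg_cong[OF eq(3), of "\<lambda>t. ncmp t x"] that by simp
    qed
  next
    fix f assume f: "f \<in> Arr ?B"
    obtain X a k t Y b l where f_eq: "f = ((X, a, k), t, (Y, b, l))" by (cases f) auto
    then have "(X, a, k) \<in> bialg" "(Y, b, l) \<in> bialg" using f by simp_all
    then obtain \<Phi> \<Psi> where \<Phi>: "is_functor R M \<Phi>" "cmp \<Phi> = (X, a, k)" and \<Psi>: "is_functor R M \<Psi>" "cmp \<Psi> = (Y, b, l)"
      using cmp_surj by metis
    have t: "is_ntr (ids R) M t" "nsrc t = restr_diag (ids R) \<Phi>" "ntgt t = restr_diag (ids R) \<Psi>"
      "\<And>f. f \<in> Arr R \<Longrightarrow> amap \<Psi> f \<cdot> ncmp t (Dom R f) = ncmp t (Cod R f) \<cdot> amap \<Phi> f"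
      \<comment> \<open>The simplification rule for arrows of the bialgebra category is switched
        off, so that membership keeps the form to which \<open>cmp_arrow_iff\<close>
        applies.\<close>
      using f cmp_arrow_iff[OF \<Phi>(1) \<Psi>(1), of t] by (simp_all add: f_eq \<Phi>(2) \<Psi>(2) del: bialgebra_cat_simps(6))
    define \<tau> where "\<tau> = mk_ntr R \<Phi> \<Psi> (ncmp t)"
    have \<tau>: "is_ntr R M \<tau>"
      unfolding \<tau>_def by (rule mk_ntr_is_ntrI[OF R.category_axioms \<Phi>(1) \<Psi>(1)]) (use t in simp_all)
    have "restr_ntr (ids R) \<tau> = t"
      by (rule ntr_eqI[OF R.ntr_ids[OF \<tau>] t(1)]) (simp_all add: \<tau>_def t)
    then have "f = amap ?C \<tau>"
      using ar[OF \<tau>] by (simp add: f_eq \<tau>_def \<Phi>(2) \<Psi>(2))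
    then show "f \<in> amap ?C ` Arr (fun_cat R M)" using \<tau> by simp
  qed (use ar arr in auto)
  ultimately show ?thesis
    unfolding reedy_bialgebras_eq by (intro bij_functor_is_iso cat)
qed

end

section \<open>The two induced structures\<close>

lemma objectwise_Int: "objectwise J C A \<inter> objectwise J C B = objectwise J C (A \<inter> B)"
  by (auto simp: objectwise_def)

text \<open>A wide subcategory has all the objects, so an objectwise condition is unchanged by
  restriction. This settles the weak equivalences on both sides.\<close>

lemma objectwise_restr_iff:
  assumes "category (wide R A)" "A \<subseteq> Arr R" "is_ntr R M \<tau>"
  shows "amap (restriction (wide R A) R M) \<tau> \<in> objectwise (wide R A) M W \<longleftrightarrow> \<tau> \<in> objectwise R M W"
  using ntr_restr[OF assms] assms(3) by (simp add: objectwise_def amap_restriction)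

theorem proposition7p1p10:
  fixes R :: "('u::infinite, 'u) cat" and d :: "'u \<Rightarrow> nat" and P N :: "'u set"
    and M :: "('o, 'm) cat" and S :: "'m mstruct"
  assumes "reedy_category R d P N"
    and "model_category TYPE('u) M S"
  shows "is_iso_functor (fun_cat R M) (reedy_bialgebras R P N M) (comparison_functor R P N M) \<and>
    left_induced (fun_cat R M) (reedy_structure R d P N M S)
      (projective_structure (wide R P) M S) (restriction (wide R P) R M) \<and>
    right_induced (fun_cat R M) (reedy_structure R d P N M S)
      (injective_structure (wide R N) M S) (restriction (wide R N) R M)"
proof -
  have M: "category M" "complete TYPE('u) M" "cocomplete TYPE('u) M" and S: "model_structure M S"
    using assms(2) by (simp_all add: model_category_def)
  interpret reedy_diagrams M "TYPE('u)" R d P N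
    using M assms(1)
    by (intro reedy_diagrams.intro reedy_diagrams_axioms.intro cocomplete_category.intro cocomplete_category_axioms.intro
        complete_category.intro complete_category_axioms.intro)
  have sub: "Cof S \<subseteq> Arr M" "Fib S \<subseteq> Arr M"
    using S by (simp_all add: model_structure_def)
  have wfs: "Cof S \<inter> WE S = LLP M (Fib S)" "Fib S = RLP M (Cof S \<inter> WE S)"
    "Cof S = LLP M (Fib S \<inter> WE S)" "Fib S \<inter> WE S = RLP M (Cof S)"
    using S unfolding model_structure_def weak_factorization_system_def by blast+
  have raises: "f \<in> P \<Longrightarrow> f \<notin> Id R ` Obj R \<Longrightarrow> d (Dom R f) < d (Cod R f)"
    and lowers: "f \<in> N \<Longrightarrow> f \<notin> Id R ` Obj R \<Longrightarrow> d (Cod R f) < d (Dom R f)" for f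
    using assms(1) unfolding reedy_category_def by blast+
  have PA: "P \<subseteq> Arr R" and NA: "N \<subseteq> Arr R" by auto
  \<comment> \<open>The lifting criterion is applied with \<open>B = Cof S\<close>: then
    \<open>RLP M B\<close> is the class of trivial fibrations, whose left lifting class is
    \<open>Cof S\<close> again.\<close>
  have cof: "amap (restriction Rp R M) \<tau> \<in> LLP (fun_cat Rp M) (objectwise Rp M (Fib S) \<inter> objectwise Rp M (WE S)) \<longleftrightarrow>
    (\<forall>r\<in>Obj R. relative_latching_map R d P M \<tau> r \<in> Cof S)" if \<tau>: "is_ntr R M \<tau>" for \<tau>
    using latching_LLP_restriction_iff[OF R.category_axioms wide_P raises M \<tau> sub(1), of "relative_latching_map R d P M \<tau>"]
    unfolding amap_restriction[OF \<tau>] objectwise_Int wfs(4)[symmetric] wfs(3)[symmetric] by blast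
  \<comment> \<open>Here \<open>B = Fib S\<close>: then \<open>LLP M B\<close> is the class of
    trivial cofibrations, whose right lifting class is \<open>Fib S\<close> again.\<close>
  have fib: "amap (restriction Rn R M) \<tau> \<in> RLP (fun_cat Rn M) (objectwise Rn M (Cof S) \<inter> objectwise Rn M (WE S)) \<longleftrightarrow>
    (\<forall>r\<in>Obj R. relative_matching_map R d N M \<tau> r \<in> Fib S)" if \<tau>: "is_ntr R M \<tau>" for \<tau>
    using matching_RLP_restriction_iff[OF R.category_axioms wide_N lowers M \<tau> sub(2)]
    unfolding amap_restriction[OF \<tau>] objectwise_Int wfs(1)[symmetric] wfs(2)[symmetric] by blast
  have we: "\<tau> \<in> objectwise R M (WE S) \<longleftrightarrow> is_ntr R M \<tau> \<and> amap (restriction Rp R M) \<tau> \<in> objectwise Rp M (WE S)"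
    "\<tau> \<in> objectwise R M (WE S) \<longleftrightarrow> is_ntr R M \<tau> \<and> amap (restriction Rn R M) \<tau> \<in> objectwise Rn M (WE S)" for \<tau>
    using objectwise_restr_iff[OF F.J.category_axioms PA, of M \<tau>] objectwise_restr_iff[OF G.J.category_axioms NA, of M \<tau>]
    by (auto simp: objectwise_def)
  have "left_induced (fun_cat R M) (reedy_structure R d P N M S) (projective_structure Rp M S) (restriction Rp R M)"
    using cof we(1) by (auto simp: left_induced_def reedy_structure_def projective_structure_def)
  moreover have "right_induced (fun_cat R M) (reedy_structure R d P N M S) (injective_structure Rn M S) (restriction Rn R M)"
    using fib we(2) by (auto simp: right_induced_def reedy_structure_def injective_structure_def)
  ultimately show ?thesis
    using comparison_iso by blast
qed

end
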